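(* Let $(P,\Phi)$ be a logarithmic $G$-Higgs bundle on $(C,D)$ with nilpotent residues, belonging to the fibre of $\mathcal M^{\mathrm{nil}}_{\mathrm{Dol}}(G)$ over $(C,D)$. Let $Y\in H^1(C,T_C(-D))$ be represented by $(\mu,\xi_1,\ldots,\xi_r)$, where $\mu$ is a Beltrami differential on $C^\circ=C\setminus D$ and $\xi_i$ is a local holomorphic vector field near $p_i$. Then $$\phi_{G,\log}(Y)=-\frac12\left[\int_{C^\circ} B(\Phi,\Phi)\mu+\sum_{i=1}^{r}\operatorname{Res}_{p_i}\bigl(B(\Phi,\Phi)\xi_i\bigr)\right].$$
   Context: $C$ is a compact Riemann surface of genus $g\geq 2$ with canonical bundle $K_C$ and tangent bundle $T_C$; $D=p_1+\cdots+p_r$ is a reduced divisor. $G$ is a connected complex reductive group with Lie algebra $\mathfrak g=\mathfrak z(\mathfrak g)\oplus[\mathfrak g,\mathfrak g]$, and $B:\mathfrak g\otimes\mathfrak g\to\mathbb C$ is a fixed invariant nondegenerate symmetric bilinear form. A logarithmic $G$-Higgs bundle on $(C,D)$ is a pair $(P,\Phi)$ where $P$ is a holomorphic principal $G$-bundle on $C$ and $\Phi\in H^0(C,\operatorname{ad}(P)\otimes K_C(D))$, with $\operatorname{ad}(P)=P\times^G\mathfrak g$. Locally at $p_i$, $\Phi=\left(\frac{N_i}{z}+A_i(z)\right)dz$ with $A_i$ holomorphic; $N_i=\operatorname{Res}_{p_i}(\Phi)$. An element of $\mathfrak g$ is nilpotent if its component in $\mathfrak z(\mathfrak g)$ is zero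 and its component in $[\mathfrak g,\mathfrak g]$ is nilpotent; $\Phi$ has nilpotent residues if every $N_i$ is nilpotent. $\mathcal M^{\mathrm{nil}}_{\mathrm{Dol}}(G)\to\mathcal T_{g,r}$ is a fixed smooth stable family over pointed Teichmüller space whose fibre over $(C,D)$ is a smooth stable locus in the moduli space of such bundles with fixed topological type and nilpotent residues. $T_{(C,D)}\mathcal T_{g,r}\cong H^1(C,T_C(-D))$, and by Serre duality $T^*_{(C,D)}\mathcal T_{g,r}\cong H^0(C,K_C^2(D))$, with pairing $\langle q,Y\rangle$. A class $Y$ may be represented in Čech–Dolbeault form by $(\mu,\xi_1,\ldots,\xi_r)$, where $\mu$ is a Beltrami differential on $C^\circ$ and $\xi_i$ is a local holomorphic vector field near $p_i$ whose value $\xi_i(p_i)\in T_{p_i}C$ is the tangent direction of the marked point $p_i$. For $q\in H^0(C,K_C^2(D))$ the Čech–Dolbeault form of the Serre pairing is, in the paper's convention, $$\langle q,Y\rangle=\int_{C^\circ}q\,\mu+\sum_{i=1}^r\operatorname{Res}_{p_i}(q\,\xi_i),$$ where $\operatorname{Res}_p(\alpha)$ is the coefficient of $dz/z$ of a meromorphic one-form $\alpha$ in a coordinate $z$ centred at $p$. For $(P,\Phi)$ with nilpotent residues one has $B(\Phi,\Phi)\in H^0(C,K_C^2(D))$ (locally $B(s,s)\,dz^2$ for $\Phi=s\,dz$), and the one-form $\phi_{G,\log}$ is defined by $\phi_{G,\log}(Y)=-\frac12\langle B(\Phi,\Phi),Y\rangle$.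
   Formalization: The integral over C° is read as the Serre trace, i.e. normalised by 1/(2πi), both in the pairing defining φ and in the formula; with the plain integral next to unnormalised residues the right side would depend on the representative (μ, ξ_1, …, ξ_r) of Y. *)

theory Defs
  imports "HOL-Homology.Homology" "HOL-Complex_Analysis.Complex_Analysis"
begin

section \<open>Compact Riemann surfaces\<close>

text \<open>A chart is a pair of an open set and a coordinate function; only the values of the
  coordinate function on the open set matter.\<close>

type_synonym 'c chart = "'c set \<times> ('c \<Rightarrow> complex)"

definition chart_inv :: "'c chart \<Rightarrow> complex \<Rightarrow> 'c" where
  "chart_inv c = inv_into (fst c) (snd c)"

definition complex_chart :: "'c::topological_space chart \<Rightarrow> bool" where
  "complex_chart c \<longleftrightarrow> open (fst c) \<and> open (snd c ` fst c) \<and>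
     homeomorphism (fst c) (snd c ` fst c) (snd c) (chart_inv c)"

definition transition :: "'c chart \<Rightarrow> 'c chart \<Rightarrow> complex \<Rightarrow> complex" where
  "transition c d = snd d \<circ> chart_inv c"

definition compatible :: "'c chart \<Rightarrow> 'c chart \<Rightarrow> bool" where
  "compatible c d \<longleftrightarrow>
     transition c d holomorphic_on snd c ` (fst c \<inter> fst d) \<and>
     transition d c holomorphic_on snd d ` (fst c \<inter> fst d)"

definition holomorphic_atlas :: "'c::topological_space chart set \<Rightarrow> bool" where
  "holomorphic_atlas A \<longleftrightarrow> (\<forall>c\<in>A. complex_chart c) \<and> (\<forall>c\<in>A. \<forall>d\<in>A. compatible c d) \<and>
     (\<Union>c\<in>A. fst c) = UNIV"

text \<open>The Riemann surface is the whole type \<open>'c\<close> with the complex structure given by the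
  atlas; \<open>coords A\<close> is the maximal atlas.\<close>

definition compact_riemann_surface :: "'c::t2_space chart set \<Rightarrow> bool" where
  "compact_riemann_surface A \<longleftrightarrow> holomorphic_atlas A \<and>
     compact (UNIV :: 'c set) \<and> connected (UNIV :: 'c set)"

definition coords :: "'c::topological_space chart set \<Rightarrow> 'c chart set" where
  "coords A = {c. complex_chart c \<and> (\<forall>d\<in>A. compatible c d)}"

definition has_genus :: "'c::topological_space itself \<Rightarrow> nat \<Rightarrow> bool" where
  "has_genus _ g \<longleftrightarrow>
     homology_group 1 (euclidean :: 'c topology) \<cong> free_Abelian_group {..<2 * g}"


section \<open>Tensor fields\<close>

text \<open>A field assigns to every chart \<open>c\<close> its coefficient, as a function of the point of the
  surface. A field of type \<open>(a, b)\<close> is a (not necessarily continuous) section of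
  $K^a \otimes \bar K^b$, written locally as $f\,dz^a\,d\bar z^b$: vector fields have type
  \<open>(-1, 0)\<close>, Beltrami differentials $\mu\, d\bar z\,\partial_z$ type \<open>(-1, 1)\<close>, quadratic
  differentials type \<open>(2, 0)\<close>. The product of two fields is the pointwise product of the
  coefficients.\<close>

type_synonym 'c field = "'c chart \<Rightarrow> 'c \<Rightarrow> complex"

definition local_rep :: "'c chart \<Rightarrow> ('c \<Rightarrow> 'b) \<Rightarrow> complex \<Rightarrow> 'b" where
  "local_rep c f = f \<circ> chart_inv c"

definition fmult :: "'c field \<Rightarrow> 'c field \<Rightarrow> 'c field" where
  "fmult f h = (\<lambda>c x. f c x * h c x)"

definition tensor_field ::
  "'c::topological_space chart set \<Rightarrow> int \<Rightarrow> int \<Rightarrow> 'c set \<Rightarrow> 'c field \<Rightarrow> bool" where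
  "tensor_field A a b S f \<longleftrightarrow>
     (\<forall>c\<in>coords A. \<forall>d\<in>coords A. \<forall>x \<in> fst c \<inter> fst d \<inter> S.
        f c x = f d x * deriv (transition c d) (snd c x) powi a
                      * cnj (deriv (transition c d) (snd c x)) powi b)"

text \<open>Infinitely real-differentiable: \<open>F m n\<close> is the partial derivative
  $\partial_x^m \partial_y^n f$.\<close>

definition smooth_fun_on :: "complex set \<Rightarrow> (complex \<Rightarrow> complex) \<Rightarrow> bool" where
  "smooth_fun_on S f \<longleftrightarrow> (\<exists>F :: nat \<Rightarrow> nat \<Rightarrow> complex \<Rightarrow> complex.
     (\<forall>z\<in>S. F 0 0 z = f z) \<and>
     (\<forall>m n. \<forall>z\<in>S. (F m n has_derivative
        (\<lambda>h. of_real (Re h) * F (Suc m) n z + of_real (Im h) * F m (Suc n) z)) (at z)))"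

definition smooth_field :: "'c::topological_space chart set \<Rightarrow> 'c set \<Rightarrow> 'c field \<Rightarrow> bool" where
  "smooth_field A S f \<longleftrightarrow> (\<forall>c\<in>coords A. smooth_fun_on (snd c ` (fst c \<inter> S)) (local_rep c (f c)))"

definition continuous_field :: "'c::topological_space chart set \<Rightarrow> 'c set \<Rightarrow> 'c field \<Rightarrow> bool" where
  "continuous_field A S f \<longleftrightarrow> (\<forall>c\<in>coords A. continuous_on (fst c \<inter> S) (f c))"

definition holomorphic_field :: "'c::topological_space chart set \<Rightarrow> 'c set \<Rightarrow> 'c field \<Rightarrow> bool" where
  "holomorphic_field A S f \<longleftrightarrow>
     (\<forall>c\<in>coords A. local_rep c (f c) holomorphic_on snd c ` (fst c \<inter> S))"

definition wirtinger_dbar :: "(complex \<Rightarrow> complex) \<Rightarrow> complex \<Rightarrow> complex" where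
  "wirtinger_dbar f z = (frechet_derivative f (at z) 1 + \<i> * frechet_derivative f (at z) \<i>) / 2"

definition dbar :: "'c field \<Rightarrow> 'c field" where
  "dbar f = (\<lambda>c x. wirtinger_dbar (local_rep c (f c)) (snd c x))"


section \<open>The integral of a (1,1)-form and residues\<close>

text \<open>The field \<open>w\<close> of type \<open>(1, 1)\<close> stands for the two-form $w\,dz\wedge d\bar z =
  -2i\,w\,dx\,dy$. It is integrated over \<open>S\<close> by cutting \<open>S\<close> into finitely many Borel pieces
  each contained in a chart.\<close>

definition has_form_integral ::
  "'c::topological_space chart set \<Rightarrow> 'c set \<Rightarrow> 'c field \<Rightarrow> complex \<Rightarrow> bool" where
  "has_form_integral A S w I \<longleftrightarrow> (\<exists>(n::nat) c E.
     (\<forall>k<n. c k \<in> coords A \<and> E k \<in> sets borel \<and> E k \<subseteq> fst (c k) \<and>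
        set_integrable lborel (snd (c k) ` E k) (local_rep (c k) (w (c k)))) \<and>
     disjoint_family_on E {..<n} \<and> (\<Union>k<n. E k) = S \<and>
     I = (\<Sum>k<n. - 2 * \<i> * (LINT z : snd (c k) ` E k | lborel. local_rep (c k) (w (c k)) z)))"

definition form_integral ::
  "'c::topological_space chart set \<Rightarrow> 'c set \<Rightarrow> 'c field \<Rightarrow> complex" where
  "form_integral A S w = (THE I. has_form_integral A S w I)"

text \<open>The integral sign in the Serre pairing denotes the Serre trace, i.e. the integral
  normalised by $1/(2\pi i)$. This is the normalisation, sign included, in which the trace is
  compatible with residues: if \<open>q\<close> is a quadratic differential with at most simple poles and
  \<open>\<eta>\<close> a smooth vector field, then
  $\frac{1}{2\pi i}\int q\,\bar\partial\eta = \sum_i \mathrm{Res}_{p_i}(q\,\eta(p_i))$.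
  Without it the expression $\int q\mu + \sum_i \mathrm{Res}_{p_i}(q\xi_i)$ depends on the
  choice of the representative $(\mu,\xi_i)$.\<close>

definition trace_integral ::
  "'c::topological_space chart set \<Rightarrow> 'c set \<Rightarrow> 'c field \<Rightarrow> complex" where
  "trace_integral A S w = form_integral A S w / (2 * of_real pi * \<i>)"

definition form_residue :: "'c::topological_space chart set \<Rightarrow> 'c \<Rightarrow> 'c field \<Rightarrow> complex" where
  "form_residue A x w =
     (let c = (SOME c. c \<in> coords A \<and> x \<in> fst c \<and> snd c x = 0)
      in residue (local_rep c (w c)) 0)"


section \<open>The cohomology group H^1(C, T(-D)) and the Serre pairing\<close>

text \<open>Smooth sections of $\mathcal L(-D)$, where $\mathcal L = K^a\otimes\bar K^b$: smooth
  sections of $\mathcal L$ which near each point of \<open>D\<close> are the product of a local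
  holomorphic equation of that point and a smooth section.\<close>

definition smooth_sections_vanishing ::
  "'c::topological_space chart set \<Rightarrow> 'c set \<Rightarrow> int \<Rightarrow> int \<Rightarrow> 'c field set" where
  "smooth_sections_vanishing A D a b = {f. tensor_field A a b UNIV f \<and> smooth_field A UNIV f \<and>
     (\<forall>c\<in>coords A. \<forall>x \<in> D \<inter> fst c. \<exists>\<rho>>0. \<exists>h. smooth_fun_on (ball (snd c x) \<rho>) h \<and>
        (\<forall>z \<in> ball (snd c x) \<rho> \<inter> snd c ` fst c. local_rep c (f c) z = (z - snd c x) * h z))}"

text \<open>$H^1(C,T_C(-D))$ as the Dolbeault cohomology
  $A^{0,1}(T_C(-D)) / \bar\partial A^{0}(T_C(-D))$.\<close>

definition dolbeault_rel ::
  "'c::topological_space chart set \<Rightarrow> 'c set \<Rightarrow> ('c field \<times> 'c field) set" where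
  "dolbeault_rel A D = {(\<nu>, \<nu>').
     \<nu> \<in> smooth_sections_vanishing A D (-1) 1 \<and> \<nu>' \<in> smooth_sections_vanishing A D (-1) 1 \<and>
     (\<exists>\<eta> \<in> smooth_sections_vanishing A D (-1) 0.
        \<forall>c\<in>coords A. \<forall>x\<in>fst c. \<nu> c x = \<nu>' c x + dbar \<eta> c x)}"

definition H1_tangent_log :: "'c::topological_space chart set \<Rightarrow> 'c set \<Rightarrow> 'c field set set" where
  "H1_tangent_log A D = smooth_sections_vanishing A D (-1) 1 // dolbeault_rel A D"

text \<open>Well defined for $q\in H^0(C,K_C^2(D))$.\<close>

definition serre_pairing ::
  "'c::topological_space chart set \<Rightarrow> 'c set \<Rightarrow> 'c field \<Rightarrow> 'c field set \<Rightarrow> complex" where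
  "serre_pairing A D q Y = trace_integral A (- D) (fmult q (SOME \<nu>. \<nu> \<in> Y))"

text \<open>Beltrami differentials on $C\setminus D$: smooth there and bounded near \<open>D\<close> (in the
  coordinates of $C$).\<close>

definition beltrami_differential ::
  "'c::topological_space chart set \<Rightarrow> 'c set \<Rightarrow> 'c field \<Rightarrow> bool" where
  "beltrami_differential A D \<mu> \<longleftrightarrow> tensor_field A (-1) 1 (- D) \<mu> \<and> smooth_field A (- D) \<mu> \<and>
     (\<forall>c\<in>coords A. \<forall>x \<in> D \<inter> fst c. \<exists>\<rho>>0. \<exists>K. \<forall>z \<in> (ball (snd c x) \<rho> - {snd c x}) \<inter> snd c ` fst c.
        norm (local_rep c (\<mu> c) z) \<le> K)"

definition local_holomorphic_vector_field ::
  "'c::topological_space chart set \<Rightarrow> 'c \<Rightarrow> 'c field \<Rightarrow> bool" where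
  "local_holomorphic_vector_field A x \<xi> \<longleftrightarrow>
     (\<exists>V. open V \<and> x \<in> V \<and> tensor_field A (-1) 0 V \<xi> \<and> holomorphic_field A V \<xi>)"

text \<open>\<open>(\<mu>, \<xi>\<^sub>1, \<dots>, \<xi>\<^sub>r)\<close> represents \<open>Y\<close>: the total complex computing $H^1(C,T_C(-D))$ is
  $A^0(T_C)\to A^{0,1}(T_C)\oplus\bigoplus_i T_{p_i}C$. A diffeomorphism moving along a vector
  field \<open>\<eta>\<close> changes the complex structure by $\bar\partial\eta$ and is undone by moving the
  marked points along $-\eta$, so $(\mu,\xi_i)\sim(\mu+\bar\partial\eta,\ \xi_i-\eta(p_i))$;
  a class of $T_C(-D)$-valued forms \<open>\<nu>\<close> is the class of \<open>(\<nu>, 0)\<close>. As \<open>\<mu>\<close> need not extend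
  smoothly over \<open>D\<close>, \<open>\<eta>\<close> is only required to be continuous there.\<close>

definition represents_class ::
  "'c::topological_space chart set \<Rightarrow> nat \<Rightarrow> (nat \<Rightarrow> 'c) \<Rightarrow> 'c field set \<Rightarrow>
   'c field \<Rightarrow> (nat \<Rightarrow> 'c field) \<Rightarrow> bool" where
  "represents_class A r p Y \<mu> \<xi> \<longleftrightarrow>
     (\<exists>\<nu>\<in>Y. \<exists>\<eta>. tensor_field A (-1) 0 UNIV \<eta> \<and> continuous_field A UNIV \<eta> \<and>
        smooth_field A (- (p ` {1..r})) \<eta> \<and>
        (\<forall>c\<in>coords A. \<forall>x \<in> fst c - p ` {1..r}. \<nu> c x = \<mu> c x + dbar \<eta> c x) \<and>
        (\<forall>i\<in>{1..r}. \<forall>c\<in>coords A. p i \<in> fst c \<longrightarrow> \<eta> c (p i) = \<xi> i c (p i)))"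


section \<open>Complex reductive groups\<close>

definition cscale :: "complex \<Rightarrow> complex^'n^'m \<Rightarrow> complex^'n^'m" where
  "cscale a M = (\<chi> i j. a * M $ i $ j)"

definition conj_transpose :: "complex^'n^'n \<Rightarrow> complex^'n^'n" where
  "conj_transpose M = (\<chi> i j. cnj (M $ j $ i))"

definition Ad :: "complex^'n^'n \<Rightarrow> complex^'n^'n \<Rightarrow> complex^'n^'n" where
  "Ad a X = a ** X ** matrix_inv a"

definition bracket :: "complex^'n^'n \<Rightarrow> complex^'n^'n \<Rightarrow> complex^'n^'n" where
  "bracket X Y = X ** Y - Y ** X"

definition matrix_subgroup :: "(complex^'n^'n) set \<Rightarrow> bool" where
  "matrix_subgroup H \<longleftrightarrow> (\<forall>a\<in>H. invertible a) \<and> mat 1 \<in> H \<and>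
     (\<forall>a\<in>H. \<forall>b\<in>H. a ** b \<in> H) \<and> (\<forall>a\<in>H. matrix_inv a \<in> H)"

definition closed_subgroup :: "(complex^'n^'n) set \<Rightarrow> bool" where
  "closed_subgroup H \<longleftrightarrow> matrix_subgroup H \<and> closedin (top_of_set {a. invertible a}) H"

text \<open>The Lie algebra of a closed linear group: velocities at the identity of curves in it.\<close>

definition lie_algebra :: "(complex^'n^'n) set \<Rightarrow> (complex^'n^'n) set" where
  "lie_algebra H = {X. \<exists>\<gamma>. (\<forall>t::real. \<gamma> t \<in> H) \<and> \<gamma> 0 = mat 1 \<and>
     (\<gamma> has_vector_derivative X) (at 0)}"

text \<open>Connected complex reductive groups, i.e. complexifications of compact connected groups,
  are taken in a faithful matrix realisation in which the compact form is unitary; these are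
  the connected closed complex subgroups of $GL_n(\mathbb C)$ that are stable under conjugate
  transposition. The compact form is $G\cap U(n)$.\<close>

definition connected_complex_reductive :: "(complex^'n^'n) set \<Rightarrow> bool" where
  "connected_complex_reductive G \<longleftrightarrow> closed_subgroup G \<and> connected G \<and>
     (\<forall>X\<in>lie_algebra G. cscale \<i> X \<in> lie_algebra G) \<and> (\<forall>a\<in>G. conj_transpose a \<in> G)"

definition lie_centre :: "(complex^'n^'n) set \<Rightarrow> (complex^'n^'n) set" where
  "lie_centre L = {X\<in>L. \<forall>Y\<in>L. bracket X Y = 0}"

text \<open>The real span is the complex span here, the set of brackets being stable under complex
  scalars.\<close>

definition lie_derived :: "(complex^'n^'n) set \<Rightarrow> (complex^'n^'n) set" where
  "lie_derived L = span {bracket X Y | X Y. X \<in> L \<and> Y \<in> L}"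

definition nilpotent_element :: "(complex^'n^'n) set \<Rightarrow> complex^'n^'n \<Rightarrow> bool" where
  "nilpotent_element L X \<longleftrightarrow> (\<exists>u \<in> lie_centre L. \<exists>v \<in> lie_derived L. X = u + v \<and> u = 0 \<and>
     (\<exists>k. \<forall>y\<in>lie_derived L. (bracket v ^^ k) y = 0))"

definition invariant_form ::
  "(complex^'n^'n) set \<Rightarrow> (complex^'n^'n \<Rightarrow> complex^'n^'n \<Rightarrow> complex) \<Rightarrow> bool" where
  "invariant_form G B \<longleftrightarrow>
     (\<forall>X\<in>lie_algebra G. \<forall>Y\<in>lie_algebra G. \<forall>Z\<in>lie_algebra G. \<forall>s.
        B (cscale s X + Y) Z = s * B X Z + B Y Z) \<and>
     (\<forall>X\<in>lie_algebra G. \<forall>Y\<in>lie_algebra G. B X Y = B Y X) \<and>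
     (\<forall>a\<in>G. \<forall>X\<in>lie_algebra G. \<forall>Y\<in>lie_algebra G. B (Ad a X) (Ad a Y) = B X Y) \<and>
     (\<forall>X\<in>lie_algebra G. (\<forall>Y\<in>lie_algebra G. B X Y = 0) \<longrightarrow> X = 0)"


section \<open>Principal bundles and logarithmic Higgs bundles\<close>

text \<open>A holomorphic principal \<open>G\<close>-bundle is a free right \<open>G\<close>-space over the surface together
  with local sections \<open>(U, s)\<close> whose transition functions are holomorphic; these determine
  the complex structure of the total space.\<close>

record ('c, 'p, 'n) gbundle =
  total :: "'p set"
  proj :: "'p \<Rightarrow> 'c"
  act :: "'p \<Rightarrow> complex^'n^'n \<Rightarrow> 'p"
  sects :: "('c set \<times> ('c \<Rightarrow> 'p)) set"

definition holomorphic_matrix_on ::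
  "'c::topological_space chart set \<Rightarrow> 'c set \<Rightarrow> ('c \<Rightarrow> complex^'n^'m) \<Rightarrow> bool" where
  "holomorphic_matrix_on A W g \<longleftrightarrow>
     (\<forall>c\<in>coords A. \<forall>i j. (\<lambda>z. local_rep c g z $ i $ j) holomorphic_on snd c ` (fst c \<inter> W))"

definition holomorphic_section ::
  "'c::topological_space chart set \<Rightarrow> (complex^'n^'n) set \<Rightarrow> ('c, 'p, 'n) gbundle \<Rightarrow>
   'c set \<times> ('c \<Rightarrow> 'p) \<Rightarrow> bool" where
  "holomorphic_section A G P \<sigma> \<longleftrightarrow> open (fst \<sigma>) \<and>
     (\<forall>x\<in>fst \<sigma>. snd \<sigma> x \<in> total P \<and> proj P (snd \<sigma> x) = x) \<and>
     (\<forall>\<tau>\<in>sects P. \<exists>g. holomorphic_matrix_on A (fst \<sigma> \<inter> fst \<tau>) g \<and>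
        (\<forall>x \<in> fst \<sigma> \<inter> fst \<tau>. g x \<in> G \<and> snd \<sigma> x = act P (snd \<tau> x) (g x)))"

definition holomorphic_principal_bundle ::
  "'c::topological_space chart set \<Rightarrow> (complex^'n^'n) set \<Rightarrow> ('c, 'p, 'n) gbundle \<Rightarrow> bool" where
  "holomorphic_principal_bundle A G P \<longleftrightarrow>
     (\<forall>u\<in>total P. \<forall>a\<in>G. act P u a \<in> total P \<and> proj P (act P u a) = proj P u) \<and>
     (\<forall>u\<in>total P. act P u (mat 1) = u) \<and>
     (\<forall>u\<in>total P. \<forall>a\<in>G. \<forall>b\<in>G. act P (act P u a) b = act P u (a ** b)) \<and>
     (\<forall>u\<in>total P. \<forall>v\<in>total P. proj P u = proj P v \<longrightarrow> (\<exists>!a. a \<in> G \<and> v = act P u a)) \<and>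
     (\<forall>\<sigma>\<in>sects P. holomorphic_section A G P \<sigma>) \<and>
     (\<Union>\<sigma>\<in>sects P. fst \<sigma>) = UNIV"

text \<open>Sections of $\mathrm{ad}(P)\otimes K$ are \<open>G\<close>-equivariant functions on \<open>P\<close> with values in
  the Lie algebra, whose coefficient with respect to $dz$ is taken in each chart.\<close>

type_synonym ('c, 'p, 'n) adfield = "'c chart \<Rightarrow> 'p \<Rightarrow> complex^'n^'n"

text \<open>\<open>F\<close> has the form \<open>N / (z - z\<^sub>0) + R z\<close> near \<open>z\<^sub>0\<close> with \<open>R\<close> holomorphic.\<close>

definition log_expansion ::
  "(complex \<Rightarrow> complex^'n^'m) \<Rightarrow> complex \<Rightarrow> complex^'n^'m \<Rightarrow> bool" where
  "log_expansion F z\<^sub>0 N \<longleftrightarrow> (\<exists>\<rho>>0. \<exists>R. (\<forall>i j. (\<lambda>z. R z $ i $ j) holomorphic_on ball z\<^sub>0 \<rho>) \<and>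
     (\<forall>z \<in> ball z\<^sub>0 \<rho> - {z\<^sub>0}. F z = cscale (1 / (z - z\<^sub>0)) N + R z))"

definition log_higgs_bundle ::
  "'c::topological_space chart set \<Rightarrow> 'c set \<Rightarrow> (complex^'n^'n) set \<Rightarrow>
   ('c, 'p, 'n) gbundle \<Rightarrow> ('c, 'p, 'n) adfield \<Rightarrow> bool" where
  "log_higgs_bundle A D G P \<Phi> \<longleftrightarrow> holomorphic_principal_bundle A G P \<and>
     (\<forall>c\<in>coords A. \<forall>u\<in>total P. proj P u \<in> fst c - D \<longrightarrow>
        \<Phi> c u \<in> lie_algebra G \<and> (\<forall>a\<in>G. \<Phi> c (act P u a) = Ad (matrix_inv a) (\<Phi> c u))) \<and>
     (\<forall>c\<in>coords A. \<forall>d\<in>coords A. \<forall>u\<in>total P. proj P u \<in> fst c \<inter> fst d - D \<longrightarrow>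
        \<Phi> c u = cscale (deriv (transition c d) (snd c (proj P u))) (\<Phi> d u)) \<and>
     (\<forall>\<sigma>\<in>sects P. \<forall>c\<in>coords A.
        (\<forall>i j. (\<lambda>z. local_rep c (\<Phi> c \<circ> snd \<sigma>) z $ i $ j)
           holomorphic_on snd c ` (fst c \<inter> fst \<sigma> - D)) \<and>
        (\<forall>x \<in> D \<inter> fst c \<inter> fst \<sigma>. \<exists>N. log_expansion (local_rep c (\<Phi> c \<circ> snd \<sigma>)) (snd c x) N))"

text \<open>In another local section the residue is conjugated by an element of \<open>G\<close>.\<close>

definition nilpotent_residues ::
  "'c::topological_space chart set \<Rightarrow> 'c set \<Rightarrow> (complex^'n^'n) set \<Rightarrow>
   ('c, 'p, 'n) gbundle \<Rightarrow> ('c, 'p, 'n) adfield \<Rightarrow> bool" where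
  "nilpotent_residues A D G P \<Phi> \<longleftrightarrow>
     (\<forall>\<sigma>\<in>sects P. \<forall>c\<in>coords A. \<forall>x \<in> D \<inter> fst c \<inter> fst \<sigma>. \<forall>N.
        log_expansion (local_rep c (\<Phi> c \<circ> snd \<sigma>)) (snd c x) N \<longrightarrow>
        nilpotent_element (lie_algebra G) N)"

text \<open>Independent of the point \<open>u\<close> of the fibre by invariance of \<open>B\<close>.\<close>

definition higgs_square ::
  "(complex^'n^'n \<Rightarrow> complex^'n^'n \<Rightarrow> complex) \<Rightarrow>
   ('c, 'p, 'n) gbundle \<Rightarrow> ('c, 'p, 'n) adfield \<Rightarrow> 'c field" where
  "higgs_square B P \<Phi> = (\<lambda>c x. let u = (SOME u. u \<in> total P \<and> proj P u = x)
                              in B (\<Phi> c u) (\<Phi> c u))"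


section \<open>Stability and topological type\<close>

definition group_derived :: "(complex^'n^'n) set \<Rightarrow> (complex^'n^'n) set" where
  "group_derived H = \<Inter>{K. matrix_subgroup K \<and>
     {a ** b ** matrix_inv a ** matrix_inv b | a b. a \<in> H \<and> b \<in> H} \<subseteq> K}"

definition solvable_group :: "(complex^'n^'n) set \<Rightarrow> bool" where
  "solvable_group H \<longleftrightarrow> (\<exists>k. (group_derived ^^ k) H = {mat 1})"

definition borel_subgroup :: "(complex^'n^'n) set \<Rightarrow> (complex^'n^'n) set \<Rightarrow> bool" where
  "borel_subgroup G H \<longleftrightarrow> H \<subseteq> G \<and> closed_subgroup H \<and> connected H \<and> solvable_group H \<and>
     (\<forall>K. H \<subseteq> K \<and> K \<subseteq> G \<and> closed_subgroup K \<and> connected K \<and> solvable_group K \<longrightarrow> K = H)"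

definition parabolic_subgroup :: "(complex^'n^'n) set \<Rightarrow> (complex^'n^'n) set \<Rightarrow> bool" where
  "parabolic_subgroup G Q \<longleftrightarrow> Q \<subseteq> G \<and> closed_subgroup Q \<and> (\<exists>H\<subseteq>Q. borel_subgroup G H)"

definition maximal_parabolic :: "(complex^'n^'n) set \<Rightarrow> (complex^'n^'n) set \<Rightarrow> bool" where
  "maximal_parabolic G Q \<longleftrightarrow> parabolic_subgroup G Q \<and> Q \<noteq> G \<and>
     (\<forall>R. parabolic_subgroup G R \<and> Q \<subseteq> R \<and> R \<noteq> G \<longrightarrow> R = Q)"

definition holomorphic_reduction ::
  "'c::topological_space chart set \<Rightarrow> (complex^'n^'n) set \<Rightarrow> ('c, 'p, 'n) gbundle \<Rightarrow>
   (complex^'n^'n) set \<Rightarrow> 'p set \<Rightarrow> bool" where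
  "holomorphic_reduction A G P Q S \<longleftrightarrow> S \<subseteq> total P \<and> (\<forall>u\<in>S. \<forall>a\<in>Q. act P u a \<in> S) \<and>
     (\<forall>u\<in>S. \<forall>v\<in>S. proj P u = proj P v \<longrightarrow> (\<exists>a\<in>Q. v = act P u a)) \<and>
     (\<forall>x. \<exists>\<sigma>. x \<in> fst \<sigma> \<and> holomorphic_section A G P \<sigma> \<and> snd \<sigma> ` fst \<sigma> \<subseteq> S)"

text \<open>\<open>d\<close> is the determinant of the complex-linear map \<open>T\<close> on the complex subspace \<open>V\<close>,
  computed in a complex basis \<open>b\<close>.\<close>

definition det_on ::
  "(complex^'n^'n) set \<Rightarrow> (complex^'n^'n \<Rightarrow> complex^'n^'n) \<Rightarrow> complex \<Rightarrow> bool" where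
  "det_on V T d \<longleftrightarrow> (\<exists>(m::nat) b M.
     (\<forall>j<m. b j \<in> V) \<and>
     (\<forall>v\<in>V. \<exists>a. v = (\<Sum>i<m. cscale (a i) (b i))) \<and>
     (\<forall>a. (\<Sum>i<m. cscale (a i) (b i)) = 0 \<longrightarrow> (\<forall>i<m. a i = 0)) \<and>
     (\<forall>j<m. T (b j) = (\<Sum>i<m. cscale (M i j) (b i))) \<and>
     d = (\<Sum>\<pi> | \<pi> permutes {..<m}. of_int (sign \<pi>) * (\<Prod>i<m. M i (\<pi> i))))"

text \<open>The degree of the adjoint bundle of the reduction \<open>S\<close> to \<open>Q\<close> is the degree of its
  determinant line bundle, i.e. the number of zeros minus poles of a meromorphic section \<open>f\<close>
  of it, viewed as an equivariant function on \<open>S\<close>.\<close>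

definition adjoint_degree ::
  "'c::topological_space chart set \<Rightarrow> (complex^'n^'n) set \<Rightarrow> ('c, 'p, 'n) gbundle \<Rightarrow>
   (complex^'n^'n) set \<Rightarrow> 'p set \<Rightarrow> int \<Rightarrow> bool" where
  "adjoint_degree A G P Q S k \<longleftrightarrow> (\<exists>f ord.
     (\<forall>u\<in>S. \<forall>a\<in>Q. \<forall>d. det_on (lie_algebra Q) (Ad (matrix_inv a)) d \<longrightarrow> f (act P u a) = d * f u) \<and>
     (\<forall>\<sigma>. holomorphic_section A G P \<sigma> \<and> snd \<sigma> ` fst \<sigma> \<subseteq> S \<longrightarrow>
        (\<forall>c\<in>coords A. local_rep c (f \<circ> snd \<sigma>) meromorphic_on snd c ` (fst c \<inter> fst \<sigma>) \<and>
          (\<forall>x \<in> fst c \<inter> fst \<sigma>.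
             (\<exists>\<^sub>F z in at (snd c x). local_rep c (f \<circ> snd \<sigma>) z \<noteq> 0) \<and>
             zorder (local_rep c (f \<circ> snd \<sigma>)) (snd c x) = ord x))) \<and>
     finite {x. ord x \<noteq> 0} \<and> k = (\<Sum>x | ord x \<noteq> 0. ord x))"

text \<open>Stability in the sense of Ramanathan: since $\mathrm{ad}(P)$ has degree 0, the condition
  that $\mathrm{ad}(P)/\mathrm{ad}(P_Q)$ has positive degree reads
  $\deg \mathrm{ad}(P_Q) < 0$.\<close>

definition stable_higgs ::
  "'c::topological_space chart set \<Rightarrow> 'c set \<Rightarrow> (complex^'n^'n) set \<Rightarrow>
   ('c, 'p, 'n) gbundle \<Rightarrow> ('c, 'p, 'n) adfield \<Rightarrow> bool" where
  "stable_higgs A D G P \<Phi> \<longleftrightarrow> (\<forall>Q S k.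
     maximal_parabolic G Q \<and> holomorphic_reduction A G P Q S \<and>
     (\<forall>c\<in>coords A. \<forall>u\<in>S. proj P u \<in> fst c - D \<longrightarrow> \<Phi> c u \<in> lie_algebra Q) \<and>
     adjoint_degree A G P Q S k \<longrightarrow> k < 0)"

definition same_topological_type ::
  "(complex^'n^'n) set \<Rightarrow> ('c::topological_space, 'p, 'n) gbundle \<Rightarrow> ('c, 'p, 'n) gbundle \<Rightarrow> bool"
  where
  "same_topological_type G P P' \<longleftrightarrow> (\<exists>f. bij_betw f (total P) (total P') \<and>
     (\<forall>u\<in>total P. proj P' (f u) = proj P u \<and> (\<forall>a\<in>G. f (act P u a) = act P' (f u) a)) \<and>
     (\<forall>\<sigma>\<in>sects P. \<forall>\<tau>\<in>sects P'. \<exists>g. continuous_on (fst \<sigma> \<inter> fst \<tau>) g \<and>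
        (\<forall>x \<in> fst \<sigma> \<inter> fst \<tau>. g x \<in> G \<and> f (snd \<sigma> x) = act P' (snd \<tau> x) (g x))))"

text \<open>\<open>\<F>\<close> is the fibre over $(C,D)$ of a family of stable loci: a set of (representatives of)
  stable logarithmic Higgs bundles with nilpotent residues and of one topological type.\<close>

definition nilpotent_stable_locus ::
  "'c::topological_space chart set \<Rightarrow> 'c set \<Rightarrow> (complex^'n^'n) set \<Rightarrow>
   (('c, 'p, 'n) gbundle \<times> ('c, 'p, 'n) adfield) set \<Rightarrow> bool" where
  "nilpotent_stable_locus A D G \<F> \<longleftrightarrow>
     (\<forall>(P, \<Phi>)\<in>\<F>. log_higgs_bundle A D G P \<Phi> \<and> nilpotent_residues A D G P \<Phi> \<and>
        stable_higgs A D G P \<Phi>) \<and>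
     (\<forall>(P, \<Phi>)\<in>\<F>. \<forall>(P', \<Phi>')\<in>\<F>. same_topological_type G P P')"


section \<open>The one-form\<close>

definition phi_G_log ::
  "'c::topological_space chart set \<Rightarrow> 'c set \<Rightarrow> (complex^'n^'n \<Rightarrow> complex^'n^'n \<Rightarrow> complex) \<Rightarrow>
   ('c, 'p, 'n) gbundle \<Rightarrow> ('c, 'p, 'n) adfield \<Rightarrow> 'c field set \<Rightarrow> complex" where
  "phi_G_log A D B P \<Phi> Y = - (1/2) * serre_pairing A D (higgs_square B P \<Phi>) Y"

end

theory Submission
  imports Defs
begin

text \<open>Write $q = B(\Phi,\Phi)$, $D = \{p_1,\dots,p_r\}$, and let \<open>\<nu>\<close> be the Dolbeault representative
  of \<open>Y\<close> used in the Serre pairing. Unwinding the definition of a representative, there is a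
  vector field \<open>\<eta>\<close>, continuous on $C$ and smooth off $D$, with $\bar\partial\eta = \nu - \mu$
  off $D$ and $\eta(p_i) = \xi_i(p_i)$: passing to another Dolbeault representative changes \<open>\<eta>\<close>
  only by a smooth field that vanishes on $D$. The claim is therefore Stokes' theorem with residues
  for the (1,0)-form $\omega = q\,\eta$,
  $$\frac{1}{2\pi i}\int_{C\setminus D} q\,\bar\partial\eta = \sum_i \mathrm{Res}_{p_i}(q\,\xi_i),$$
  and it requires that $q$ be a quadratic differential with at most simple poles.
  
  The pole order is where the nilpotency of the residues enters: near $p_i$ the double pole of $q$
  has coefficient $B(N_i,N_i)$, and this vanishes (\<open>invariant_form_nilpotent\<close>). Indeed a nilpotent
  $N$ can be written as $[N,X]$ with $X$ in the Lie algebra (\<open>nilpotent_in_range_bracket\<close>, proved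
  with a positive definite trace form in place of the Jacobson--Morozov theorem); differentiating
  $t \mapsto B(\mathrm{Ad}_{\gamma(t)}N,\mathrm{Ad}_{\gamma(t)}N)$, which is constant, along a curve
  with velocity $X$ gives $0 = 2B([X,N],N) = -2B(N,N)$.
  
  Stokes' theorem (\<open>stokes_residues\<close>) is reduced by a partition of unity to one coordinate disc,
  where it is the Cauchy--Pompeiu formula for a simple pole
  (\<open>integral_wirtinger_dbar_punctured_disc\<close>). The substitution $z = z_0 + e^w$ turns the punctured
  disc into a half strip on which $e^w f(z_0+e^w)$ is periodic, and the divergence theorem on
  rectangles applies; no derivative of \<open>\<eta>\<close> other than $\bar\partial\eta$ need be bounded near
  $D$. The same change of variables formula (\<open>holomorphic_change_of_variables\<close>) makes the integral
  of a (1,1)-form independent of the decomposition into charts (\<open>form_integral_eq\<close>).\<close>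

(* In what follows the dollar sign stands for vector and matrix entries only. *)
no_notation fps_nth (infixl \<open>$\<close> 75)

section \<open>Change of variables in the plane\<close>

text \<open>The complex plane as $\mathbb R^2$; Lebesgue measures correspond.\<close>

definition cvec :: "real^2 \<Rightarrow> complex" where
  "cvec v = Complex (v $ 1) (v $ 2)"

definition vecc :: "complex \<Rightarrow> real^2" where
  "vecc z = vector [Re z, Im z]"

lemma vecc_nth [simp]: "vecc z $ 1 = Re z" "vecc z $ 2 = Im z"
  by (simp_all add: vecc_def)

lemma cvec_vecc [simp]: "cvec (vecc z) = z"
  by (simp add: cvec_def)

lemma vecc_cvec [simp]: "vecc (cvec v) = v"
  by (simp add: cvec_def vec_eq_iff forall_2)

lemma inj_vecc: "inj vecc"
  by (metis cvec_vecc injI)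

lemma bounded_linear_cvec: "bounded_linear cvec"
  unfolding linear_conv_bounded_linear[symmetric]
  by (intro linearI) (simp_all add: cvec_def complex_eq_iff)

lemma bounded_linear_vecc: "bounded_linear vecc"
  unfolding linear_conv_bounded_linear[symmetric]
  by (intro linearI) (simp_all add: vec_eq_iff forall_2)

lemma measurable_cvec [measurable]: "cvec \<in> borel_measurable borel"
  by (intro borel_measurable_continuous_onI linear_continuous_on bounded_linear_cvec)

lemma measurable_vecc [measurable]: "vecc \<in> borel_measurable borel"
  by (intro borel_measurable_continuous_onI linear_continuous_on bounded_linear_vecc)

lemma lborel_complex_eq_distr_vec: "lborel = distr lborel lborel cvec"
proof (rule lborel_eqI)
  fix l u :: complex
  assume le: "\<And>b. b \<in> Basis \<Longrightarrow> l \<bullet> b \<le> u \<bullet> b"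
  have le': "Re l \<le> Re u" "Im l \<le> Im u"
    using le[of 1] le[of \<i>] by (auto simp: Basis_complex_def)
  have pre: "cvec -` box l u \<inter> space lborel = box (vecc l) (vecc u)"
    by (auto simp: in_box_complex_iff cvec_def mem_box_cart forall_2)
  have "emeasure (distr lborel lborel cvec) (box l u) = emeasure lborel (box (vecc l) (vecc u))"
    by (subst emeasure_distr) (simp_all add: pre[simplified])
  also have "\<dots> = (\<Prod>b\<in>Basis. (vecc u - vecc l) \<bullet> b)"
  proof (rule emeasure_lborel_box)
    fix b :: "real^2" assume "b \<in> Basis"
    then obtain i where "b = axis i 1" by (auto simp: Basis_vec_def)
    thus "vecc l \<bullet> b \<le> vecc u \<bullet> b"
      using le' exhaust_2[of i] by (auto simp: inner_axis)
  qed
  also have "(\<Prod>b\<in>Basis. (vecc u - vecc l) \<bullet> b) = (Re u - Re l) * (Im u - Im l)"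
  proof -
    have B: "(Basis :: (real^2) set) = {axis 1 1, axis 2 1}"
      by (auto simp: Basis_vec_def) (metis exhaust_2)
    moreover have "axis 1 1 \<noteq> (axis 2 1 :: real^2)" by (simp add: axis_eq_axis)
    ultimately show ?thesis unfolding B by (simp add: inner_axis)
  qed
  also have "\<dots> = (\<Prod>b\<in>Basis. (u - l) \<bullet> b)"
    by (simp add: Basis_complex_def)
  finally show "emeasure (distr lborel lborel cvec) (box l u) = (\<Prod>b\<in>Basis. (u - l) \<bullet> b)" .
qed simp

lemma integrable_complex_iff_vec:
  fixes f :: "complex \<Rightarrow> 'a::{banach, second_countable_topology}"
  assumes [measurable]: "f \<in> borel_measurable borel"
  shows "integrable lborel f \<longleftrightarrow> integrable lborel (f \<circ> cvec)"
  by (subst lborel_complex_eq_distr_vec, subst integrable_distr_eq) (simp_all add: o_def)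

lemma integral_complex_eq_vec:
  fixes f :: "complex \<Rightarrow> 'a::{banach, second_countable_topology}"
  assumes [measurable]: "f \<in> borel_measurable borel"
  shows "integral\<^sup>L lborel f = integral\<^sup>L lborel (f \<circ> cvec)"
  by (subst lborel_complex_eq_distr_vec, subst integral_distr) (simp_all add: o_def)

lemma det_complex_mult:
  "det (matrix (\<lambda>h. vecc (a * cvec h))) = (norm a)\<^sup>2"
  by (simp add: det_2 matrix_def cvec_def axis_def cmod_power2 power2_eq_square[of "Re a"] power2_eq_square[of "Im a"])

text \<open>Change of variables under an injective holomorphic map. The substituted function is only
  assumed integrable on the image; applied to the inverse map as well, this gives an equivalence.\<close>

lemma holomorphic_change_of_variables:
  fixes T f :: "complex \<Rightarrow> complex"
  assumes U: "open U" "T holomorphic_on U" and S: "S \<subseteq> U" "S \<in> sets borel"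
    and TS: "T ` S \<in> sets borel" and inj: "inj_on T S"
    and f: "set_integrable lborel (T ` S) f"
  shows "set_integrable lborel S (\<lambda>z. of_real ((norm (deriv T z))\<^sup>2) * f (T z))"
    and "(LINT z:S|lborel. of_real ((norm (deriv T z))\<^sup>2) * f (T z)) = (LINT z:T ` S|lborel. f z)"
proof -
  define F where "F = (\<lambda>z. indicator (T ` S) z *\<^sub>R f z)"
  define G where "G = (\<lambda>z. indicator S z *\<^sub>R (of_real ((norm (deriv T z))\<^sup>2) * f (T z)))"
  have F: "integrable lborel F" using f unfolding F_def set_integrable_def .
  have Fm [measurable]: "F \<in> borel_measurable borel" using borel_measurable_integrable[OF F] by simp
  have contT: "continuous_on S T"
    using U S by (meson continuous_on_subset holomorphic_on_imp_continuous_on)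
  have contT': "continuous_on S (deriv T)"
    by (meson S(1) U continuous_on_subset holomorphic_deriv holomorphic_on_imp_continuous_on)
  have TSm [measurable]: "(\<lambda>z. indicator S z *\<^sub>R T z) \<in> borel_measurable borel"
    "(\<lambda>z. indicator S z *\<^sub>R (of_real ((norm (deriv T z))\<^sup>2)::complex)) \<in> borel_measurable borel"
    by (intro borel_measurable_continuous_on_indicator S contT continuous_intros contT')+
  have Geq: "G = (\<lambda>z. (indicator S z *\<^sub>R of_real ((norm (deriv T z))\<^sup>2)) * F (indicator S z *\<^sub>R T z))"
    by (auto simp: G_def F_def fun_eq_iff indicator_def)
  have Gm [measurable]: "G \<in> borel_measurable borel"
    unfolding Geq by measurable
  \<comment> \<open>Conjugating with the isometry turns the claim into the real change of variables formula,
    whose Jacobian determinant is the squared modulus of the complex derivative.\<close>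
  let ?S = "vecc ` S" and ?T = "\<lambda>v. vecc (T (cvec v))" and ?f = "\<lambda>v. vecc (f (cvec v))"
  have S_vimage: "vecc ` S' = cvec -` S'" for S'
    by (auto simp: image_iff) (metis vecc_cvec)
  have Sm: "?S \<in> sets lebesgue"
    unfolding S_vimage using measurable_sets_borel[OF measurable_cvec S(2)] by auto
  have TS': "?T ` ?S = vecc ` (T ` S)"
    by (auto simp: image_image)
  have vint: "integrable lborel (\<lambda>v. vecc (h (cvec v))) \<and>
      integral\<^sup>L lborel (\<lambda>v. vecc (h (cvec v))) = vecc (integral\<^sup>L lborel h)"
    if h: "integrable lborel h" for h :: "complex \<Rightarrow> complex"
  proof -
    have hm: "h \<in> borel_measurable borel" using borel_measurable_integrable[OF h] by simp
    have "integrable lborel (\<lambda>v. h (cvec v))"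
      using integrable_complex_iff_vec[OF hm] h by (simp add: o_def)
    from integrable_bounded_linear[OF bounded_linear_vecc this]
      integral_bounded_linear[OF bounded_linear_vecc this]
    show ?thesis by (simp add: integral_complex_eq_vec[OF hm] o_def)
  qed
  have iF: "indicator (vecc ` (T ` S)) v *\<^sub>R ?f v = vecc (F (cvec v))" for v
    unfolding S_vimage F_def
    by (simp add: indicator_def bounded_linear.linear bounded_linear_vecc linear_0)
  have aF: "?f absolutely_integrable_on (?T ` ?S)" "integral (?T ` ?S) ?f = vecc (integral\<^sup>L lborel F)"
  proof -
    have 1: "set_integrable lborel (?T ` ?S) ?f"
      unfolding set_integrable_def TS' iF using vint[OF F] by blast
    show "?f absolutely_integrable_on (?T ` ?S)"
      using 1 unfolding set_integrable_def
      by (subst integrable_completion) (auto dest: borel_measurable_integrable)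
    have "(LINT v:?T ` ?S|lborel. ?f v) = vecc (integral\<^sup>L lborel F)"
      unfolding set_lebesgue_integral_def TS' iF using vint[OF F] by blast
    thus "integral (?T ` ?S) ?f = vecc (integral\<^sup>L lborel F)"
      using set_borel_integral_eq_integral(2)[OF 1] by simp
  qed
  have der: "(?T has_derivative (\<lambda>h. vecc (deriv T (cvec x) * cvec h))) (at x within ?S)"
    if "x \<in> ?S" for x
  proof -
    have "cvec x \<in> U" using that S by auto
    hence "(T has_derivative (*) (deriv T (cvec x))) (at (cvec x))"
      using U holomorphic_derivI has_field_derivative_imp_has_derivative by blast
    hence "((T \<circ> cvec) has_derivative (*) (deriv T (cvec x)) \<circ> cvec) (at x)"
      by (intro diff_chain_at bounded_linear_imp_has_derivative bounded_linear_cvec)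
    from bounded_linear.has_derivative[OF bounded_linear_vecc this]
    show ?thesis by (auto simp: o_def intro: has_derivative_at_withinI)
  qed
  have inj': "inj_on ?T ?S"
    using inj by (auto simp: inj_on_def dest!: inj_vecc[THEN injD])
  have iG: "indicator ?S v *\<^sub>R (\<bar>det (matrix (\<lambda>h. vecc (deriv T (cvec v) * cvec h)))\<bar> *\<^sub>R ?f (?T v))
     = vecc (G (cvec v))" for v
    unfolding S_vimage G_def det_complex_mult
    by (auto simp: indicator_def vec_eq_iff forall_2)
  from has_absolute_integral_change_of_variables[OF Sm der inj', of ?f "vecc (integral\<^sup>L lborel F)"] aF
  have *: "(\<lambda>x. \<bar>det (matrix (\<lambda>h. vecc (deriv T (cvec x) * cvec h)))\<bar> *\<^sub>R ?f (?T x))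
      absolutely_integrable_on ?S"
    and **: "integral ?S (\<lambda>x. \<bar>det (matrix (\<lambda>h. vecc (deriv T (cvec x) * cvec h)))\<bar> *\<^sub>R ?f (?T x))
      = vecc (integral\<^sup>L lborel F)"
    by blast+
  have 2: "integrable lborel (\<lambda>v. vecc (G (cvec v)))"
    using * unfolding set_integrable_def iG by (subst (asm) integrable_completion) auto
  have "integrable lborel (\<lambda>v. cvec (vecc (G (cvec v))))"
    using integrable_bounded_linear[OF bounded_linear_cvec 2] .
  hence G: "integrable lborel G"
    using integrable_complex_iff_vec[OF Gm] by (simp add: o_def)
  thus "set_integrable lborel S (\<lambda>z. of_real ((norm (deriv T z))\<^sup>2) * f (T z))"
    unfolding set_integrable_def G_def .
  have 3: "set_integrable lborel ?S (\<lambda>x. \<bar>det (matrix (\<lambda>h. vecc (deriv T (cvec x) * cvec h)))\<bar> *\<^sub>R ?f (?T x))"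
    unfolding set_integrable_def iG by (rule 2)
  have "vecc (integral\<^sup>L lborel G) = vecc (integral\<^sup>L lborel F)"
    using set_borel_integral_eq_integral(2)[OF 3] ** vint[OF G]
    unfolding set_lebesgue_integral_def iG by simp
  hence "integral\<^sup>L lborel G = integral\<^sup>L lborel F" by (metis cvec_vecc)
  thus "(LINT z:S|lborel. of_real ((norm (deriv T z))\<^sup>2) * f (T z)) = (LINT z:T ` S|lborel. f z)"
    unfolding set_lebesgue_integral_def G_def F_def .
qed

section \<open>Continuously differentiable functions and the Wirtinger derivative\<close>

text \<open>Real continuous differentiability at the points of a set, expressed by the two partial
  derivatives, i.e. by the values of the derivative at 1 and at \<open>\<i>\<close>. The derivative is taken in
  the plane, not relative to the set.\<close>

definition C1_on :: "complex set \<Rightarrow> (complex \<Rightarrow> complex) \<Rightarrow> bool" where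
  "C1_on S f \<longleftrightarrow> (\<forall>z\<in>S. f differentiable (at z)) \<and>
     continuous_on S (\<lambda>z. frechet_derivative f (at z) 1) \<and>
     continuous_on S (\<lambda>z. frechet_derivative f (at z) \<i>)"

lemma C1_onI:
  assumes "\<And>z. z \<in> S \<Longrightarrow> (f has_derivative D z) (at z)"
    and "continuous_on S (\<lambda>z. D z 1)" "continuous_on S (\<lambda>z. D z \<i>)"
  shows "C1_on S f"
proof -
  have "D z = frechet_derivative f (at z)" if "z \<in> S" for z
    using assms(1)[OF that] by (rule frechet_derivative_at)
  thus ?thesis unfolding C1_on_def using assms
    by (auto simp: differentiable_def cong: continuous_on_cong)
qed

lemma C1_on_has_derivative:
  "C1_on S f \<Longrightarrow> z \<in> S \<Longrightarrow> (f has_derivative frechet_derivative f (at z)) (at z)"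
  unfolding C1_on_def by (simp add: frechet_derivative_works[symmetric])

lemma C1_on_subset: "C1_on S f \<Longrightarrow> T \<subseteq> S \<Longrightarrow> C1_on T f"
  unfolding C1_on_def by (meson continuous_on_subset subsetD)

lemma C1_on_imp_continuous_on: "C1_on S f \<Longrightarrow> continuous_on S f"
  unfolding C1_on_def
  by (meson continuous_at_imp_continuous_on differentiable_imp_continuous_within)

lemma C1_on_Un:
  assumes "open S" "open T" "C1_on S f" "C1_on T f"
  shows "C1_on (S \<union> T) f"
  using assms unfolding C1_on_def by (auto intro: continuous_on_open_Un)

lemma frechet_derivative_cong:
  assumes "open S" "z \<in> S" "\<And>w. w \<in> S \<Longrightarrow> f w = g w"
  shows "frechet_derivative f (at z) = frechet_derivative g (at z)"
proof -
  have "(f has_derivative D) (at z) \<longleftrightarrow> (g has_derivative D) (at z)" for D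
    using assms has_derivative_transform_within_open by metis
  thus ?thesis unfolding frechet_derivative_def by simp
qed

lemma C1_on_cong:
  assumes "open S" "\<And>w. w \<in> S \<Longrightarrow> f w = g w" "C1_on S f"
  shows "C1_on S g"
proof (rule C1_onI)
  fix z assume z: "z \<in> S"
  show "(g has_derivative frechet_derivative f (at z)) (at z)"
    using C1_on_has_derivative[OF assms(3) z] assms(1,2) z
    by (metis has_derivative_transform_within_open)
qed (use assms(3) in \<open>auto simp: C1_on_def\<close>)

lemma has_derivative_complex_expand:
  fixes f :: "complex \<Rightarrow> complex"
  assumes "(f has_derivative D) (at z)"
  shows "D h = of_real (Re h) * D 1 + of_real (Im h) * D \<i>"
proof -
  have l: "linear D" using assms has_derivative_linear by blast
  have "h = Re h *\<^sub>R 1 + Im h *\<^sub>R \<i>" by (simp add: complex_eq_iff)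
  hence "D h = D (Re h *\<^sub>R 1 + Im h *\<^sub>R \<i>)" by simp
  also have "\<dots> = Re h *\<^sub>R D 1 + Im h *\<^sub>R D \<i>" by (simp add: l linear_add linear_scale)
  finally show ?thesis by (simp add: scaleR_conv_of_real)
qed

lemma C1_on_mult:
  assumes f: "C1_on S f" and g: "C1_on S g"
  shows "C1_on S (\<lambda>z. f z * g z)"
proof (rule C1_onI)
  fix z assume "z \<in> S"
  show "((\<lambda>z. f z * g z) has_derivative
      (\<lambda>h. f z * frechet_derivative g (at z) h + frechet_derivative f (at z) h * g z)) (at z)"
    using has_derivative_mult[OF C1_on_has_derivative[OF f] C1_on_has_derivative[OF g]] \<open>z \<in> S\<close>
    by blast
qed (insert assms C1_on_imp_continuous_on[OF f] C1_on_imp_continuous_on[OF g],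
     auto simp: C1_on_def intro!: continuous_intros)

lemma C1_on_add:
  assumes f: "C1_on S f" and g: "C1_on S g"
  shows "C1_on S (\<lambda>z. f z + g z)"
proof (rule C1_onI)
  fix z assume "z \<in> S"
  show "((\<lambda>z. f z + g z) has_derivative
      (\<lambda>h. frechet_derivative f (at z) h + frechet_derivative g (at z) h)) (at z)"
    using has_derivative_add[OF C1_on_has_derivative[OF f] C1_on_has_derivative[OF g]] \<open>z \<in> S\<close>
    by blast
qed (insert assms, auto simp: C1_on_def intro!: continuous_intros)

lemma C1_on_const [simp]: "C1_on S (\<lambda>_. c)"
  by (rule C1_onI[where D = "\<lambda>_ _. 0"]) auto

lemma C1_on_cmult: "C1_on S f \<Longrightarrow> C1_on S (\<lambda>z. c * f z)"
  using C1_on_mult[OF C1_on_const] by blast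

lemma C1_on_diff:
  assumes f: "C1_on S f" and g: "C1_on S g"
  shows "C1_on S (\<lambda>z. f z - g z)"
  using C1_on_add[OF f C1_on_cmult[OF g, of "-1"]] by simp

lemma C1_on_prod:
  assumes "\<And>i. i \<in> I \<Longrightarrow> C1_on S (f i)"
  shows "C1_on S (\<lambda>z. \<Prod>i\<in>I. f i z)"
  using assms by (induction I rule: infinite_finite_induct) (auto intro: C1_on_mult)

lemma C1_on_holomorphic:
  assumes "f holomorphic_on S" "open S"
  shows "C1_on S f"
proof (rule C1_onI)
  fix z assume "z \<in> S"
  thus "(f has_derivative (*) (deriv f z)) (at z)"
    using assms holomorphic_derivI has_field_derivative_imp_has_derivative by blast
next
  have "continuous_on S (deriv f)"
    using assms by (intro holomorphic_on_imp_continuous_on holomorphic_deriv)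
  thus "continuous_on S (\<lambda>z. deriv f z * 1)" "continuous_on S (\<lambda>z. deriv f z * \<i>)"
    by (auto intro!: continuous_intros)
qed

lemma C1_on_compose_holomorphic:
  assumes f: "C1_on V f" and T: "T holomorphic_on U" "open U" "T ` U \<subseteq> V"
  shows "C1_on U (\<lambda>z. f (T z))"
proof -
  have D: "frechet_derivative f (at (T z)) h = of_real (Re h) * frechet_derivative f (at (T z)) 1
      + of_real (Im h) * frechet_derivative f (at (T z)) \<i>" if "z \<in> U" for z h
    using has_derivative_complex_expand[OF C1_on_has_derivative[OF f, of "T z"]] that T by auto
  have cT: "continuous_on U T" "continuous_on U (deriv T)"
    using T by (auto intro: holomorphic_on_imp_continuous_on holomorphic_deriv)
  have cf: "continuous_on U (\<lambda>z. frechet_derivative f (at (T z)) e)" if "e = 1 \<or> e = \<i>" for e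
    using that f T(3) unfolding C1_on_def
    by (auto intro!: continuous_on_compose2[OF _ cT(1), of V])
  show ?thesis
  proof (rule C1_onI)
    fix z assume z: "z \<in> U"
    have "(T has_derivative (*) (deriv T z)) (at z)"
      using z T holomorphic_derivI has_field_derivative_imp_has_derivative by blast
    from diff_chain_at[OF this C1_on_has_derivative[OF f, of "T z"]] z T
    show "((\<lambda>z. f (T z)) has_derivative (\<lambda>h. frechet_derivative f (at (T z)) (deriv T z * h))) (at z)"
      by (auto simp: o_def)
  next
    have "continuous_on U (\<lambda>z. frechet_derivative f (at (T z)) (deriv T z * e))" for e
      by (subst continuous_on_cong[OF refl D]) (auto intro!: continuous_intros cT cf)
    thus "continuous_on U (\<lambda>z. frechet_derivative f (at (T z)) (deriv T z * 1))"
       "continuous_on U (\<lambda>z. frechet_derivative f (at (T z)) (deriv T z * \<i>))" by blast+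
  qed
qed

lemma smooth_fun_on_imp_C1_on:
  assumes "smooth_fun_on S f" "open S"
  shows "C1_on S f"
proof -
  obtain F :: "nat \<Rightarrow> nat \<Rightarrow> complex \<Rightarrow> complex" where F0: "\<And>z. z \<in> S \<Longrightarrow> F 0 0 z = f z"
    and F: "\<And>m n z. z \<in> S \<Longrightarrow> (F m n has_derivative
        (\<lambda>h. of_real (Re h) * F (Suc m) n z + of_real (Im h) * F m (Suc n) z)) (at z)"
    using assms(1) unfolding smooth_fun_on_def by metis
  have cont: "continuous_on S (F m n)" for m n
    using F by (meson continuous_at_imp_continuous_on has_derivative_continuous)
  have "C1_on S (F 0 0)"
    by (rule C1_onI[OF F]) (auto intro: cont)
  thus ?thesis using C1_on_cong[OF assms(2), of "F 0 0" f] F0 by blast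
qed

lemma wirtinger_dbar_eqI:
  "(f has_derivative D) (at z) \<Longrightarrow> wirtinger_dbar f z = (D 1 + \<i> * D \<i>) / 2"
  unfolding wirtinger_dbar_def using frechet_derivative_at by metis

lemma wirtinger_dbar_cong:
  assumes "open S" "z \<in> S" "\<And>w. w \<in> S \<Longrightarrow> f w = g w"
  shows "wirtinger_dbar f z = wirtinger_dbar g z"
  unfolding wirtinger_dbar_def using frechet_derivative_cong[OF assms] by simp

lemma continuous_on_wirtinger_dbar: "C1_on S f \<Longrightarrow> continuous_on S (wirtinger_dbar f)"
  unfolding C1_on_def wirtinger_dbar_def by (auto intro!: continuous_intros)

lemma wirtinger_dbar_add:
  assumes "f differentiable (at z)" "g differentiable (at z)"
  shows "wirtinger_dbar (\<lambda>z. f z + g z) z = wirtinger_dbar f z + wirtinger_dbar g z"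
  by (subst wirtinger_dbar_eqI[OF has_derivative_add[OF assms[unfolded frechet_derivative_works]]])
     (simp add: wirtinger_dbar_def field_simps)

lemma wirtinger_dbar_diff:
  assumes "f differentiable (at z)" "g differentiable (at z)"
  shows "wirtinger_dbar (\<lambda>z. f z - g z) z = wirtinger_dbar f z - wirtinger_dbar g z"
  by (subst wirtinger_dbar_eqI[OF has_derivative_diff[OF assms[unfolded frechet_derivative_works]]])
     (simp add: wirtinger_dbar_def field_simps)

lemma wirtinger_dbar_mult:
  assumes "f differentiable (at z)" "g differentiable (at z)"
  shows "wirtinger_dbar (\<lambda>z. f z * g z) z = f z * wirtinger_dbar g z + wirtinger_dbar f z * g z"
  by (subst wirtinger_dbar_eqI[OF has_derivative_mult[OF assms[unfolded frechet_derivative_works]]])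
     (simp add: wirtinger_dbar_def field_simps)

lemma wirtinger_dbar_holomorphic:
  assumes "f field_differentiable (at z)"
  shows "wirtinger_dbar f z = 0"
proof -
  obtain d where "(f has_derivative (*) d) (at z)"
    using assms unfolding field_differentiable_def has_field_derivative_def by blast
  thus ?thesis by (simp add: wirtinger_dbar_eqI complex_eq_iff)
qed

lemma wirtinger_dbar_const [simp]: "wirtinger_dbar (\<lambda>_. c) z = 0"
  by (rule wirtinger_dbar_holomorphic) (auto intro: derivative_intros)

lemma wirtinger_dbar_sum:
  assumes "finite I" "\<And>i. i \<in> I \<Longrightarrow> f i differentiable (at z)"
  shows "wirtinger_dbar (\<lambda>z. \<Sum>i\<in>I. f i z) z = (\<Sum>i\<in>I. wirtinger_dbar (f i) z)"
  using assms
proof (induction I rule: finite_induct)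
  case (insert i I)
  have "(\<lambda>z. \<Sum>i\<in>I. f i z) differentiable (at z)"
    using insert by (intro differentiable_sum) auto
  thus ?case using insert by (simp add: wirtinger_dbar_add)
qed simp

lemma wirtinger_dbar_compose:
  assumes f: "f differentiable (at (T z))" and T: "T field_differentiable (at z)"
  shows "wirtinger_dbar (\<lambda>z. f (T z)) z = wirtinger_dbar f (T z) * cnj (deriv T z)"
proof -
  let ?D = "frechet_derivative f (at (T z))"
  have D: "(f has_derivative ?D) (at (T z))" using f by (simp add: frechet_derivative_works)
  have "(T has_derivative (*) (deriv T z)) (at z)"
    using T field_differentiable_derivI has_field_derivative_imp_has_derivative by blast
  from wirtinger_dbar_eqI[OF diff_chain_at[OF this D]]
  have "wirtinger_dbar (\<lambda>z. f (T z)) z = (?D (deriv T z) + \<i> * ?D (deriv T z * \<i>)) / 2"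
    by (simp add: o_def)
  also have "\<dots> = wirtinger_dbar f (T z) * cnj (deriv T z)"
    unfolding wirtinger_dbar_def
    by (subst (1 2) has_derivative_complex_expand[OF D])
       (simp add: complex_eq_iff field_simps)
  finally show ?thesis .
qed

section \<open>The Cauchy-Pompeiu formula for a simple pole\<close>

lemma lborel_complex_eq_distr_prod:
  "lborel = distr (lborel :: (real \<times> real) measure) lborel (\<lambda>(x, y). Complex x y)"
proof (rule lborel_eqI)
  have m: "(\<lambda>(x, y). Complex x y) \<in> borel_measurable (borel :: (real \<times> real) measure)"
    by (intro borel_measurable_continuous_onI) (auto simp: case_prod_unfold Complex_eq intro!: continuous_intros)
  fix l u :: complex
  assume le: "\<And>b. b \<in> Basis \<Longrightarrow> l \<bullet> b \<le> u \<bullet> b"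
  have le': "Re l \<le> Re u" "Im l \<le> Im u"
    using le[of 1] le[of \<i>] by (auto simp: Basis_complex_def)
  have pre: "(\<lambda>(x, y). Complex x y) -` box l u = box (Re l, Im l) (Re u, Im u)"
    by (auto simp: box_def Basis_prod_def Basis_complex_def)
  have "emeasure (distr (lborel :: (real \<times> real) measure) lborel (\<lambda>(x, y). Complex x y)) (box l u)
      = emeasure lborel (box (Re l, Im l) (Re u, Im u))"
    using m by (subst emeasure_distr) (simp_all add: pre)
  also have "\<dots> = (\<Prod>b\<in>Basis. ((Re u, Im u) - (Re l, Im l)) \<bullet> b)"
    using le' by (intro emeasure_lborel_box) (auto simp: Basis_prod_def)
  also have "(\<Prod>b\<in>Basis. ((Re u, Im u) - (Re l, Im l)) \<bullet> b) = (\<Prod>b\<in>Basis. (u - l) \<bullet> b)"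
    by (simp add: Basis_complex_def Basis_prod_def)
  finally show "emeasure (distr (lborel :: (real \<times> real) measure) lborel (\<lambda>(x, y). Complex x y)) (box l u)
      = (\<Prod>b\<in>Basis. (u - l) \<bullet> b)" .
qed simp

lemma measurable_Complex:
  "(\<lambda>p. Complex (fst p) (snd p)) \<in> borel_measurable borel"
  by (intro borel_measurable_continuous_onI) (auto simp: Complex_eq intro!: continuous_intros)

lemma integral_complex_iterated:
  fixes f :: "complex \<Rightarrow> complex"
  assumes f: "integrable lborel f"
  shows "integral\<^sup>L lborel f = (LINT y|lborel. LINT x|lborel. f (Complex x y))"
    and "integral\<^sup>L lborel f = (LINT x|lborel. LINT y|lborel. f (Complex x y))"
proof -
  have fm [measurable]: "f \<in> borel_measurable borel"
    using borel_measurable_integrable[OF f] by simp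
  have i: "integrable (lborel \<Otimes>\<^sub>M lborel) (\<lambda>(x, y). f (Complex x y))"
    using f by (subst (asm) lborel_complex_eq_distr_prod, subst (asm) integrable_distr_eq)
      (auto simp: case_prod_unfold lborel_prod intro: measurable_Complex)
  have e: "integral\<^sup>L lborel f = integral\<^sup>L (lborel \<Otimes>\<^sub>M lborel) (\<lambda>(x, y). f (Complex x y))"
    by (subst lborel_complex_eq_distr_prod, subst integral_distr)
      (auto simp: case_prod_unfold lborel_prod intro: measurable_Complex)
  show "integral\<^sup>L lborel f = (LINT y|lborel. LINT x|lborel. f (Complex x y))"
    unfolding e lborel_pair.integral_fst[OF i, symmetric] by (rule lborel_pair.Fubini_integral[OF i, symmetric])
  show "integral\<^sup>L lborel f = (LINT x|lborel. LINT y|lborel. f (Complex x y))"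
    unfolding e by (rule lborel_pair.integral_fst[OF i, symmetric])
qed

text \<open>The closed rectangle $[a,b]\times[c,d]$.\<close>

definition rectangle :: "real \<Rightarrow> real \<Rightarrow> real \<Rightarrow> real \<Rightarrow> complex set" where
  "rectangle a b c d = {w. a \<le> Re w \<and> Re w \<le> b \<and> c \<le> Im w \<and> Im w \<le> d}"

lemma rectangle_eq_cbox: "rectangle a b c d = cbox (Complex a c) (Complex b d)"
  by (auto simp: rectangle_def in_cbox_complex_iff)

text \<open>The divergence theorem: $\bar\partial k = (k_x + i k_y)/2$, and each partial derivative is
  integrated first in its own direction.\<close>

lemma integral_wirtinger_dbar_rectangle:
  assumes k: "C1_on U k" "rectangle a b c d \<subseteq> U" and ab: "a \<le> b" "c \<le> d"
  shows "set_integrable lborel (rectangle a b c d) (wirtinger_dbar k)"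
    and "(LINT w:rectangle a b c d|lborel. wirtinger_dbar k w) =
      ((LINT y:{c..d}|lborel. k (Complex b y) - k (Complex a y)) +
        \<i> * (LINT x:{a..b}|lborel. k (Complex x d) - k (Complex x c))) / 2"
proof -
  let ?R = "rectangle a b c d"
  define kx where "kx = (\<lambda>z. frechet_derivative k (at z) 1)"
  define ky where "ky = (\<lambda>z. frechet_derivative k (at z) \<i>)"
  have kR: "C1_on ?R k" using C1_on_subset k by blast
  have cont: "continuous_on ?R kx" "continuous_on ?R ky"
    using kR unfolding C1_on_def kx_def ky_def by auto
  have int: "set_integrable lborel ?R kx" "set_integrable lborel ?R ky"
    unfolding set_integrable_def
    by (intro borel_integrable_compact cont; simp add: rectangle_eq_cbox)+
  have dbar: "wirtinger_dbar k w = (kx w + \<i> * ky w) / 2" for w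
    by (simp add: wirtinger_dbar_def kx_def ky_def)
  have dbar': "wirtinger_dbar k = (\<lambda>w. (kx w + \<i> * ky w) / 2)"
    using dbar by blast
  show "set_integrable lborel ?R (wirtinger_dbar k)"
    unfolding dbar' by (intro set_integral_add set_integrable_mult_right set_integrable_divide int)
  have der: "(k has_derivative (\<lambda>h. of_real (Re h) * kx z + of_real (Im h) * ky z)) (at z)"
    if "z \<in> ?R" for z
    using C1_on_has_derivative[OF kR that] unfolding kx_def ky_def
    by (subst has_derivative_complex_expand[OF C1_on_has_derivative[OF kR that], symmetric])
  have X: "(LINT x|lborel. indicator ?R (Complex x y) *\<^sub>R kx (Complex x y)) =
      indicator {c..d} y *\<^sub>R (k (Complex b y) - k (Complex a y))" for y
  proof (cases "y \<in> {c..d}")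
    case True
    have "(LINT x|lborel. indicator ?R (Complex x y) *\<^sub>R kx (Complex x y)) =
        (LINT x|lborel. indicator {a..b} x *\<^sub>R kx (Complex x y))"
      using True by (intro Bochner_Integration.integral_cong refl) (auto simp: rectangle_def indicator_def)
    also have "\<dots> = k (Complex b y) - k (Complex a y)"
    proof (rule integral_FTC_atLeastAtMost[OF ab(1)])
      fix x assume x: "a \<le> x" "x \<le> b"
      have "((\<lambda>x. Complex x y) has_derivative (\<lambda>h. of_real h)) (at x)"
        unfolding Complex_eq by (auto intro!: derivative_eq_intros)
      moreover have "Complex x y \<in> ?R" using x True by (auto simp: rectangle_def)
      ultimately have "((\<lambda>x. k (Complex x y)) has_derivative
          (\<lambda>h. of_real h * kx (Complex x y))) (at x)"
        using diff_chain_at[OF _ der] by (fastforce simp: o_def)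
      thus "((\<lambda>x. k (Complex x y)) has_vector_derivative kx (Complex x y)) (at x within {a..b})"
        by (auto simp: has_vector_derivative_def scaleR_conv_of_real intro: has_derivative_at_withinI)
    next
      show "continuous_on {a..b} (\<lambda>x. kx (Complex x y))"
        using True by (intro continuous_on_compose2[OF cont(1)])
          (auto simp: rectangle_def Complex_eq intro!: continuous_intros)
    qed
    finally show ?thesis using True by simp
  next
    case False
    hence "indicator ?R (Complex x y) = (0::real)" for x by (auto simp: rectangle_def indicator_def)
    thus ?thesis using False by simp
  qed
  have Y: "(LINT y|lborel. indicator ?R (Complex x y) *\<^sub>R ky (Complex x y)) =
      indicator {a..b} x *\<^sub>R (k (Complex x d) - k (Complex x c))" for x
  proof (cases "x \<in> {a..b}")
    case True
    have "(LINT y|lborel. indicator ?R (Complex x y) *\<^sub>R ky (Complex x y)) =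
        (LINT y|lborel. indicator {c..d} y *\<^sub>R ky (Complex x y))"
      using True by (intro Bochner_Integration.integral_cong refl) (auto simp: rectangle_def indicator_def)
    also have "\<dots> = k (Complex x d) - k (Complex x c)"
    proof (rule integral_FTC_atLeastAtMost[OF ab(2)])
      fix y assume y: "c \<le> y" "y \<le> d"
      have "((\<lambda>y. Complex x y) has_derivative (\<lambda>h. \<i> * of_real h)) (at y)"
        unfolding Complex_eq by (auto intro!: derivative_eq_intros)
      moreover have "Complex x y \<in> ?R" using y True by (auto simp: rectangle_def)
      ultimately have "((\<lambda>y. k (Complex x y)) has_derivative
          (\<lambda>h. of_real h * ky (Complex x y))) (at y)"
        using diff_chain_at[OF _ der] by (fastforce simp: o_def)
      thus "((\<lambda>y. k (Complex x y)) has_vector_derivative ky (Complex x y)) (at y within {c..d})"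
        by (auto simp: has_vector_derivative_def scaleR_conv_of_real intro: has_derivative_at_withinI)
    next
      show "continuous_on {c..d} (\<lambda>y. ky (Complex x y))"
        using True by (intro continuous_on_compose2[OF cont(2)])
          (auto simp: rectangle_def Complex_eq intro!: continuous_intros)
    qed
    finally show ?thesis using True by simp
  next
    case False
    hence "indicator ?R (Complex x y) = (0::real)" for y by (auto simp: rectangle_def indicator_def)
    thus ?thesis using False by simp
  qed
  have "(LINT w:?R|lborel. wirtinger_dbar k w) = ((LINT w:?R|lborel. kx w) + \<i> * (LINT w:?R|lborel. ky w)) / 2"
    unfolding dbar' using int by (simp add: set_integral_add)
  also have "(LINT w:?R|lborel. kx w) = (LINT y:{c..d}|lborel. k (Complex b y) - k (Complex a y))"
    unfolding set_lebesgue_integral_def integral_complex_iterated(1)[OF int(1)[unfolded set_integrable_def]] X ..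
  also have "(LINT w:?R|lborel. ky w) = (LINT x:{a..b}|lborel. k (Complex x d) - k (Complex x c))"
    unfolding set_lebesgue_integral_def integral_complex_iterated(2)[OF int(2)[unfolded set_integrable_def]] Y ..
  finally show "(LINT w:?R|lborel. wirtinger_dbar k w) =
      ((LINT y:{c..d}|lborel. k (Complex b y) - k (Complex a y)) +
        \<i> * (LINT x:{a..b}|lborel. k (Complex x d) - k (Complex x c))) / 2" .
qed

lemma null_sets_Im_eq: "{w. Im w = c} \<in> null_sets lborel"
proof -
  have "negligible {w. \<i> \<bullet> w = c}" by (rule negligible_hyperplane) simp
  moreover have "{w. \<i> \<bullet> w = c} = {w. Im w = c}" by auto
  moreover have "{w. Im w = c} \<in> sets borel"
    by (intro borel_closed closed_Collect_eq continuous_intros)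
  ultimately show ?thesis
    by (metis negligible_iff_null_sets null_sets_completion_iff sets_lborel)
qed

text \<open>Polar coordinates in holomorphic form: the exponential map takes half-open rectangles of height
  $2\pi$ onto closed annuli.\<close>

lemma exp_image_annulus:
  assumes "0 < \<rho>"
  shows "(\<lambda>w. z\<^sub>0 + exp w) ` {w. a \<le> Re w \<and> Re w \<le> ln \<rho> \<and> 0 \<le> Im w \<and> Im w < 2 * pi} =
    {z. exp a \<le> dist z z\<^sub>0 \<and> dist z z\<^sub>0 \<le> \<rho>}" (is "?f ` ?A = ?Z")
proof (intro equalityI subsetI)
  fix z assume "z \<in> ?f ` ?A"
  then obtain w where w: "w \<in> ?A" "z = z\<^sub>0 + exp w" by blast
  have "dist z z\<^sub>0 = exp (Re w)" using w by (simp add: dist_norm)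
  moreover have "exp (Re w) \<le> \<rho>" using w assms by (simp add: ln_ge_iff)
  ultimately show "z \<in> ?Z" using w by simp
next
  fix z assume z: "z \<in> ?Z"
  hence nz: "z - z\<^sub>0 \<noteq> 0" by (metis (no_types, lifting) dist_eq_0_iff eq_iff_diff_eq_0 exp_gt_zero linorder_not_le mem_Collect_eq)
  define w where "w = Complex (ln (norm (z - z\<^sub>0))) (Arg2pi (z - z\<^sub>0))"
  have "exp w = of_real (norm (z - z\<^sub>0)) * exp (\<i> * of_real (Arg2pi (z - z\<^sub>0)))"
    using nz by (simp add: w_def Complex_eq exp_add exp_of_real)
  also have "\<dots> = z - z\<^sub>0" using Arg2pi_eq[of "z - z\<^sub>0"] by simp
  finally have "?f w = z" by simp
  moreover have "w \<in> ?A"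
    using z nz assms Arg2pi_ge_0[of "z - z\<^sub>0"] Arg2pi_lt_2pi[of "z - z\<^sub>0"]
    by (auto simp: w_def dist_norm ln_ge_iff)
  ultimately show "z \<in> ?f ` ?A" by blast
qed

text \<open>The Cauchy--Pompeiu formula for a function with at most a simple pole, of residue \<open>L\<close>, that
  vanishes on the boundary of the disc. The integrability of $\bar\partial f$ is a hypothesis; the
  other partial derivatives of \<open>f\<close> may grow arbitrarily near the pole.\<close>

lemma integral_wirtinger_dbar_punctured_disc:
  assumes f: "C1_on (ball z\<^sub>0 R - {z\<^sub>0}) f" and \<rho>: "0 < \<rho>" "\<rho> < R"
    and zero: "\<And>z. dist z z\<^sub>0 = \<rho> \<Longrightarrow> f z = 0"
    and int: "set_integrable lborel (cball z\<^sub>0 \<rho> - {z\<^sub>0}) (wirtinger_dbar f)"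
    and lim: "((\<lambda>z. (z - z\<^sub>0) * f z) \<longlongrightarrow> L) (at z\<^sub>0)"
  shows "(LINT z:cball z\<^sub>0 \<rho> - {z\<^sub>0}|lborel. wirtinger_dbar f z) = - (of_real pi * L)"
proof -
  define T where "T = (\<lambda>w. z\<^sub>0 + exp w)"
  \<comment> \<open>The pull-back of the form $f\,dz$ under \<open>T\<close> is $k\,dw$; it is periodic in the imaginary
    direction and tends to \<open>L\<close> as the real part tends to $-\infty$.\<close>
  define k where "k = (\<lambda>w. exp w * f (T w))"
  define A where "A = (\<lambda>n::nat. {w. - real n \<le> Re w \<and> Re w \<le> ln \<rho> \<and> 0 \<le> Im w \<and> Im w < 2 * pi})"
  define Z where "Z = (\<lambda>n::nat. {z. exp (- real n) \<le> dist z z\<^sub>0 \<and> dist z z\<^sub>0 \<le> \<rho>})"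
  define U where "U = {w. Re w < ln R}"
  have R: "0 < R" using \<rho> by simp
  have U: "open U" unfolding U_def by (intro open_Collect_less continuous_intros)
  have T_holo: "T holomorphic_on X" for X unfolding T_def by (intro holomorphic_intros)
  have dT: "deriv T w = exp w" for w
    unfolding T_def by (intro DERIV_imp_deriv) (auto intro!: derivative_eq_intros)
  have TU: "T w \<in> ball z\<^sub>0 R - {z\<^sub>0}" if "w \<in> U" for w
  proof -
    have "exp (Re w) < R" using that R unfolding U_def by (metis exp_less_cancel_iff exp_ln mem_Collect_eq)
    thus ?thesis by (simp add: T_def dist_norm)
  qed
  have fT: "C1_on U (\<lambda>w. f (T w))"
    using TU by (intro C1_on_compose_holomorphic[OF f T_holo U]) auto
  have k: "C1_on U k" unfolding k_def
    by (intro C1_on_mult fT C1_on_holomorphic U holomorphic_intros)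
  have dk: "wirtinger_dbar k w = of_real ((norm (deriv T w))\<^sup>2) * wirtinger_dbar f (T w)" if "w \<in> U" for w
  proof -
    have "wirtinger_dbar k w = exp w * wirtinger_dbar (\<lambda>w. f (T w)) w + wirtinger_dbar exp w * f (T w)"
      unfolding k_def using fT that
      by (intro wirtinger_dbar_mult) (auto simp: C1_on_def intro!: field_differentiable_imp_differentiable field_differentiable_within_exp)
    also have "wirtinger_dbar exp w = 0"
      by (intro wirtinger_dbar_holomorphic field_differentiable_within_exp)
    also have "wirtinger_dbar (\<lambda>w. f (T w)) w = wirtinger_dbar f (T w) * cnj (deriv T w)"
    proof (rule wirtinger_dbar_compose)
      show "f differentiable at (T w)" using f TU[OF that] by (auto simp: C1_on_def)
      show "T field_differentiable at w" using T_holo[of UNIV] holomorphic_on_imp_differentiable_at by blast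
    qed
    finally show ?thesis unfolding dT complex_norm_square by (simp add: mult_ac)
  qed
  have AZ: "T ` A n = Z n" for n
    unfolding T_def A_def Z_def using exp_image_annulus[OF \<rho>(1)] by simp
  have lnlt: "ln \<rho> < ln R" using \<rho> by simp
  have rU: "rectangle (- real n) (ln \<rho>) 0 (2 * pi) \<subseteq> U" for n
    using lnlt by (auto simp: rectangle_def U_def)
  have AU: "A n \<subseteq> U" for n using lnlt by (auto simp: A_def U_def)
  have Ab: "A n \<in> sets borel" for n
  proof -
    have "A n = {w. - real n \<le> Re w} \<inter> {w. Re w \<le> ln \<rho>} \<inter> {w. 0 \<le> Im w} \<inter> {w. Im w < 2 * pi}"
      by (auto simp: A_def)
    thus ?thesis
      by (auto intro!: sets.Int borel_closed borel_open closed_Collect_le open_Collect_less continuous_intros)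
  qed
  have Zb: "Z n \<in> sets borel" for n
  proof -
    have "Z n = {z. exp (- real n) \<le> dist z z\<^sub>0} \<inter> {z. dist z z\<^sub>0 \<le> \<rho>}"
      by (auto simp: Z_def)
    thus ?thesis
      by (auto intro!: sets.Int borel_closed closed_Collect_le continuous_intros)
  qed
  have ZU: "(\<Union>n. Z n) = cball z\<^sub>0 \<rho> - {z\<^sub>0}"
  proof (intro equalityI subsetI)
    fix z assume "z \<in> cball z\<^sub>0 \<rho> - {z\<^sub>0}"
    hence z: "dist z z\<^sub>0 \<le> \<rho>" "0 < dist z z\<^sub>0" by (auto simp: dist_commute)
    obtain n :: nat where "- ln (dist z z\<^sub>0) \<le> real n" using real_arch_simple by blast
    hence "- real n \<le> ln (dist z z\<^sub>0)" by simp
    hence "exp (- real n) \<le> dist z z\<^sub>0" using z(2) by (simp only: ln_ge_iff)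
    thus "z \<in> (\<Union>n. Z n)" using z by (auto simp: Z_def)
  qed (auto simp: Z_def dist_commute)
  have inc: "incseq Z"
    by (rule incseq_SucI) (auto simp: Z_def intro: order_trans[rotated])
  have injT: "inj_on T (A n)" for n
    by (rule inj_onI) (auto simp: T_def A_def intro!: exp_complex_eqI)
  have intZ: "set_integrable lborel (Z n) (wirtinger_dbar f)" for n
    by (rule set_integrable_subset[OF int]) (use Zb ZU in auto)
  have val: "(LINT z:Z n|lborel. wirtinger_dbar f z) =
      - (LINT y:{0..2 * pi}|lborel. k (Complex (- real n) y)) / 2" if n: "- real n \<le> ln \<rho>" for n
  proof -
    let ?R = "rectangle (- real n) (ln \<rho>) 0 (2 * pi)"
    \<comment> \<open>Periodicity cancels the horizontal edges; the right edge maps to the boundary circle.\<close>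
    have edge_Im: "k (Complex x (2*pi)) - k (Complex x 0) = 0" for x
    proof -
      have "exp (Complex x (2*pi)) = exp (Complex x 0)"
        using exp_two_pi_i' by (simp add: Complex_eq exp_add mult.commute[of 2])
      thus ?thesis by (simp add: k_def T_def)
    qed
    have edge_Re: "k (Complex (ln \<rho>) y) = 0" for y
      using zero[of "T (Complex (ln \<rho>) y)"] \<rho> by (simp add: k_def T_def dist_norm)
    have "(LINT z:Z n|lborel. wirtinger_dbar f z) =
        (LINT w:A n|lborel. of_real ((norm (deriv T w))\<^sup>2) * wirtinger_dbar f (T w))"
      using holomorphic_change_of_variables(2)[OF U T_holo AU Ab _ injT, of n "wirtinger_dbar f"] Zb intZ
      unfolding AZ by metis
    also have "\<dots> = (LINT w:A n|lborel. wirtinger_dbar k w)"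
      using Ab dk[OF subsetD[OF AU]] by (intro set_lebesgue_integral_cong) auto
    also have "\<dots> = (LINT w:?R|lborel. wirtinger_dbar k w)"
    proof (rule set_integral_cong_set)
      have "set_integrable lborel ?R (wirtinger_dbar k)"
        by (rule integral_wirtinger_dbar_rectangle(1)[OF k rU]) (use n in auto)
      moreover have "A n \<subseteq> ?R" by (auto simp: A_def rectangle_def)
      ultimately show "set_borel_measurable lborel ?R (wirtinger_dbar k)"
        "set_borel_measurable lborel (A n) (wirtinger_dbar k)"
        using Ab set_integrable_subset[of lborel ?R "wirtinger_dbar k" "A n"]
        by (auto simp: set_integrable_def set_borel_measurable_def dest: borel_measurable_integrable)
      have "AE w in lborel. w \<notin> {w. Im w = 2 * pi}"
        by (rule AE_not_in[OF null_sets_Im_eq])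
      thus "AE w in lborel. (w \<in> ?R) = (w \<in> A n)"
        by eventually_elim (auto simp: A_def rectangle_def)
    qed
    also have "\<dots> = ((LINT y:{0..2*pi}|lborel. k (Complex (ln \<rho>) y) - k (Complex (- real n) y)) +
        \<i> * (LINT x:{- real n..ln \<rho>}|lborel. k (Complex x (2*pi)) - k (Complex x 0))) / 2"
      by (rule integral_wirtinger_dbar_rectangle(2)[OF k rU]) (use n in auto)
    finally show ?thesis using edge_Im edge_Re by (simp add: set_lebesgue_integral_def)
  qed
  have klim: "\<forall>\<epsilon>>0. \<exists>N::nat. \<forall>n\<ge>N. \<forall>y. dist (k (Complex (- real n) y)) L < \<epsilon>"
  proof (intro allI impI)
    fix \<epsilon> :: real assume "\<epsilon> > 0"
    then obtain \<delta> where \<delta>: "\<delta> > 0" "\<And>z. z \<noteq> z\<^sub>0 \<Longrightarrow> dist z z\<^sub>0 < \<delta> \<Longrightarrow> dist ((z - z\<^sub>0) * f z) L < \<epsilon>"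
      using lim unfolding LIM_def by metis
    obtain N :: nat where N: "- ln \<delta> < real N" using reals_Archimedean2 by blast
    show "\<exists>N::nat. \<forall>n\<ge>N. \<forall>y. dist (k (Complex (- real n) y)) L < \<epsilon>"
    proof (intro exI allI impI)
      fix n y assume n: "N \<le> n"
      have "exp (- real n) < exp (ln \<delta>)" using N n by (simp del: exp_ln)
      hence "dist (T (Complex (- real n) y)) z\<^sub>0 < \<delta>" using \<delta>(1) by (simp add: T_def dist_norm)
      moreover have "T (Complex (- real n) y) \<noteq> z\<^sub>0" by (simp add: T_def)
      ultimately show "dist (k (Complex (- real n) y)) L < \<epsilon>"
        using \<delta>(2) by (force simp: k_def T_def)
    qed
  qed
  obtain N0 :: nat where N0: "- ln \<rho> \<le> real N0" using real_arch_simple by blast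
  obtain N1 where N1: "\<And>n y. n \<ge> N1 \<Longrightarrow> dist (k (Complex (- real n) y)) L < 1"
    using klim by (metis zero_less_one)
  \<comment> \<open>From the index \<open>N\<close> on, the rectangles are nonempty and \<open>k\<close> is bounded by $|L| + 1$ on their
    left edges.\<close>
  define N where "N = max N0 N1"
  have "(\<lambda>n. LINT y|lborel. indicator {0..2*pi} y *\<^sub>R k (Complex (- real (n + N)) y)) \<longlonglongrightarrow>
      (LINT y|lborel. indicator {0..2*pi} y *\<^sub>R L)"
  proof (rule integral_dominated_convergence[where w = "\<lambda>y. indicator {0..2*pi} y *\<^sub>R (norm L + 1)"])
    show "(\<lambda>y. indicator {0..2*pi} y *\<^sub>R L) \<in> borel_measurable lborel" by simp
    show "integrable lborel (\<lambda>y. indicator {0..2*pi} y *\<^sub>R (norm L + 1))"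
      by (intro borel_integrable_compact) auto
    fix n
    have "Complex (- real (n + N)) y \<in> U" for y
      using rU[of "n + N"] N0 lnlt by (auto simp: U_def N_def)
    hence "continuous_on {0..2*pi} (\<lambda>y. k (Complex (- real (n + N)) y))"
      by (intro continuous_on_compose2[OF C1_on_imp_continuous_on[OF k]])
        (auto simp: Complex_eq intro!: continuous_intros)
    thus "(\<lambda>y. indicator {0..2*pi} y *\<^sub>R k (Complex (- real (n + N)) y)) \<in> borel_measurable lborel"
      using borel_measurable_continuous_on_indicator[of "{0..2*pi}"] by simp
    have "norm (k (Complex (- real (n + N)) y)) \<le> norm L + 1" for y
    proof -
      have "N1 \<le> n + N" by (simp add: N_def)
      from N1[OF this, of y] norm_triangle_sub[of "k (Complex (- real (n + N)) y)" L]
      show ?thesis unfolding dist_norm by linarith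
    qed
    thus "AE y in lborel. norm (indicator {0..2*pi} y *\<^sub>R k (Complex (- real (n + N)) y))
        \<le> indicator {0..2*pi} y *\<^sub>R (norm L + 1)"
      by (auto simp: indicator_def)
  next
    have "(\<lambda>n. k (Complex (- real (n + N)) y)) \<longlonglongrightarrow> L" for y
      unfolding LIMSEQ_def using klim by (meson trans_le_add1)
    thus "AE y in lborel. (\<lambda>n. indicator {0..2*pi} y *\<^sub>R k (Complex (- real (n + N)) y)) \<longlonglongrightarrow>
        indicator {0..2*pi} y *\<^sub>R L"
      by (auto intro!: tendsto_intros)
  qed
  also have "(LINT y|lborel. indicator {0..2*pi} y *\<^sub>R L) = of_real (2 * pi) * L"
    by (simp add: scaleR_conv_of_real)
  finally have "(\<lambda>n. - (LINT y:{0..2 * pi}|lborel. k (Complex (- real (n + N)) y)) / 2) \<longlonglongrightarrow>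
      - (of_real (2 * pi) * L) / 2"
    unfolding set_lebesgue_integral_def by (intro tendsto_intros) auto
  moreover have "- (LINT y:{0..2 * pi}|lborel. k (Complex (- real (n + N)) y)) / 2 =
      (LINT z:Z (n + N)|lborel. wirtinger_dbar f z)" for n
    using N0 by (intro val[symmetric]) (auto simp: N_def)
  ultimately have "(\<lambda>n. LINT z:Z (n + N)|lborel. wirtinger_dbar f z) \<longlonglongrightarrow> - (of_real pi * L)"
    by simp
  moreover have "(\<lambda>n. LINT z:Z n|lborel. wirtinger_dbar f z) \<longlonglongrightarrow>
      (LINT z:(\<Union>n. Z n)|lborel. wirtinger_dbar f z)"
    using Zb inc int by (intro set_integral_cont_up) (auto simp: ZU)
  hence "(\<lambda>n. LINT z:Z (n + N)|lborel. wirtinger_dbar f z) \<longlonglongrightarrow>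
      (LINT z:(\<Union>n. Z n)|lborel. wirtinger_dbar f z)"
    by (rule LIMSEQ_ignore_initial_segment)
  ultimately show ?thesis using LIMSEQ_unique unfolding ZU by blast
qed

lemma integrable_Re_times_Im:
  fixes g h :: "real \<Rightarrow> real"
  assumes g: "integrable lborel g" and h: "integrable lborel h"
  shows "integrable lborel (\<lambda>z. g (Re z) * h (Im z))"
proof -
  have [measurable]: "g \<in> borel_measurable borel" "h \<in> borel_measurable borel"
    using g h by (auto dest: borel_measurable_integrable)
  have "integrable (lborel \<Otimes>\<^sub>M lborel) (\<lambda>p. g (fst p) * h (snd p))"
  proof (rule lborel_pair.Fubini_integrable)
    show "integrable lborel (\<lambda>x. LINT y|lborel. norm (g (fst (x, y)) * h (snd (x, y))))"
      using g h by (simp add: abs_mult)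
  qed (use h in auto)
  thus ?thesis
    by (subst lborel_complex_eq_distr_prod, subst integrable_distr_eq)
      (auto simp: case_prod_unfold lborel_prod intro: measurable_Complex)
qed

text \<open>$1/|z - z_0|$ is locally integrable: under $w = -\log(z-z_0)$ it corresponds to
  $e^{-\mathrm{Re}\,w}$ on a half strip. The slit left out by the logarithm is a null set.\<close>

lemma set_integrable_inverse_norm:
  fixes z\<^sub>0 :: complex
  assumes \<rho>: "0 < \<rho>"
  shows "set_integrable lborel (cball z\<^sub>0 \<rho> - {z\<^sub>0}) (\<lambda>z. of_real (1 / dist z z\<^sub>0) :: complex)"
proof -
  define V where "V = {z. z - z\<^sub>0 \<notin> \<real>\<^sub>\<le>\<^sub>0}"
  define S where "S = cball z\<^sub>0 \<rho> \<inter> V"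
  define T where "T = (\<lambda>z. - Ln (z - z\<^sub>0))"
  define W where "W = {w. - ln \<rho> \<le> Re w \<and> - pi < Im w \<and> Im w < pi}"
  have V: "open V"
  proof -
    have "V = (\<lambda>z. z - z\<^sub>0) -` (- \<real>\<^sub>\<le>\<^sub>0)" by (auto simp: V_def)
    thus ?thesis by (auto intro!: open_vimage continuous_intros)
  qed
  have dT: "(T has_field_derivative - (1 / (z - z\<^sub>0))) (at z)" if "z \<in> V" for z
    using that unfolding T_def V_def by (auto intro!: derivative_eq_intros simp: inverse_eq_divide)
  have T_holo: "T holomorphic_on V"
    using dT V by (auto simp: holomorphic_on_open)
  have TS: "T ` S = W"
  proof (intro equalityI subsetI)
    fix w assume "w \<in> T ` S"
    then obtain z where z: "z \<in> S" "w = T z" by blast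
    have nz: "z - z\<^sub>0 \<noteq> 0" using z by (auto simp: S_def V_def)
    have "ln (norm (z - z\<^sub>0)) \<le> ln \<rho>" using z nz \<rho> by (simp add: S_def dist_norm norm_minus_commute)
    moreover have "\<bar>Im (Ln (z - z\<^sub>0))\<bar> < pi"
    proof -
      have "Im (Ln (z - z\<^sub>0)) \<noteq> pi" using z nz
        by (auto simp: S_def V_def Im_Ln_eq_pi complex_nonpos_Reals_iff)
      thus ?thesis using mpi_less_Im_Ln[OF nz] Im_Ln_le_pi[OF nz] by linarith
    qed
    ultimately show "w \<in> W" using nz z by (auto simp: W_def T_def)
  next
    fix w assume w: "w \<in> W"
    have l: "Ln (exp (- w)) = - w" using w by (intro Ln_exp) (auto simp: W_def)
    have "T (z\<^sub>0 + exp (- w)) = w" by (simp add: T_def l)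
    moreover have "exp (- w) \<notin> \<real>\<^sub>\<le>\<^sub>0"
    proof
      assume "exp (- w) \<in> \<real>\<^sub>\<le>\<^sub>0"
      moreover have "Re (exp (- w)) \<noteq> 0 \<or> Im (exp (- w)) \<noteq> 0"
        using exp_not_eq_zero[of "- w"] unfolding complex_eq_iff by simp
      ultimately have "Im (Ln (exp (- w))) = pi"
        by (subst Im_Ln_eq_pi) (auto simp: complex_nonpos_Reals_iff less_le)
      thus False using w l by (simp add: W_def)
    qed
    moreover have "exp (- Re w) \<le> \<rho>"
      using w \<rho> by (simp add: W_def) (metis exp_le_cancel_iff exp_ln minus_le_iff)
    ultimately show "w \<in> T ` S"
      by (intro image_eqI[of _ _ "z\<^sub>0 + exp (- w)"]) (auto simp: S_def V_def dist_norm)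
  qed
  have Wb: "W \<in> sets borel"
  proof -
    have "W = {w. - ln \<rho> \<le> Re w} \<inter> {w. - pi < Im w} \<inter> {w. Im w < pi}" by (auto simp: W_def)
    thus ?thesis
      by (auto intro!: sets.Int borel_closed borel_open closed_Collect_le open_Collect_less continuous_intros)
  qed
  have Sb: "S \<in> sets borel" unfolding S_def using V by (auto intro!: sets.Int borel_closed borel_open)
  have inj: "inj_on T S"
  proof (rule inj_onI)
    fix x y assume xy: "x \<in> S" "y \<in> S" "T x = T y"
    hence "x - z\<^sub>0 \<noteq> 0" "y - z\<^sub>0 \<noteq> 0" by (auto simp: S_def V_def)
    moreover have "exp (Ln (x - z\<^sub>0)) = exp (Ln (y - z\<^sub>0))" using xy by (simp add: T_def)
    ultimately show "x = y" by simp
  qed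
  have "set_integrable lebesgue {- ln \<rho>..} (\<lambda>x. exp (- x))"
    using has_integral_exp_minus_to_infinity[of 1 "- ln \<rho>"]
    by (intro nonnegative_absolutely_integrable_1) (auto simp: integrable_on_def)
  hence g: "integrable lborel (\<lambda>x. indicator {- ln \<rho>..} x *\<^sub>R exp (- x))"
    unfolding set_integrable_def by (subst (asm) integrable_completion) auto
  have h: "integrable lborel (indicator {- pi<..<pi} :: real \<Rightarrow> real)"
    by (rule integrable_real_indicator) auto
  have fun_eq: "(\<lambda>w. indicator W w *\<^sub>R (of_real (exp (- Re w)) :: complex)) =
     (\<lambda>w. of_real (indicator {- ln \<rho>..} (Re w) *\<^sub>R exp (- Re w) * indicator {- pi<..<pi} (Im w)))"
    by (auto simp: W_def indicator_def)
  have "set_integrable lborel W (\<lambda>w. of_real (exp (- Re w)) :: complex)"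
    unfolding set_integrable_def fun_eq
    by (intro integrable_of_real integrable_Re_times_Im[OF g h])
  hence "set_integrable lborel S (\<lambda>z. of_real ((norm (deriv T z))\<^sup>2) * (of_real (exp (- Re (T z))) :: complex))"
    using holomorphic_change_of_variables(1)[OF V T_holo _ Sb _ inj, of "\<lambda>w. of_real (exp (- Re w))"] Wb
    unfolding TS by (simp add: S_def)
  also have "?this \<longleftrightarrow> set_integrable lborel S (\<lambda>z. of_real (1 / dist z z\<^sub>0) :: complex)"
  proof (rule set_integrable_cong)
    fix z assume "z \<in> S"
    hence z: "z \<in> V" "z - z\<^sub>0 \<noteq> 0" by (auto simp: S_def V_def)
    have "deriv T z = - (1 / (z - z\<^sub>0))" using dT[OF z(1)] by (rule DERIV_imp_deriv)
    thus "complex_of_real ((norm (deriv T z))\<^sup>2) * of_real (exp (- Re (T z))) = of_real (1 / dist z z\<^sub>0)"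
      using z(2) unfolding T_def
      by (simp add: norm_divide dist_norm power2_eq_square)
  qed auto
  finally have S_int: "set_integrable lborel S (\<lambda>z. of_real (1 / dist z z\<^sub>0) :: complex)" .
  let ?C = "cball z\<^sub>0 \<rho> - {z\<^sub>0}"
  have Sub: "S \<subseteq> ?C" by (auto simp: S_def V_def)
  have "continuous_on ?C (\<lambda>z. of_real (1 / dist z z\<^sub>0) :: complex)"
    by (intro continuous_intros) auto
  hence meas: "set_borel_measurable lborel ?C (\<lambda>z. of_real (1 / dist z z\<^sub>0) :: complex)"
    unfolding set_borel_measurable_def
    using borel_measurable_continuous_on_indicator[of ?C "\<lambda>z. of_real (1 / dist z z\<^sub>0) :: complex"]
    by (simp add: sets.Diff borel_closed)
  have "AE z in lborel. (indicator S z *\<^sub>R (of_real (1 / dist z z\<^sub>0) :: complex)) =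
      indicator ?C z *\<^sub>R of_real (1 / dist z z\<^sub>0)"
  proof -
    have "AE z in lborel. z \<notin> {z. Im z = Im z\<^sub>0}" by (rule AE_not_in[OF null_sets_Im_eq])
    thus ?thesis
      by eventually_elim (auto simp: S_def V_def indicator_def complex_nonpos_Reals_iff)
  qed
  thus ?thesis
    unfolding set_integrable_def
    using S_int[unfolded set_integrable_def] meas[unfolded set_borel_measurable_def]
    by (intro integrable_cong_AE_imp[OF S_int[unfolded set_integrable_def]]) auto
qed

lemma set_integrable_punctured_disc:
  fixes w :: "complex \<Rightarrow> complex"
  assumes "0 < \<rho>" and cont: "continuous_on (cball z\<^sub>0 \<rho> - {z\<^sub>0}) w"
    and bnd: "\<And>z. z \<in> cball z\<^sub>0 \<rho> - {z\<^sub>0} \<Longrightarrow> norm (w z) \<le> K / dist z z\<^sub>0"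
  shows "set_integrable lborel (cball z\<^sub>0 \<rho> - {z\<^sub>0}) w"
proof (rule set_integrable_bound)
  show "set_integrable lborel (cball z\<^sub>0 \<rho> - {z\<^sub>0}) (\<lambda>z. of_real K * of_real (1 / dist z z\<^sub>0) :: complex)"
    by (intro set_integrable_mult_right set_integrable_inverse_norm assms)
  show "set_borel_measurable lborel (cball z\<^sub>0 \<rho> - {z\<^sub>0}) w"
    unfolding set_borel_measurable_def
    using borel_measurable_continuous_on_indicator[OF _ cont] by (auto intro!: sets.Diff borel_closed)
  have "norm (w z) \<le> norm (of_real K * of_real (1 / dist z z\<^sub>0) :: complex)" if "z \<in> cball z\<^sub>0 \<rho> - {z\<^sub>0}" for z
  proof -
    have "norm (w z) \<le> K / dist z z\<^sub>0" by (rule bnd[OF that])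
    also have "\<dots> \<le> \<bar>K\<bar> / dist z z\<^sub>0" by (intro divide_right_mono) auto
    also have "\<dots> = norm (of_real K * of_real (1 / dist z z\<^sub>0) :: complex)"
      unfolding norm_mult norm_of_real by simp
    finally show ?thesis .
  qed
  thus "AE z in lborel. z \<in> cball z\<^sub>0 \<rho> - {z\<^sub>0} \<longrightarrow>
      norm (w z) \<le> norm (of_real K * of_real (1 / dist z z\<^sub>0) :: complex)" by blast
qed

section \<open>Bump functions\<close>

lemma has_real_derivative_positive_part_square:
  "((\<lambda>x::real. (max 0 x)\<^sup>2) has_real_derivative 2 * max 0 x) (at x)"
proof -
  consider "x > 0" | "x < 0" | "x = 0" by linarith
  thus ?thesis
  proof cases
    case 1
    have "((\<lambda>x::real. x\<^sup>2) has_real_derivative 2 * x) (at x)" by (auto intro!: derivative_eq_intros)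
    hence "((\<lambda>x::real. (max 0 x)\<^sup>2) has_real_derivative 2 * x) (at x)"
      by (rule has_field_derivative_transform_within_open[of _ _ _ "{0<..}"]) (use 1 in auto)
    thus ?thesis using 1 by simp
  next
    case 2
    have "((\<lambda>x::real. 0) has_real_derivative 0) (at x)" by simp
    hence "((\<lambda>x::real. (max 0 x)\<^sup>2) has_real_derivative 0) (at x)"
      by (rule has_field_derivative_transform_within_open[of _ _ _ "{..<0}"]) (use 2 in auto)
    thus ?thesis using 2 by simp
  next
    case 3
    have "((\<lambda>h::real. (max 0 h)\<^sup>2 / h) \<longlongrightarrow> 0) (at 0)"
    proof (rule Lim_null_comparison)
      show "\<forall>\<^sub>F h::real in at 0. norm ((max 0 h)\<^sup>2 / h) \<le> \<bar>h\<bar>"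
        by (rule always_eventually) (auto simp: max_def power2_eq_square)
      show "((\<lambda>h::real. \<bar>h\<bar>) \<longlongrightarrow> 0) (at 0)" by (auto intro!: tendsto_eq_intros)
    qed
    thus ?thesis using 3 by (simp add: DERIV_def)
  qed
qed

lemma C1_on_positive_part_square:
  assumes f: "C1_on S f"
  shows "C1_on S (\<lambda>z. of_real ((max 0 (Re (f z)))\<^sup>2))"
proof (rule C1_onI)
  fix z assume z: "z \<in> S"
  have "((\<lambda>z. Re (f z)) has_derivative (\<lambda>h. Re (frechet_derivative f (at z) h))) (at z)"
    using bounded_linear.has_derivative[OF bounded_linear_Re C1_on_has_derivative[OF f z]] .
  from diff_chain_at[OF this has_real_derivative_positive_part_square[unfolded has_field_derivative_def]]
  have "((\<lambda>z. (max 0 (Re (f z)))\<^sup>2) has_derivative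
      (\<lambda>h. 2 * max 0 (Re (f z)) * Re (frechet_derivative f (at z) h))) (at z)"
    by (simp add: o_def)
  from bounded_linear.has_derivative[OF bounded_linear_of_real this]
  show "((\<lambda>z. of_real ((max 0 (Re (f z)))\<^sup>2)) has_derivative
      (\<lambda>h. of_real (2 * max 0 (Re (f z)) * Re (frechet_derivative f (at z) h)) :: complex)) (at z)" .
qed (insert f C1_on_imp_continuous_on[OF f], auto simp: C1_on_def intro!: continuous_intros)

text \<open>A continuously differentiable function which is 1 on the disc of radius \<open>r\<close> about \<open>z\<^sub>0\<close> and
  vanishes off the disc of radius \<open>2 * r\<close>. With $x_+ = \max(0,x)$ it is
  $((1 - ((t - 1)_+)^2)_+)^2$ for $t = |z-z_0|^2/r^2$. One continuous derivative is all that is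
  needed for Stokes' theorem.\<close>

definition bump :: "complex \<Rightarrow> real \<Rightarrow> complex \<Rightarrow> complex" where
  "bump z\<^sub>0 r z = of_real ((max 0 (1 - (max 0 ((dist z z\<^sub>0)\<^sup>2 / r\<^sup>2 - 1))\<^sup>2))\<^sup>2)"

lemma C1_on_bump: "C1_on S (bump z\<^sub>0 r)"
proof -
  have cnj: "C1_on S cnj"
    by (rule C1_onI[where D = "\<lambda>_. cnj"])
      (auto intro: bounded_linear_imp_has_derivative bounded_linear_cnj)
  have id: "C1_on S (\<lambda>z. z)"
    by (rule C1_onI[where D = "\<lambda>_ h. h"]) auto
  have "C1_on S (\<lambda>z. of_real (1 / r\<^sup>2) * ((z - z\<^sub>0) * (cnj z - cnj z\<^sub>0)) - 1)"
    by (intro C1_on_diff C1_on_cmult C1_on_mult cnj id C1_on_const)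
  also have "(\<lambda>z. of_real (1 / r\<^sup>2) * ((z - z\<^sub>0) * (cnj z - cnj z\<^sub>0)) - 1) =
      (\<lambda>z. of_real ((dist z z\<^sub>0)\<^sup>2 / r\<^sup>2 - 1))"
    by (simp add: fun_eq_iff dist_norm complex_norm_square del: of_real_power flip: complex_cnj_diff)
  finally have 1: "C1_on S (\<lambda>z. complex_of_real ((dist z z\<^sub>0)\<^sup>2 / r\<^sup>2 - 1))" .
  have "C1_on S (\<lambda>z. of_real ((max 0 (Re (1 -
      of_real ((max 0 (Re (complex_of_real ((dist z z\<^sub>0)\<^sup>2 / r\<^sup>2 - 1))))\<^sup>2))))\<^sup>2))"
    by (intro C1_on_positive_part_square C1_on_diff C1_on_const 1)
  also have "(\<lambda>z. complex_of_real ((max 0 (Re (1 -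
      of_real ((max 0 (Re (complex_of_real ((dist z z\<^sub>0)\<^sup>2 / r\<^sup>2 - 1))))\<^sup>2))))\<^sup>2)) = bump z\<^sub>0 r"
    by (simp add: bump_def fun_eq_iff del: of_real_power of_real_diff of_real_divide)
  finally show ?thesis .
qed

lemma bump_eq_1:
  assumes "0 < r" "dist z z\<^sub>0 \<le> r"
  shows "bump z\<^sub>0 r z = 1"
proof -
  have "(dist z z\<^sub>0)\<^sup>2 \<le> r\<^sup>2" using assms by (intro power_mono) auto
  hence "(dist z z\<^sub>0)\<^sup>2 / r\<^sup>2 \<le> 1" using assms by simp
  thus ?thesis by (simp add: bump_def)
qed

lemma bump_eq_0:
  assumes "0 < r" "2 * r \<le> dist z z\<^sub>0"
  shows "bump z\<^sub>0 r z = 0"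
proof -
  have "(2 * r)\<^sup>2 \<le> (dist z z\<^sub>0)\<^sup>2" using assms by (intro power_mono) auto
  hence "4 \<le> (dist z z\<^sub>0)\<^sup>2 / r\<^sup>2" using assms by (simp add: field_simps)
  hence "1 \<le> (dist z z\<^sub>0)\<^sup>2 / r\<^sup>2 - 1" by linarith
  hence "1\<^sup>2 \<le> (max 0 ((dist z z\<^sub>0)\<^sup>2 / r\<^sup>2 - 1))\<^sup>2" by (intro power_mono) auto
  thus ?thesis by (simp add: bump_def)
qed

section \<open>Charts of a Riemann surface\<close>

lemma chart_inv_left [simp]: "complex_chart c \<Longrightarrow> x \<in> fst c \<Longrightarrow> chart_inv c (snd c x) = x"
  unfolding complex_chart_def homeomorphism_def by blast

lemma chart_inv_right [simp]: "complex_chart c \<Longrightarrow> z \<in> snd c ` fst c \<Longrightarrow> snd c (chart_inv c z) = z"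
  unfolding complex_chart_def homeomorphism_def by blast

lemma chart_inj_on: "complex_chart c \<Longrightarrow> inj_on (snd c) (fst c)"
  by (metis chart_inv_left inj_onI)

lemma local_rep_chart [simp]: "complex_chart c \<Longrightarrow> x \<in> fst c \<Longrightarrow> local_rep c f (snd c x) = f x"
  by (simp add: local_rep_def)

lemma open_chart_domain: "complex_chart c \<Longrightarrow> open (fst c)"
  by (simp add: complex_chart_def)

lemma continuous_on_chart: "complex_chart c \<Longrightarrow> continuous_on (fst c) (snd c)"
  unfolding complex_chart_def homeomorphism_def by blast

lemma continuous_on_chart_inv: "complex_chart c \<Longrightarrow> continuous_on (snd c ` fst c) (chart_inv c)"
  unfolding complex_chart_def homeomorphism_def by blast

lemma chart_image_vimage:
  assumes "complex_chart c"
  shows "snd c ` (fst c \<inter> X) = chart_inv c -` X \<inter> snd c ` fst c"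
  using assms by (auto simp: image_iff)

lemma open_chart_image:
  assumes c: "complex_chart c" and X: "open X"
  shows "open (snd c ` (fst c \<inter> X))"
proof -
  have "open (snd c ` fst c)" using c by (simp add: complex_chart_def)
  thus ?thesis unfolding chart_image_vimage[OF c]
    using continuous_on_chart_inv[OF c] X continuous_on_open_vimage by blast
qed

lemma borel_chart_image:
  assumes c: "complex_chart c" and E: "E \<in> sets borel" "E \<subseteq> fst c"
  shows "snd c ` E \<in> sets borel"
proof -
  have op: "open (snd c ` fst c)" using c by (simp add: complex_chart_def)
  have "chart_inv c \<in> borel_measurable (restrict_space borel (snd c ` fst c))"
    by (rule borel_measurable_continuous_on_restrict[OF continuous_on_chart_inv[OF c]])
  from measurable_sets[OF this E(1)]
  have "chart_inv c -` E \<inter> snd c ` fst c \<in> sets (restrict_space borel (snd c ` fst c))"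
    by (simp add: space_restrict_space)
  hence "chart_inv c -` E \<inter> snd c ` fst c \<in> sets borel"
    using op by (subst (asm) sets_restrict_space_iff) auto
  moreover have "snd c ` (fst c \<inter> E) = snd c ` E" using E by (simp add: Int_absorb1)
  ultimately show ?thesis using chart_image_vimage[OF c, of E] by simp
qed

lemma continuous_on_local_rep:
  assumes c: "complex_chart c" and f: "continuous_on (fst c \<inter> S) f"
  shows "continuous_on (snd c ` (fst c \<inter> S)) (local_rep c f)"
  unfolding local_rep_def using c
  by (intro continuous_on_compose continuous_on_subset[OF continuous_on_chart_inv[OF c]])
     (auto simp: image_image intro: continuous_on_subset[OF f])

lemma continuous_on_of_local_rep:
  assumes c: "complex_chart c" and f: "continuous_on (snd c ` (fst c \<inter> S)) (local_rep c f)"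
  shows "continuous_on (fst c \<inter> S) f"
proof -
  have "continuous_on (fst c \<inter> S) (\<lambda>x. local_rep c f (snd c x))"
    by (rule continuous_on_compose2[OF f continuous_on_subset[OF continuous_on_chart[OF c]]]) auto
  thus ?thesis using c by (subst continuous_on_cong[OF refl, of _ _ "\<lambda>x. local_rep c f (snd c x)"]) auto
qed

lemma transition_chart [simp]: "complex_chart c \<Longrightarrow> x \<in> fst c \<Longrightarrow> transition c d (snd c x) = snd d x"
  by (simp add: transition_def)

lemma transition_image:
  "complex_chart c \<Longrightarrow> E \<subseteq> fst c \<Longrightarrow> transition c d ` snd c ` E = snd d ` E"
  by (force simp: image_image intro!: image_cong)

lemma transition_inj_on:
  assumes "complex_chart c" "complex_chart d" "E \<subseteq> fst c" "E \<subseteq> fst d"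
  shows "inj_on (transition c d) (snd c ` E)"
  using assms by (auto simp: inj_on_def subset_iff) (metis chart_inv_left)

text \<open>A decomposition of \<open>S\<close> into finitely many disjoint Borel pieces \<open>E k\<close>, each lying in the chart
  \<open>c k\<close>.\<close>

definition tiling :: "'c::topological_space chart set \<Rightarrow> 'c set \<Rightarrow> nat \<Rightarrow> (nat \<Rightarrow> 'c chart) \<Rightarrow> (nat \<Rightarrow> 'c set) \<Rightarrow> bool" where
  "tiling A S n c E \<longleftrightarrow> (\<forall>k<n. c k \<in> coords A \<and> E k \<in> sets borel \<and> E k \<subseteq> fst (c k)) \<and>
     disjoint_family_on E {..<n} \<and> (\<Union>k<n. E k) = S"

text \<open>Integrability and integral of a (1,1)-form over one piece, in the coordinate of one chart. The
  factor $-2i$ of $dz\wedge d\bar z = -2i\,dx\,dy$ is not included.\<close>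

definition piece_integrable :: "'c chart \<Rightarrow> 'c set \<Rightarrow> 'c field \<Rightarrow> bool" where
  "piece_integrable c E w \<longleftrightarrow> set_integrable lborel (snd c ` E) (local_rep c (w c))"

definition piece_integral :: "'c chart \<Rightarrow> 'c set \<Rightarrow> 'c field \<Rightarrow> complex" where
  "piece_integral c E w = (LINT z : snd c ` E | lborel. local_rep c (w c) z)"

lemma coords_complex_chart [simp]: "c \<in> coords A \<Longrightarrow> complex_chart c"
  by (simp add: coords_def)

context
  fixes A :: "'c::t2_space chart set"
  assumes atlas: "holomorphic_atlas A"
begin

lemma atlas_subset_coords: "A \<subseteq> coords A"
  using atlas unfolding coords_def holomorphic_atlas_def by blast

lemma coords_cover: "\<exists>c\<in>coords A. x \<in> fst c"
  using atlas atlas_subset_coords unfolding holomorphic_atlas_def by blast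

lemma transition_holomorphic:
  assumes c: "c \<in> coords A" and d: "d \<in> coords A"
  shows "transition c d holomorphic_on snd c ` (fst c \<inter> fst d)"
proof -
  \<comment> \<open>Near any point the transition factors through a chart of the given atlas.\<close>
  let ?W = "\<lambda>a. snd c ` (fst c \<inter> (fst d \<inter> fst a))"
  have "transition c d holomorphic_on (\<Union>a\<in>A. ?W a)"
  proof (rule holomorphic_on_UN_open)
    fix a assume a: "a \<in> A"
    have ca: "complex_chart a" using a atlas by (simp add: holomorphic_atlas_def)
    show "open (?W a)" using c d ca by (intro open_chart_image open_Int open_chart_domain) auto
    have 1: "transition c a holomorphic_on ?W a"
      using c a unfolding coords_def compatible_def
      by (auto intro: holomorphic_on_subset)
    have 2: "transition a d holomorphic_on snd a ` (fst a \<inter> fst d)"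
      using d a unfolding coords_def compatible_def by (simp add: Int_commute)
    have "transition a d \<circ> transition c a holomorphic_on ?W a"
      by (rule holomorphic_on_compose_gen[OF 1 2]) (use c in auto)
    thus "transition c d holomorphic_on ?W a"
      by (rule holomorphic_transform) (use c ca in auto)
  qed
  also have "(\<Union>a\<in>A. ?W a) = snd c ` (fst c \<inter> fst d)"
    using atlas unfolding holomorphic_atlas_def by blast
  finally show ?thesis .
qed

lemma deriv_transition_nonzero:
  assumes c: "c \<in> coords A" and d: "d \<in> coords A" and x: "x \<in> fst c" "x \<in> fst d"
  shows "deriv (transition c d) (snd c x) \<noteq> 0"
proof -
  let ?W = "snd c ` (fst c \<inter> fst d)"
  have "open ?W" using c d by (intro open_chart_image open_chart_domain) auto
  moreover have "inj_on (transition c d) ?W"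
    using c d by (intro transition_inj_on) auto
  moreover have "snd c x \<in> ?W" using x by blast
  ultimately show ?thesis
    using holomorphic_injective_imp_regular[OF transition_holomorphic[OF c d]] by blast
qed

text \<open>The maximal atlas is closed under translations of the coordinate; in particular it contains a
  chart centred at any given point.\<close>

lemma coords_translate:
  assumes c: "c \<in> coords A"
  shows "(fst c, \<lambda>x. snd c x - a) \<in> coords A"
proof -
  let ?c = "(fst c, \<lambda>x. snd c x - a)"
  have cc: "complex_chart c" using c by simp
  have img: "snd ?c ` S = (\<lambda>z. z - a) ` snd c ` S" for S by (simp add: image_image)
  have opimg: "open ((\<lambda>z. z - a) ` snd c ` fst c)"
    using cc open_translation_subtract[of "snd c ` fst c" a] by (simp add: complex_chart_def)
  have inj: "inj_on (\<lambda>x. snd c x - a) (fst c)"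
    using chart_inj_on[OF cc] by (auto simp: inj_on_def)
  have inv_eq: "chart_inv ?c z = chart_inv c (z + a)" if z: "z \<in> snd ?c ` fst c" for z
  proof -
    obtain x where x: "x \<in> fst c" "z = snd c x - a" using z by auto
    have "chart_inv ?c z = x"
      unfolding chart_inv_def using x inj inv_into_f_f[OF inj] by simp
    thus ?thesis using x cc by simp
  qed
  have homeo: "homeomorphism (fst ?c) (snd ?c ` fst ?c) (snd ?c) (chart_inv ?c)"
    unfolding homeomorphism_def
  proof (intro conjI ballI)
    show "continuous_on (fst ?c) (snd ?c)"
      using continuous_on_chart[OF cc] by (auto intro!: continuous_intros)
    have "continuous_on (snd ?c ` fst ?c) (\<lambda>z. chart_inv c (z + a))"
      by (rule continuous_on_compose2[OF continuous_on_chart_inv[OF cc]]) (auto intro!: continuous_intros)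
    thus "continuous_on (snd ?c ` fst ?c) (chart_inv ?c)"
      by (subst continuous_on_cong[OF refl inv_eq]) auto
    show "chart_inv ?c ` snd ?c ` fst ?c = fst ?c"
      using cc by (force simp: inv_eq image_iff)
  qed (use inv_eq cc in auto)
  have "compatible ?c d" if d: "d \<in> A" for d
  proof -
    have cd: "compatible c d" using c d unfolding coords_def by blast
    have "transition c d \<circ> (\<lambda>z. z + a) holomorphic_on snd ?c ` (fst c \<inter> fst d)"
      using cd unfolding compatible_def
      by (intro holomorphic_on_compose_gen[where t = "snd c ` (fst c \<inter> fst d)"])
         (auto intro!: holomorphic_intros)
    hence "transition ?c d holomorphic_on snd ?c ` (fst c \<inter> fst d)"
      by (rule holomorphic_transform) (auto simp: transition_def inv_eq)
    moreover have "transition d ?c = (\<lambda>z. transition d c z - a)"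
      by (auto simp: transition_def)
    hence "transition d ?c holomorphic_on snd d ` (fst c \<inter> fst d)"
      using cd unfolding compatible_def by (auto intro!: holomorphic_intros)
    ultimately show ?thesis by (simp add: compatible_def)
  qed
  moreover have "complex_chart ?c"
    unfolding complex_chart_def using homeo opimg open_chart_domain[OF cc] by (simp add: image_image)
  ultimately show ?thesis unfolding coords_def by blast
qed

lemma coords_centred: "\<exists>c\<in>coords A. x \<in> fst c \<and> snd c x = 0"
proof -
  obtain c where "c \<in> coords A" "x \<in> fst c" using coords_cover by blast
  thus ?thesis using coords_translate[of c "snd c x"] by (intro bexI[of _ "(fst c, \<lambda>y. snd c y - snd c x)"]) auto
qed

section \<open>Integration of (1,1)-forms\<close>

lemma chart_integral_transition:
  assumes c: "c \<in> coords A" and d: "d \<in> coords A"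
    and E: "E \<in> sets borel" "E \<subseteq> fst c" "E \<subseteq> fst d" and w: "tensor_field A 1 1 S w" "E \<subseteq> S"
    and int: "set_integrable lborel (snd d ` E) (local_rep d (w d))"
  shows "set_integrable lborel (snd c ` E) (local_rep c (w c))"
    and "(LINT z:snd c ` E|lborel. local_rep c (w c) z) = (LINT z:snd d ` E|lborel. local_rep d (w d) z)"
proof -
  let ?T = "transition c d" and ?U = "snd c ` (fst c \<inter> fst d)"
  let ?f = "\<lambda>z. of_real ((norm (deriv ?T z))\<^sup>2) * local_rep d (w d) (?T z)"
  have [simp]: "complex_chart c" "complex_chart d" using c d by auto
  have U: "open ?U" by (intro open_chart_image open_chart_domain) auto
  have img: "?T ` snd c ` E = snd d ` E" using E by (intro transition_image) auto
  have Ec: "snd c ` E \<in> sets borel" using E by (intro borel_chart_image) auto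
  have Ed: "?T ` snd c ` E \<in> sets borel" unfolding img using E by (intro borel_chart_image) auto
  have sub: "snd c ` E \<subseteq> ?U" using E by auto
  have inj: "inj_on ?T (snd c ` E)" using E by (intro transition_inj_on) auto
  note cv = holomorphic_change_of_variables[OF U transition_holomorphic[OF c d] sub Ec Ed inj, unfolded img, OF int]
  have eq: "?f z = local_rep c (w c) z" if z: "z \<in> snd c ` E" for z
  proof -
    obtain x where x: "x \<in> E" "z = snd c x" using z by blast
    hence x': "x \<in> fst c" "x \<in> fst d" using E by auto
    have "w c x = w d x * deriv ?T (snd c x) * cnj (deriv ?T (snd c x))"
      using w(1)[unfolded tensor_field_def, rule_format, OF c d, of x] w(2) x(1) x' by auto
    also have "\<dots> = w d x * of_real ((norm (deriv ?T (snd c x)))\<^sup>2)"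
      by (simp only: complex_norm_square mult.assoc)
    finally show ?thesis using x x' by (simp add: mult.commute)
  qed
  show "set_integrable lborel (snd c ` E) (local_rep c (w c))"
  proof -
    have "(\<lambda>z. indicator (snd c ` E) z *\<^sub>R ?f z) = (\<lambda>z. indicator (snd c ` E) z *\<^sub>R local_rep c (w c) z)"
    proof
      fix z
      show "indicator (snd c ` E) z *\<^sub>R ?f z = indicator (snd c ` E) z *\<^sub>R local_rep c (w c) z"
      proof (cases "z \<in> snd c ` E")
        case True
        show ?thesis by (simp only: eq[OF True])
      next
        case False
        hence "indicator (snd c ` E) z = (0::real)" by (rule indicator_simps(2))
        thus ?thesis by (simp only: scaleR_zero_left)
      qed
    qed
    thus ?thesis using cv(1) unfolding set_integrable_def by metis
  qed
  have "(LINT z:snd c ` E|lborel. local_rep c (w c) z) = (LINT z:snd c ` E|lborel. ?f z)"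
    by (rule set_lebesgue_integral_cong) (use Ec eq[symmetric] in \<open>simp, blast\<close>)
  thus "(LINT z:snd c ` E|lborel. local_rep c (w c) z) = (LINT z:snd d ` E|lborel. local_rep d (w d) z)"
    using cv(2) by simp
qed

lemma has_form_integral_iff:
  "has_form_integral A S w I \<longleftrightarrow> (\<exists>n c E. tiling A S n c E \<and> (\<forall>k<n. piece_integrable (c k) (E k) w) \<and>
     I = - 2 * \<i> * (\<Sum>k<n. piece_integral (c k) (E k) w))"
  unfolding has_form_integral_def tiling_def piece_integrable_def piece_integral_def
    sum_distrib_left[of "- 2 * \<i>"]
  by (intro iff_exI) blast

lemma piece_integrable_subset:
  assumes "c \<in> coords A" "E \<subseteq> fst c" "piece_integrable c E w" "E' \<in> sets borel" "E' \<subseteq> E"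
  shows "piece_integrable c E' w"
  unfolding piece_integrable_def
proof (rule set_integrable_subset)
  show "set_integrable lborel (snd c ` E) (local_rep c (w c))"
    using assms(3) unfolding piece_integrable_def .
  have "snd c ` E' \<in> sets borel"
    by (rule borel_chart_image[OF coords_complex_chart[OF assms(1)] assms(4) order_trans[OF assms(5,2)]])
  thus "snd c ` E' \<in> sets lborel" by simp
  show "snd c ` E' \<subseteq> snd c ` E" by (rule image_mono[OF assms(5)])
qed

lemma piece_integral_finite_UN:
  assumes c: "c \<in> coords A" and fin: "finite I" and dis: "disjoint_family_on E I"
    and E: "\<And>i. i \<in> I \<Longrightarrow> E i \<in> sets borel" "\<And>i. i \<in> I \<Longrightarrow> E i \<subseteq> fst c"
    and int: "\<And>i. i \<in> I \<Longrightarrow> piece_integrable c (E i) w"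
  shows "piece_integrable c (\<Union>i\<in>I. E i) w"
    and "piece_integral c (\<Union>i\<in>I. E i) w = (\<Sum>i\<in>I. piece_integral c (E i) w)"
proof -
  have b: "snd c ` E i \<in> sets lborel" if "i \<in> I" for i
    using borel_chart_image[OF coords_complex_chart[OF c] E[OF that]] by simp
  have "inj_on (snd c) (fst c)" using c by (intro chart_inj_on) auto
  hence dis': "disjoint_family_on (\<lambda>i. snd c ` E i) I"
    using dis E(2) unfolding disjoint_family_on_def
    by (metis image_Int inj_on_image_Int image_empty)
  show "piece_integrable c (\<Union>i\<in>I. E i) w"
    using int b unfolding piece_integrable_def image_UN
    by (intro set_integrable_UN fin) auto
  show "piece_integral c (\<Union>i\<in>I. E i) w = (\<Sum>i\<in>I. piece_integral c (E i) w)"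
    using int b unfolding piece_integrable_def piece_integral_def image_UN
    by (intro set_integral_finite_Union fin dis') auto
qed

text \<open>Two decompositions are compared on their common refinement.\<close>

lemma tiling_integral_unique:
  assumes t: "tiling A S n c E" and t': "tiling A S m d F" and w: "tensor_field A 1 1 S w"
    and int: "\<And>k. k < n \<Longrightarrow> piece_integrable (c k) (E k) w"
  shows "\<And>l. l < m \<Longrightarrow> piece_integrable (d l) (F l) w"
    and "(\<Sum>l<m. piece_integral (d l) (F l) w) = (\<Sum>k<n. piece_integral (c k) (E k) w)"
proof -
  have E: "c k \<in> coords A" "E k \<in> sets borel" "E k \<subseteq> fst (c k)" "E k \<subseteq> S" if "k < n" for k
    using t that unfolding tiling_def by auto
  have F: "d l \<in> coords A" "F l \<in> sets borel" "F l \<subseteq> fst (d l)" "F l \<subseteq> S" if "l < m" for l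
    using t' that unfolding tiling_def by auto
  have FE: "F l = (\<Union>k<n. F l \<inter> E k)" if "l < m" for l
    using F(4)[OF that] t unfolding tiling_def by blast
  have EF: "E k = (\<Union>l<m. F l \<inter> E k)" if "k < n" for k
    using E(4)[OF that] t' unfolding tiling_def by blast
  have disE: "disjoint_family_on (\<lambda>k. F l \<inter> E k) {..<n}" for l
    using t unfolding tiling_def disjoint_family_on_def by blast
  have disF: "disjoint_family_on (\<lambda>l. F l \<inter> E k) {..<m}" for k
    using t' unfolding tiling_def disjoint_family_on_def by blast
  have ic: "piece_integrable (c k) (F l \<inter> E k) w" if "k < n" "l < m" for k l
    by (rule piece_integrable_subset[OF E(1)[OF that(1)] E(3)[OF that(1)] int[OF that(1)]])
       (use E(2)[OF that(1)] F(2)[OF that(2)] in auto)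
  have id: "piece_integrable (d l) (F l \<inter> E k) w \<and>
      piece_integral (d l) (F l \<inter> E k) w = piece_integral (c k) (F l \<inter> E k) w"
    if "k < n" "l < m" for k l
  proof -
    have "F l \<inter> E k \<in> sets borel" "F l \<inter> E k \<subseteq> fst (d l)" "F l \<inter> E k \<subseteq> fst (c k)" "F l \<inter> E k \<subseteq> S"
      using E(2-4)[OF that(1)] F(2-4)[OF that(2)] by auto
    from chart_integral_transition[OF F(1)[OF that(2)] E(1)[OF that(1)] this(1-3) w this(4)] ic[OF that]
    show ?thesis unfolding piece_integrable_def piece_integral_def by blast
  qed
  have FEb: "F l \<inter> E k \<in> sets borel" if "k < n" "l < m" for k l
    using E(2)[OF that(1)] F(2)[OF that(2)] by (rule sets.Int[rotated])
  show 1: "piece_integrable (d l) (F l) w" if "l < m" for l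
    by (subst FE[OF that], rule piece_integral_finite_UN(1)[OF F(1)[OF that] finite_lessThan disE])
       (use FEb[OF _ that] F(3)[OF that] id[OF _ that] in blast)+
  have "(\<Sum>l<m. piece_integral (d l) (F l) w) = (\<Sum>l<m. \<Sum>k<n. piece_integral (d l) (F l \<inter> E k) w)"
  proof (rule sum.cong[OF refl])
    fix l assume "l \<in> {..<m}"
    hence l: "l < m" by simp
    show "piece_integral (d l) (F l) w = (\<Sum>k<n. piece_integral (d l) (F l \<inter> E k) w)"
      by (subst FE[OF l], rule piece_integral_finite_UN(2)[OF F(1)[OF l] finite_lessThan disE])
         (use FEb[OF _ l] F(3)[OF l] id[OF _ l] in blast)+
  qed
  also have "\<dots> = (\<Sum>k<n. \<Sum>l<m. piece_integral (c k) (F l \<inter> E k) w)"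
    by (subst sum.swap, intro sum.cong refl) (simp add: id)
  also have "\<dots> = (\<Sum>k<n. piece_integral (c k) (E k) w)"
  proof (rule sum.cong[OF refl])
    fix k assume "k \<in> {..<n}"
    hence k: "k < n" by simp
    show "(\<Sum>l<m. piece_integral (c k) (F l \<inter> E k) w) = piece_integral (c k) (E k) w"
      by (subst (2) EF[OF k], rule piece_integral_finite_UN(2)[OF E(1)[OF k] finite_lessThan disF, symmetric])
         (use FEb[OF k] E(3)[OF k] ic[OF k] in blast)+
  qed
  finally show "(\<Sum>l<m. piece_integral (d l) (F l) w) = (\<Sum>k<n. piece_integral (c k) (E k) w)" .
qed

lemma form_integral_eq:
  assumes t: "tiling A S n c E" and w: "tensor_field A 1 1 S w"
    and int: "\<And>k. k < n \<Longrightarrow> piece_integrable (c k) (E k) w"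
  shows "form_integral A S w = - 2 * \<i> * (\<Sum>k<n. piece_integral (c k) (E k) w)"
  unfolding form_integral_def
proof (rule the_equality)
  show "has_form_integral A S w (- 2 * \<i> * (\<Sum>k<n. piece_integral (c k) (E k) w))"
    unfolding has_form_integral_iff using t int by blast
next
  fix I assume "has_form_integral A S w I"
  then obtain m d F where F: "tiling A S m d F" "I = - 2 * \<i> * (\<Sum>k<m. piece_integral (d k) (F k) w)"
    "\<And>k. k < m \<Longrightarrow> piece_integrable (d k) (F k) w"
    unfolding has_form_integral_iff by blast
  thus "I = - 2 * \<i> * (\<Sum>k<n. piece_integral (c k) (E k) w)"
    using tiling_integral_unique(2)[OF t F(1) w int] by simp
qed

end

section \<open>Singular forms and coordinate discs\<close>

text \<open>Fields and functions on the surface that are continuously differentiable in every coordinate of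
  the maximal atlas.\<close>

definition C1_field :: "'c::topological_space chart set \<Rightarrow> 'c set \<Rightarrow> 'c field \<Rightarrow> bool" where
  "C1_field A S f \<longleftrightarrow> (\<forall>c\<in>coords A. C1_on (snd c ` (fst c \<inter> S)) (local_rep c (f c)))"

definition C1_scalar :: "'c::topological_space chart set \<Rightarrow> ('c \<Rightarrow> complex) \<Rightarrow> bool" where
  "C1_scalar A \<phi> \<longleftrightarrow> (\<forall>c\<in>coords A. C1_on (snd c ` fst c) (local_rep c \<phi>))"

text \<open>Continuous off \<open>D\<close> and $O(1/|z|)$ near the points of \<open>D\<close>. The singularities of a (1,1)-form
  subject to this are integrable.\<close>

definition mild_singularities :: "'c::topological_space chart set \<Rightarrow> 'c set \<Rightarrow> 'c field \<Rightarrow> bool" where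
  "mild_singularities A D w \<longleftrightarrow> (\<forall>c\<in>coords A. continuous_on (fst c \<inter> - D) (w c) \<and>
     (\<forall>x\<in>D \<inter> fst c. \<exists>\<rho>>0. \<exists>K. \<forall>z\<in>(ball (snd c x) \<rho> - {snd c x}) \<inter> snd c ` fst c.
        norm (local_rep c (w c) z) \<le> K / dist z (snd c x)))"

text \<open>The closed disc of radius \<open>s\<close> about \<open>x\<close> in the coordinate of \<open>c\<close>; meaningful when that disc is
  contained in the image of the chart.\<close>

definition closed_disc :: "'c chart \<Rightarrow> 'c \<Rightarrow> real \<Rightarrow> 'c set" where
  "closed_disc c x s = chart_inv c ` cball (snd c x) s"

text \<open>The bump function of radius \<open>r\<close> about \<open>x\<close> in the coordinate of \<open>c\<close>, extended by zero.\<close>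

definition surface_bump :: "'c chart \<Rightarrow> 'c \<Rightarrow> real \<Rightarrow> 'c \<Rightarrow> complex" where
  "surface_bump c x r y = (if y \<in> fst c then bump (snd c x) r (snd c y) else 0)"

text \<open>A disc of coordinate radius \<open>4 * r\<close> about \<open>x\<close> that contains no point of \<open>D\<close> except possibly \<open>x\<close>.
  The smaller radii have their own uses: discs of radius \<open>r\<close> will cover the surface, bump functions
  are supported in discs of radius \<open>2 * r\<close>, and the local Stokes formula is applied on discs of
  radius \<open>3 * r\<close>.\<close>

definition coordinate_disc ::
  "'c::topological_space chart set \<Rightarrow> 'c set \<Rightarrow> 'c \<Rightarrow> 'c chart \<Rightarrow> real \<Rightarrow> bool" where
  "coordinate_disc A D x c r \<longleftrightarrow> c \<in> coords A \<and> x \<in> fst c \<and> 0 < r \<and>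
     ball (snd c x) (4 * r) \<subseteq> snd c ` (fst c \<inter> - (D - {x}))"

text \<open>If at every point one of the \<open>a j\<close> is 1, the summands on the left form a partition of unity.\<close>

lemma telescoping_partition:
  fixes a :: "nat \<Rightarrow> complex"
  shows "(\<Sum>j<m. a j * (\<Prod>i<j. 1 - a i)) = 1 - (\<Prod>i<m. 1 - a i)"
  by (induction m) (auto simp: algebra_simps)

lemma C1_scalar_mult: "C1_scalar A f \<Longrightarrow> C1_scalar A g \<Longrightarrow> C1_scalar A (\<lambda>x. f x * g x)"
  unfolding C1_scalar_def using C1_on_mult by (fastforce simp: local_rep_def o_def)

lemma C1_scalar_one_minus: "C1_scalar A f \<Longrightarrow> C1_scalar A (\<lambda>x. 1 - f x)"
  unfolding C1_scalar_def using C1_on_diff[OF C1_on_const[of _ 1]] by (fastforce simp: local_rep_def o_def)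

lemma C1_scalar_prod:
  "(\<And>i. i \<in> I \<Longrightarrow> C1_scalar A (f i)) \<Longrightarrow> C1_scalar A (\<lambda>x. \<Prod>i\<in>I. f i x)"
  unfolding C1_scalar_def using C1_on_prod[of I] by (fastforce simp: local_rep_def o_def)

lemma set_integrable_singleton:
  fixes f :: "complex \<Rightarrow> complex"
  shows "set_integrable lborel {a} f" "(LINT z:{a}|lborel. f z) = 0"
proof -
  have eq: "(\<lambda>z. indicator {a} z *\<^sub>R f z) = (\<lambda>z. indicator {a} z *\<^sub>R f a)"
    by (auto simp: indicator_def fun_eq_iff)
  show "set_integrable lborel {a} f" unfolding set_integrable_def eq by simp
  show "(LINT z:{a}|lborel. f z) = 0" unfolding set_lebesgue_integral_def eq by simp
qed

lemma set_integrable_insert: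
  fixes f :: "complex \<Rightarrow> complex"
  assumes "set_integrable lborel (X - {a}) f" "X \<in> sets borel" "a \<in> X"
  shows "set_integrable lborel X f" "(LINT z:X|lborel. f z) = (LINT z:X - {a}|lborel. f z)"
proof -
  have X: "X = (X - {a}) \<union> {a}" using assms by blast
  show "set_integrable lborel X f"
    by (subst X, rule set_integrable_Un) (use assms set_integrable_singleton in auto)
  show "(LINT z:X|lborel. f z) = (LINT z:X - {a}|lborel. f z)"
    by (subst X, subst set_integral_Un) (use assms set_integrable_singleton in auto)
qed

lemma closed_disc_eq:
  fixes c :: "'c::t2_space chart"
  assumes c: "complex_chart c" and sub: "cball (snd c x) s \<subseteq> snd c ` fst c"
  shows "closed_disc c x s = {y \<in> fst c. dist (snd c y) (snd c x) \<le> s}"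
    and "snd c ` closed_disc c x s = cball (snd c x) s" and "closed (closed_disc c x s)"
proof -
  show 1: "closed_disc c x s = {y \<in> fst c. dist (snd c y) (snd c x) \<le> s}"
  proof (intro equalityI subsetI)
    fix y assume "y \<in> closed_disc c x s"
    then obtain z where z: "z \<in> cball (snd c x) s" "y = chart_inv c z" by (auto simp: closed_disc_def)
    then obtain y' where "y' \<in> fst c" "z = snd c y'" using sub by blast
    thus "y \<in> {y \<in> fst c. dist (snd c y) (snd c x) \<le> s}" using z c by (simp add: dist_commute)
  next
    fix y assume y: "y \<in> {y \<in> fst c. dist (snd c y) (snd c x) \<le> s}"
    hence "chart_inv c (snd c y) = y" using c by simp
    thus "y \<in> closed_disc c x s" unfolding closed_disc_def using y
      by (intro image_eqI[of _ _ "snd c y"]) (auto simp: dist_commute)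
  qed
  show "snd c ` closed_disc c x s = cball (snd c x) s"
  proof (intro equalityI subsetI)
    fix z assume z: "z \<in> cball (snd c x) s"
    then obtain y' where "y' \<in> fst c" "z = snd c y'" using sub by blast
    thus "z \<in> snd c ` closed_disc c x s" unfolding 1 using z by (auto simp: dist_commute)
  qed (auto simp: 1 dist_commute)
  have "compact (closed_disc c x s)" unfolding closed_disc_def
    using sub continuous_on_chart_inv[OF c] continuous_on_subset
    by (intro compact_continuous_image) auto
  thus "closed (closed_disc c x s)" by (rule compact_imp_closed)
qed

lemma surface_bump_eq_1:
  assumes "0 < r" "y \<in> fst c" "dist (snd c y) (snd c x) \<le> r"
  shows "surface_bump c x r y = 1"
  using assms by (simp add: surface_bump_def bump_eq_1)

context
  fixes A :: "'c::t2_space chart set"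
  assumes atlas: "holomorphic_atlas A"
begin

lemma tensor_field_dbar:
  assumes \<omega>: "tensor_field A 1 0 S \<omega>" "C1_field A S \<omega>" and S: "open S"
  shows "tensor_field A 1 1 S (dbar \<omega>)"
  unfolding tensor_field_def
proof (intro ballI)
  fix c d x assume c: "c \<in> coords A" and d: "d \<in> coords A" and x: "x \<in> fst c \<inter> fst d \<inter> S"
  let ?T = "transition c d" and ?W = "snd c ` (fst c \<inter> (fst d \<inter> S))" and ?z = "snd c x"
  let ?f = "local_rep d (\<omega> d)"
  have cc: "complex_chart c" "complex_chart d" using c d coords_complex_chart by blast+
  have W: "open ?W" using cc S by (intro open_chart_image open_Int open_chart_domain)
  have z: "?z \<in> ?W" using x by blast
  have TW: "?T ` ?W \<subseteq> snd d ` (fst d \<inter> S)" using cc by auto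
  have holo: "?T holomorphic_on ?W"
    using transition_holomorphic[OF atlas c d] by (rule holomorphic_on_subset) auto
  have C1f: "C1_on (snd d ` (fst d \<inter> S)) ?f" using \<omega>(2) d unfolding C1_field_def by blast
  have C1fT: "C1_on ?W (\<lambda>z. ?f (?T z))" by (rule C1_on_compose_holomorphic[OF C1f holo W TW])
  have eq: "local_rep c (\<omega> c) w = ?f (?T w) * deriv ?T w" if w: "w \<in> ?W" for w
  proof -
    obtain y where y: "y \<in> fst c" "y \<in> fst d" "y \<in> S" "w = snd c y" using w by blast
    have "\<omega> c y = \<omega> d y * deriv ?T (snd c y) powi 1 * cnj (deriv ?T (snd c y)) powi 0"
      using \<omega>(1) c d y unfolding tensor_field_def by blast
    thus ?thesis using y cc by simp
  qed
  have "dbar \<omega> c x = wirtinger_dbar (\<lambda>w. ?f (?T w) * deriv ?T w) ?z"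
    unfolding dbar_def by (rule wirtinger_dbar_cong[OF W z eq])
  also have "\<dots> = ?f (?T ?z) * wirtinger_dbar (deriv ?T) ?z + wirtinger_dbar (\<lambda>w. ?f (?T w)) ?z * deriv ?T ?z"
  proof (rule wirtinger_dbar_mult)
    show "(\<lambda>w. ?f (?T w)) differentiable at ?z" using C1fT z unfolding C1_on_def by blast
    show "deriv ?T differentiable at ?z"
      using holomorphic_deriv[OF holo W] W z
      by (meson field_differentiable_imp_differentiable holomorphic_on_imp_differentiable_at)
  qed
  also have "wirtinger_dbar (deriv ?T) ?z = 0"
    using holomorphic_deriv[OF holo W] W z
    by (meson holomorphic_on_imp_differentiable_at wirtinger_dbar_holomorphic)
  also have "wirtinger_dbar (\<lambda>w. ?f (?T w)) ?z = wirtinger_dbar ?f (?T ?z) * cnj (deriv ?T ?z)"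
  proof (rule wirtinger_dbar_compose)
    show "?f differentiable at (?T ?z)" using C1f TW z unfolding C1_on_def by blast
    show "?T field_differentiable at ?z" using holo W z holomorphic_on_imp_differentiable_at by blast
  qed
  finally show "dbar \<omega> c x = dbar \<omega> d x * deriv ?T ?z powi 1 * cnj (deriv ?T ?z) powi 1"
    using x cc by (simp add: dbar_def)
qed

lemma coordinate_disc_exists:
  assumes D: "finite D"
  shows "\<exists>c r. coordinate_disc A D x c r"
proof -
  obtain c where c: "c \<in> coords A" "x \<in> fst c" using coords_cover[OF atlas] by blast
  have cc: "complex_chart c" using c coords_complex_chart by blast
  have "closed (D - {x})" using D by (intro finite_imp_closed) auto
  hence "open (- (D - {x}))" by (rule open_Compl)
  hence "open (snd c ` (fst c \<inter> - (D - {x})))" using cc by (intro open_chart_image)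
  moreover have "snd c x \<in> snd c ` (fst c \<inter> - (D - {x}))" using c by blast
  ultimately obtain R where R: "R > 0" "ball (snd c x) R \<subseteq> snd c ` (fst c \<inter> - (D - {x}))"
    using openE by blast
  hence "coordinate_disc A D x c (R / 4)" using c unfolding coordinate_disc_def by simp
  thus ?thesis by blast
qed

lemma coordinate_discD:
  assumes "coordinate_disc A D x c r"
  shows "c \<in> coords A" "complex_chart c" "x \<in> fst c" "0 < r"
    and "ball (snd c x) (4 * r) \<subseteq> snd c ` fst c"
    and "\<And>s. s < 4 * r \<Longrightarrow> cball (snd c x) s \<subseteq> snd c ` fst c"
    and "\<And>y. y \<in> D \<Longrightarrow> y \<in> fst c \<Longrightarrow> dist (snd c y) (snd c x) < 4 * r \<Longrightarrow> y = x"
    and "ball (snd c x) (4 * r) - {snd c x} \<subseteq> snd c ` (fst c \<inter> - D)"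
    and "x \<notin> D \<Longrightarrow> ball (snd c x) (4 * r) \<subseteq> snd c ` (fst c \<inter> - D)"
proof -
  show c: "c \<in> coords A" and x: "x \<in> fst c" and "0 < r"
    using assms by (auto simp: coordinate_disc_def)
  have sub: "ball (snd c x) (4 * r) \<subseteq> snd c ` (fst c \<inter> - (D - {x}))"
    using assms by (auto simp: coordinate_disc_def)
  show cc: "complex_chart c" using c coords_complex_chart by blast
  show "ball (snd c x) (4 * r) \<subseteq> snd c ` fst c" using sub by blast
  thus "cball (snd c x) s \<subseteq> snd c ` fst c" if "s < 4 * r" for s
    using that by (force simp: subset_iff)
  show "y = x" if "y \<in> D" "y \<in> fst c" "dist (snd c y) (snd c x) < 4 * r" for y
  proof -
    have "snd c y \<in> snd c ` (fst c \<inter> - (D - {x}))" using sub that by (auto simp: dist_commute)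
    then obtain y' where "y' \<in> fst c" "y' \<notin> D - {x}" "snd c y = snd c y'" by blast
    thus ?thesis using that chart_inj_on[OF cc] by (metis DiffI inj_onD singletonD)
  qed
  show "ball (snd c x) (4 * r) - {snd c x} \<subseteq> snd c ` (fst c \<inter> - D)" using sub by blast
  show "ball (snd c x) (4 * r) \<subseteq> snd c ` (fst c \<inter> - D)" if "x \<notin> D" using sub that by auto
qed

lemma surface_bump_eq_0:
  assumes "coordinate_disc A D x c r" "y \<notin> closed_disc c x (2 * r)"
  shows "surface_bump c x r y = 0"
proof (cases "y \<in> fst c")
  case True
  note cd = coordinate_discD[OF assms(1)]
  have "cball (snd c x) (2 * r) \<subseteq> snd c ` fst c" using cd(4) by (intro cd(6)) simp
  hence "2 * r \<le> dist (snd c y) (snd c x)"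
    using assms(2) True unfolding closed_disc_eq(1)[OF cd(2) \<open>cball (snd c x) (2 * r) \<subseteq> snd c ` fst c\<close>] by simp
  thus ?thesis using True cd(4) by (simp add: surface_bump_def bump_eq_0)
qed (simp add: surface_bump_def)

text \<open>The extension by zero is differentiable because the closed disc that supports it is compact,
  hence closed in the surface.\<close>

lemma C1_scalar_surface_bump:
  assumes cd: "coordinate_disc A D x c r"
  shows "C1_scalar A (surface_bump c x r)"
  unfolding C1_scalar_def
proof (intro ballI)
  fix d assume d: "d \<in> coords A"
  let ?K = "closed_disc c x (2 * r)"
  note c = coordinate_discD[OF cd]
  have dd: "complex_chart d" using d coords_complex_chart by blast
  have K: "cball (snd c x) (2 * r) \<subseteq> snd c ` fst c" using c(4) by (intro c(6)) simp
  have Kc: "closed ?K" and Kf: "?K \<subseteq> fst c" using closed_disc_eq[OF c(2) K] by auto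
  let ?U = "snd d ` (fst d \<inter> fst c)" and ?V = "snd d ` (fst d \<inter> - ?K)"
  have U: "open ?U" using dd c by (intro open_chart_image open_chart_domain)
  have V: "open ?V" using dd Kc by (intro open_chart_image) auto
  have UV: "snd d ` fst d = ?U \<union> ?V" using Kf by blast
  have 1: "C1_on ?U (\<lambda>z. bump (snd c x) r (transition d c z))"
    by (rule C1_on_compose_holomorphic[OF C1_on_bump[of UNIV] transition_holomorphic[OF atlas d c(1)] U]) auto
  have "C1_on ?U (local_rep d (surface_bump c x r))"
    by (rule C1_on_cong[OF U _ 1]) (use dd in \<open>auto simp: surface_bump_def\<close>)
  moreover have "C1_on ?V (local_rep d (surface_bump c x r))"
    by (rule C1_on_cong[OF V _ C1_on_const[of _ 0]]) (use dd surface_bump_eq_0[OF cd] in auto)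
  ultimately show "C1_on (snd d ` fst d) (local_rep d (surface_bump c x r))"
    unfolding UV by (intro C1_on_Un U V)
qed

lemma finite_coordinate_disc_cover:
  assumes D: "finite D" and comp: "compact (UNIV :: 'c set)"
  obtains m x c r where "\<And>j. j < (m::nat) \<Longrightarrow> coordinate_disc A D (x j) (c j) (r j)"
    and "\<And>y. \<exists>j<m. y \<in> fst (c j) \<and> dist (snd (c j) y) (snd (c j) (x j)) < r j"
proof -
  obtain c r where cr: "\<And>x. coordinate_disc A D x (c x) (r x)"
    using coordinate_disc_exists[OF D] by metis
  define V where "V = (\<lambda>x. {y \<in> fst (c x). dist (snd (c x) y) (snd (c x) x) < r x})"
  have V: "open (V x)" for x
  proof -
    have eq: "V x = snd (c x) -` ball (snd (c x) x) (r x) \<inter> fst (c x)" by (auto simp: V_def dist_commute)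
    show ?thesis unfolding eq
      using continuous_on_open_vimage[OF open_chart_domain[OF coordinate_discD(2)[OF cr]]]
        continuous_on_chart[OF coordinate_discD(2)[OF cr]] open_ball by blast
  qed
  have "x \<in> V x" for x using coordinate_discD(3,4)[OF cr, of x] by (simp add: V_def)
  hence "UNIV \<subseteq> (\<Union>x\<in>UNIV. V x)" by blast
  then obtain X where X: "finite X" "UNIV \<subseteq> (\<Union>x\<in>X. V x)"
    using compactE_image[OF comp, of UNIV V] V by metis
  obtain h where h: "bij_betw h {..<card X} X"
    using ex_bij_betw_nat_finite[OF X(1)] by (auto simp: atLeast0LessThan)
  show thesis
  proof (rule that[of "card X" h "\<lambda>j. c (h j)" "\<lambda>j. r (h j)"])
    fix y
    obtain x where "x \<in> X" "y \<in> V x" using X by blast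
    moreover then obtain j where "j < card X" "x = h j" using h by (force simp: bij_betw_def)
    ultimately show "\<exists>j<card X. y \<in> fst (c (h j)) \<and> dist (snd (c (h j)) y) (snd (c (h j)) (h j)) < r (h j)"
      by (auto simp: V_def)
  qed (use cr in auto)
qed

text \<open>The bound holds about the centre of every coordinate disc: a centre that does not lie in \<open>D\<close> is
  a point of continuity.\<close>

lemma mild_singularities_bound:
  assumes w: "mild_singularities A D w" and cd: "coordinate_disc A D x c r"
  shows "\<exists>\<rho>>0. \<rho> \<le> 3 * r \<and> (\<exists>K. \<forall>z\<in>ball (snd c x) \<rho> - {snd c x}. norm (local_rep c (w c) z) \<le> K / dist z (snd c x))"
proof (cases "x \<in> D")
  case True
  note c = coordinate_discD[OF cd]
  obtain \<rho> K where \<rho>: "\<rho> > 0" "\<forall>z\<in>(ball (snd c x) \<rho> - {snd c x}) \<inter> snd c ` fst c. norm (local_rep c (w c) z) \<le> K / dist z (snd c x)"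
    using w c(1,3) True unfolding mild_singularities_def by blast
  show ?thesis
  proof (rule exI[of _ "min \<rho> (3 * r)"], intro conjI exI[of _ K] ballI)
    fix z assume z: "z \<in> ball (snd c x) (min \<rho> (3 * r)) - {snd c x}"
    hence "z \<in> snd c ` fst c" using c(4,5) by (auto simp: subset_iff)
    thus "norm (local_rep c (w c) z) \<le> K / dist z (snd c x)" using z \<rho>(2) by auto
  qed (use \<rho> c in auto)
next
  case False
  note c = coordinate_discD[OF cd]
  have "continuous_on (snd c ` (fst c \<inter> - D)) (local_rep c (w c))"
    using w c unfolding mild_singularities_def by (intro continuous_on_local_rep) auto
  hence "continuous_on (cball (snd c x) (3 * r)) (local_rep c (w c))"
    by (rule continuous_on_subset) (use c(4) c(9)[OF False] in \<open>auto simp: subset_iff\<close>)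
  hence "bounded (local_rep c (w c) ` cball (snd c x) (3 * r))"
    by (intro compact_imp_bounded compact_continuous_image) auto
  then obtain M where M: "M > 0" "\<And>z. z \<in> cball (snd c x) (3 * r) \<Longrightarrow> norm (local_rep c (w c) z) \<le> M"
    unfolding bounded_pos by blast
  show ?thesis
  proof (rule exI[of _ "3 * r"], intro conjI exI[of _ "M * (3 * r)"] ballI)
    fix z assume z: "z \<in> ball (snd c x) (3 * r) - {snd c x}"
    have "norm (local_rep c (w c) z) * dist z (snd c x) \<le> M * (3 * r)"
      using z M(1) M(2)[of z] by (intro mult_mono) (auto simp: dist_commute)
    thus "norm (local_rep c (w c) z) \<le> M * (3 * r) / dist z (snd c x)" using z by (simp add: field_simps)
  qed (use c in auto)
qed

lemma mild_singularities_integrable: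
  assumes w: "mild_singularities A D w" and cd: "coordinate_disc A D x c r"
  shows "set_integrable lborel (cball (snd c x) (3 * r) - {snd c x}) (local_rep c (w c))"
    and "set_integrable lborel (cball (snd c x) (3 * r)) (local_rep c (w c))"
proof -
  note c = coordinate_discD[OF cd]
  let ?z = "snd c x" and ?f = "local_rep c (w c)"
  obtain \<rho> K where \<rho>: "\<rho> > 0" "\<rho> \<le> 3 * r" and K: "\<And>z. z \<in> ball ?z \<rho> - {?z} \<Longrightarrow> norm (?f z) \<le> K / dist z ?z"
    using mild_singularities_bound[OF w cd] by blast
  have "continuous_on (snd c ` (fst c \<inter> - D)) ?f"
    using w c unfolding mild_singularities_def by (intro continuous_on_local_rep) auto
  hence cont: "continuous_on (cball ?z (3 * r) - {?z}) ?f"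
    by (rule continuous_on_subset) (use c(4,8) in \<open>auto simp: subset_iff\<close>)
  have "compact (cball ?z (3 * r) - ball ?z \<rho>)" by (intro compact_diff) auto
  moreover have "continuous_on (cball ?z (3 * r) - ball ?z \<rho>) ?f"
    by (rule continuous_on_subset[OF cont]) (use \<rho> in auto)
  ultimately have "bounded (?f ` (cball ?z (3 * r) - ball ?z \<rho>))"
    by (intro compact_imp_bounded compact_continuous_image) auto
  then obtain M where M: "M > 0" "\<And>z. z \<in> cball ?z (3 * r) - ball ?z \<rho> \<Longrightarrow> norm (?f z) \<le> M"
    unfolding bounded_pos by blast
  show int: "set_integrable lborel (cball ?z (3 * r) - {?z}) ?f"
  proof (rule set_integrable_punctured_disc[OF _ cont])
    show "norm (?f z) \<le> max K (M * (3 * r)) / dist z ?z" if z: "z \<in> cball ?z (3 * r) - {?z}" for z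
    proof (cases "z \<in> ball ?z \<rho>")
      case True
      hence "norm (?f z) \<le> K / dist z ?z" using K z by blast
      also have "\<dots> \<le> max K (M * (3 * r)) / dist z ?z" by (intro divide_right_mono) auto
      finally show ?thesis .
    next
      case False
      have "norm (?f z) * dist z ?z \<le> M * (3 * r)"
        using z False M(1) M(2)[of z] by (intro mult_mono) (auto simp: dist_commute)
      hence "norm (?f z) \<le> M * (3 * r) / dist z ?z" using z by (simp add: field_simps)
      also have "\<dots> \<le> max K (M * (3 * r)) / dist z ?z" by (intro divide_right_mono) auto
      finally show ?thesis .
    qed
  qed (use c in auto)
  show "set_integrable lborel (cball ?z (3 * r)) ?f"
    by (rule set_integrable_insert(1)[OF int]) (use c in auto)
qed

end

section \<open>The Stokes theorem with residues\<close>

lemma local_rep_dbar: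
  assumes "complex_chart c" "z \<in> snd c ` fst c"
  shows "local_rep c (dbar f c) z = wirtinger_dbar (local_rep c (f c)) z"
  using assms by (auto simp: dbar_def)

lemma tensor_field_scalar_mult:
  assumes "tensor_field A a b S \<omega>"
  shows "tensor_field A a b S (\<lambda>c x. \<phi> x * \<omega> c x)"
  unfolding tensor_field_def
proof (intro ballI)
  fix c d x assume *: "c \<in> coords A" "d \<in> coords A" "x \<in> fst c \<inter> fst d \<inter> S"
  have e: "\<omega> c x = \<omega> d x * deriv (transition c d) (snd c x) powi a * cnj (deriv (transition c d) (snd c x)) powi b"
    using assms * unfolding tensor_field_def by blast
  show "\<phi> x * \<omega> c x = \<phi> x * \<omega> d x * deriv (transition c d) (snd c x) powi a * cnj (deriv (transition c d) (snd c x)) powi b"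
    unfolding e by (simp only: mult.assoc)
qed

lemma C1_field_scalar_mult:
  assumes "C1_scalar A \<phi>" "C1_field A S \<omega>"
  shows "C1_field A S (\<lambda>c x. \<phi> x * \<omega> c x)"
  unfolding C1_field_def
proof
  fix c assume c: "c \<in> coords A"
  have 1: "C1_on (snd c ` (fst c \<inter> S)) (local_rep c \<phi>)"
    by (rule C1_on_subset[of "snd c ` fst c"]) (use assms(1) c in \<open>auto simp: C1_scalar_def\<close>)
  have 2: "C1_on (snd c ` (fst c \<inter> S)) (local_rep c (\<omega> c))"
    using assms(2) c unfolding C1_field_def by blast
  from C1_on_mult[OF 1 2] show "C1_on (snd c ` (fst c \<inter> S)) (local_rep c (\<lambda>x. \<phi> x * \<omega> c x))"
    by (simp add: local_rep_def o_def)
qed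

context
  fixes A :: "'c::t2_space chart set"
  assumes atlas: "holomorphic_atlas A"
begin

lemma continuous_on_dbar:
  assumes f: "C1_field A S f" and c: "c \<in> coords A"
  shows "continuous_on (fst c \<inter> S) (dbar f c)"
proof -
  have cc: "complex_chart c" using c coords_complex_chart by blast
  have "C1_on (snd c ` (fst c \<inter> S)) (local_rep c (f c))" using f c unfolding C1_field_def by blast
  thus ?thesis unfolding dbar_def
    by (intro continuous_on_compose2[OF continuous_on_wirtinger_dbar]
        continuous_on_subset[OF continuous_on_chart[OF cc]]) auto
qed

lemma form_integral_sum:
  assumes t: "tiling A S m c F" and J: "finite J"
    and wj: "\<And>j. j \<in> J \<Longrightarrow> tensor_field A 1 1 S (w j)"
    and int: "\<And>j l. j \<in> J \<Longrightarrow> l < m \<Longrightarrow> piece_integrable (c l) (F l) (w j)"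
    and v: "tensor_field A 1 1 S v"
    and eq: "\<And>d x. d \<in> coords A \<Longrightarrow> x \<in> fst d \<Longrightarrow> x \<in> S \<Longrightarrow> v d x = (\<Sum>j\<in>J. w j d x)"
  shows "form_integral A S v = (\<Sum>j\<in>J. form_integral A S (w j))"
proof -
  have F: "c l \<in> coords A" "complex_chart (c l)" "F l \<in> sets borel" "F l \<subseteq> fst (c l)" "F l \<subseteq> S" if "l < m" for l
    using t that coords_complex_chart unfolding tiling_def by auto
  have Fb: "snd (c l) ` F l \<in> sets lborel" if "l < m" for l
    using borel_chart_image[OF F(2,3,4)[OF that]] by simp
  have rep: "local_rep (c l) (v (c l)) z = (\<Sum>j\<in>J. local_rep (c l) (w j (c l)) z)"
    if l: "l < m" and z: "z \<in> snd (c l) ` F l" for l z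
  proof -
    obtain x where x: "x \<in> F l" "z = snd (c l) x" using z by blast
    hence "x \<in> fst (c l)" "x \<in> S" using F[OF l] by auto
    thus ?thesis using eq[OF F(1)[OF l]] F(2)[OF l] x by simp
  qed
  have p: "piece_integrable (c l) (F l) v \<and>
      piece_integral (c l) (F l) v = (\<Sum>j\<in>J. piece_integral (c l) (F l) (w j))" if l: "l < m" for l
  proof -
    have i: "integrable lborel (\<lambda>z. indicator (snd (c l) ` F l) z *\<^sub>R local_rep (c l) (w j (c l)) z)"
      if "j \<in> J" for j
      using int[OF that l] unfolding piece_integrable_def set_integrable_def .
    have e: "(\<lambda>z. indicator (snd (c l) ` F l) z *\<^sub>R local_rep (c l) (v (c l)) z) =
        (\<lambda>z. \<Sum>j\<in>J. indicator (snd (c l) ` F l) z *\<^sub>R local_rep (c l) (w j (c l)) z)"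
    proof
      fix z
      show "indicator (snd (c l) ` F l) z *\<^sub>R local_rep (c l) (v (c l)) z =
        (\<Sum>j\<in>J. indicator (snd (c l) ` F l) z *\<^sub>R local_rep (c l) (w j (c l)) z)"
      proof (cases "z \<in> snd (c l) ` F l")
        case True
        show ?thesis unfolding rep[OF l True] by (rule scaleR_sum_right)
      next
        case False
        hence "indicator (snd (c l) ` F l) z = (0::real)" by (rule indicator_simps(2))
        thus ?thesis by (simp only: scaleR_zero_left sum.neutral_const)
      qed
    qed
    show ?thesis
      unfolding piece_integrable_def piece_integral_def set_integrable_def set_lebesgue_integral_def e
      using i by (auto intro!: Bochner_Integration.integrable_sum Bochner_Integration.integral_sum)
  qed
  have "form_integral A S v = - 2 * \<i> * (\<Sum>l<m. piece_integral (c l) (F l) v)"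
    using p by (intro form_integral_eq[OF atlas t v]) blast
  also have "(\<Sum>l<m. piece_integral (c l) (F l) v) = (\<Sum>l<m. \<Sum>j\<in>J. piece_integral (c l) (F l) (w j))"
    using p by (intro sum.cong refl) simp
  also have "\<dots> = (\<Sum>j\<in>J. \<Sum>l<m. piece_integral (c l) (F l) (w j))"
    by (rule sum.swap)
  also have "- 2 * \<i> * \<dots> = (\<Sum>j\<in>J. - 2 * \<i> * (\<Sum>l<m. piece_integral (c l) (F l) (w j)))"
    by (rule sum_distrib_left)
  also have "\<dots> = (\<Sum>j\<in>J. form_integral A S (w j))"
    using form_integral_eq[OF atlas t wj] int by (intro sum.cong refl) simp
  finally show ?thesis .
qed

text \<open>A form supported in a closed set inside one chart is integrated in that chart.\<close>

lemma form_integral_supported: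
  assumes t: "tiling A S m c F" and w: "tensor_field A 1 1 S w" and S: "S \<in> sets borel"
    and d: "d \<in> coords A" and K: "closed K" "K \<subseteq> fst d"
    and zero: "\<And>e x. e \<in> coords A \<Longrightarrow> x \<in> fst e \<Longrightarrow> x \<in> S \<Longrightarrow> x \<notin> K \<Longrightarrow> w e x = 0"
    and int: "piece_integrable d (K \<inter> S) w"
  shows "form_integral A S w = - 2 * \<i> * piece_integral d (K \<inter> S) w"
proof -
  have F: "c l \<in> coords A" "complex_chart (c l)" "F l \<in> sets borel" "F l \<subseteq> fst (c l)" "F l \<subseteq> S" if "l < m" for l
    using t that coords_complex_chart unfolding tiling_def by auto
  \<comment> \<open>The piece \<open>K \<inter> S\<close> is put in front, and \<open>K\<close> is removed from the others.\<close>
  define c' where "c' = case_nat d c"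
  define F' where "F' = case_nat (K \<inter> S) (\<lambda>l. F l - K)"
  have Kb: "K \<in> sets borel" using K by (rule_tac borel_closed)
  have t': "tiling A S (Suc m) c' F'"
    unfolding tiling_def
  proof (intro conjI allI impI)
    fix k assume "k < Suc m"
    thus "c' k \<in> coords A" "F' k \<in> sets borel" "F' k \<subseteq> fst (c' k)"
      using d K Kb S F(1,3) subsetD[OF F(4)] by (auto simp: c'_def F'_def split: nat.splits)
  next
    have "a = b" if "y \<in> F a" "y \<in> F b" "a < m" "b < m" for a b y
      using t that unfolding tiling_def disjoint_family_on_def by blast
    thus "disjoint_family_on F' {..<Suc m}"
      unfolding disjoint_family_on_def by (auto simp: F'_def split: nat.splits)
    show "(\<Union>k<Suc m. F' k) = S"
    proof -
      have "(\<Union>k<Suc m. F' k) = F' 0 \<union> (\<Union>l<m. F' (Suc l))"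
        unfolding lessThan_Suc_eq_insert_0 by auto
      also have "\<dots> = (K \<inter> S) \<union> ((\<Union>l<m. F l) - K)" by (auto simp: F'_def)
      also have "(\<Union>l<m. F l) = S" using t unfolding tiling_def by blast
      finally show ?thesis by blast
    qed
  qed
  have z: "(\<lambda>z. indicator (snd (c l) ` (F l - K)) z *\<^sub>R local_rep (c l) (w (c l)) z) = (\<lambda>_. 0)"
    if l: "l < m" for l
  proof
    fix z
    show "indicator (snd (c l) ` (F l - K)) z *\<^sub>R local_rep (c l) (w (c l)) z = 0"
    proof (cases "z \<in> snd (c l) ` (F l - K)")
      case True
      then obtain x where x: "x \<in> F l" "x \<notin> K" "z = snd (c l) x" by blast
      hence "x \<in> fst (c l)" "x \<in> S" using F[OF l] by auto
      hence "local_rep (c l) (w (c l)) z = 0" using zero[OF F(1)[OF l] _ _ x(2)] x(3) F(2)[OF l] by simp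
      thus ?thesis by (simp only: scaleR_zero_right)
    next
      case False
      hence "indicator (snd (c l) ` (F l - K)) z = (0::real)" by (rule indicator_simps(2))
      thus ?thesis by (simp only: scaleR_zero_left)
    qed
  qed
  have rest: "piece_integrable (c l) (F l - K) w" "piece_integral (c l) (F l - K) w = 0" if "l < m" for l
    unfolding piece_integrable_def piece_integral_def set_integrable_def set_lebesgue_integral_def z[OF that]
    by simp_all
  have "form_integral A S w = - 2 * \<i> * (\<Sum>k<Suc m. piece_integral (c' k) (F' k) w)"
    by (rule form_integral_eq[OF atlas t' w])
      (use int rest(1) in \<open>auto simp: c'_def F'_def split: nat.splits\<close>)
  also have "(\<Sum>k<Suc m. piece_integral (c' k) (F' k) w) = piece_integral d (K \<inter> S) w"
    unfolding sum.lessThan_Suc_shift using rest(2) by (simp add: c'_def F'_def)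
  finally show ?thesis .
qed

text \<open>The discs of radius \<open>r j\<close>, made disjoint in the order of their indices and deprived of \<open>D\<close>,
  decompose the complement of \<open>D\<close>.\<close>

lemma disc_tiling:
  fixes m :: nat
  assumes D: "finite D" and cd: "\<And>j. j < m \<Longrightarrow> coordinate_disc A D (x j) (c j) (r j)"
    and cover: "\<And>y. \<exists>j<m. y \<in> fst (c j) \<and> dist (snd (c j) y) (snd (c j) (x j)) < r j"
  obtains F where "tiling A (- D) m c F"
    and "\<And>w l. mild_singularities A D w \<Longrightarrow> l < m \<Longrightarrow> piece_integrable (c l) (F l) w"
proof -
  define V where "V = (\<lambda>j. {y \<in> fst (c j). dist (snd (c j) y) (snd (c j) (x j)) < r j})"
  define F where "F = (\<lambda>j. V j - (\<Union>i<j. V i) - D)"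
  note cd' = coordinate_discD[OF atlas cd]
  have V: "open (V j)" if j: "j < m" for j
  proof -
    have eq: "V j = snd (c j) -` ball (snd (c j) (x j)) (r j) \<inter> fst (c j)" by (auto simp: V_def dist_commute)
    show ?thesis unfolding eq
      using continuous_on_open_vimage[OF open_chart_domain[OF cd'(2)[OF j]]]
        continuous_on_chart[OF cd'(2)[OF j]] open_ball by blast
  qed
  have Db: "D \<in> sets borel" using D by (intro borel_closed finite_imp_closed)
  have Vb: "V j \<in> sets borel" if "j < m" for j using V[OF that] by (rule borel_open)
  have Fb: "F j \<in> sets borel" if "j < m" for j
    unfolding F_def using Vb that Db by (intro sets.Diff sets.finite_UN) auto
  have t: "tiling A (- D) m c F"
    unfolding tiling_def
  proof (intro conjI allI impI)
    fix k assume k: "k < m"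
    show "c k \<in> coords A" by (rule cd'(1)[OF k])
    show "F k \<in> sets borel" by (rule Fb[OF k])
    show "F k \<subseteq> fst (c k)" by (auto simp: F_def V_def)
  next
    have "F i \<inter> F j = {}" if "i < j" for i j using that by (auto simp: F_def)
    thus "disjoint_family_on F {..<m}"
      unfolding disjoint_family_on_def by (metis inf_commute linorder_neqE_nat)
    show "(\<Union>k<m. F k) = - D"
    proof (intro equalityI subsetI)
      fix y assume y: "y \<in> - D"
      define j where "j = (LEAST j. j < m \<and> y \<in> V j)"
      have ex: "\<exists>j. j < m \<and> y \<in> V j" using cover[of y] by (auto simp: V_def)
      have j: "j < m" "y \<in> V j" unfolding j_def using LeastI_ex[OF ex] by auto
      have "y \<notin> V i" if "i < j" for i
        using not_less_Least[of i "\<lambda>j. j < m \<and> y \<in> V j"] that j(1) unfolding j_def by auto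
      hence "y \<in> F j" using j y by (auto simp: F_def)
      thus "y \<in> (\<Union>k<m. F k)" using j by blast
    qed (auto simp: F_def)
  qed
  have "piece_integrable (c l) (F l) w" if w: "mild_singularities A D w" and l: "l < m" for w l
    unfolding piece_integrable_def
  proof (rule set_integrable_subset)
    show "set_integrable lborel (cball (snd (c l) (x l)) (3 * r l)) (local_rep (c l) (w (c l)))"
      by (rule mild_singularities_integrable(2)[OF atlas w cd[OF l]])
    have "F l \<subseteq> fst (c l)" by (auto simp: F_def V_def)
    from borel_chart_image[OF cd'(2)[OF l] Fb[OF l] this]
    show "snd (c l) ` F l \<in> sets lborel" by simp
    show "snd (c l) ` F l \<subseteq> cball (snd (c l) (x l)) (3 * r l)"
      using cd'(4)[OF l] by (auto simp: F_def V_def dist_commute)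
  qed
  thus thesis using t that by blast
qed

text \<open>By the product rule $\bar\partial(\phi\omega) = \phi\,\bar\partial\omega + \bar\partial\phi\;\omega$,
  where \<open>\<omega>\<close> itself is $O(1/|z|)$ because of its simple pole.\<close>

lemma mild_singularities_dbar_scalar_mult:
  assumes D: "finite D" and \<phi>: "C1_scalar A \<phi>" and \<omega>: "C1_field A (- D) \<omega>"
    and mild: "mild_singularities A D (dbar \<omega>)"
    and lim: "\<And>c x. c \<in> coords A \<Longrightarrow> x \<in> D \<Longrightarrow> x \<in> fst c \<Longrightarrow>
        ((\<lambda>z. (z - snd c x) * local_rep c (\<omega> c) z) \<longlongrightarrow> L x) (at (snd c x))"
  shows "mild_singularities A D (dbar (\<lambda>c x. \<phi> x * \<omega> c x))" (is "mild_singularities A D (dbar ?\<omega>)")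
  unfolding mild_singularities_def
proof (intro ballI conjI)
  fix c assume c: "c \<in> coords A"
  have cc: "complex_chart c" using c coords_complex_chart by blast
  show "continuous_on (fst c \<inter> - D) (dbar ?\<omega> c)"
    by (rule continuous_on_dbar[OF C1_field_scalar_mult[OF \<phi> \<omega>] c])
  fix x assume x: "x \<in> D \<inter> fst c"
  let ?z = "snd c x" and ?p = "local_rep c \<phi>" and ?f = "local_rep c (\<omega> c)"
  have Cp: "C1_on (snd c ` fst c) ?p" using \<phi> c unfolding C1_scalar_def by blast
  have Cf: "C1_on (snd c ` (fst c \<inter> - D)) ?f" using \<omega> c unfolding C1_field_def by blast
  have "closed (D - {x})" using D by (intro finite_imp_closed) auto
  hence "open (snd c ` (fst c \<inter> - (D - {x})))" using cc by (intro open_chart_image open_Compl)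
  moreover have "?z \<in> snd c ` (fst c \<inter> - (D - {x}))" using x by blast
  ultimately obtain \<rho>1 where \<rho>1: "\<rho>1 > 0" "cball ?z \<rho>1 \<subseteq> snd c ` (fst c \<inter> - (D - {x}))"
    using open_contains_cball by blast
  obtain \<rho>2 K where \<rho>2: "\<rho>2 > 0"
    "\<forall>z\<in>(ball ?z \<rho>2 - {?z}) \<inter> snd c ` fst c. norm (local_rep c (dbar \<omega> c) z) \<le> K / dist z ?z"
    using mild c x unfolding mild_singularities_def by blast
  have "x \<in> D" "x \<in> fst c" using x by auto
  from lim[OF c this] obtain \<rho>3 where \<rho>3: "\<rho>3 > 0"
    "\<And>z. z \<noteq> ?z \<Longrightarrow> dist z ?z < \<rho>3 \<Longrightarrow> dist ((z - ?z) * ?f z) (L x) < 1"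
    unfolding LIM_def by (metis zero_less_one)
  have sub: "cball ?z \<rho>1 \<subseteq> snd c ` fst c" using \<rho>1 by blast
  have "compact (?p ` cball ?z \<rho>1)"
    by (intro compact_continuous_image continuous_on_subset[OF C1_on_imp_continuous_on[OF Cp] sub]) auto
  then obtain M1 where M1: "M1 > 0" "\<And>z. z \<in> cball ?z \<rho>1 \<Longrightarrow> norm (?p z) \<le> M1"
    using compact_imp_bounded bounded_pos by (metis imageI)
  have "compact (wirtinger_dbar ?p ` cball ?z \<rho>1)"
    by (intro compact_continuous_image continuous_on_subset[OF continuous_on_wirtinger_dbar[OF Cp] sub]) auto
  then obtain M2 where M2: "M2 > 0" "\<And>z. z \<in> cball ?z \<rho>1 \<Longrightarrow> norm (wirtinger_dbar ?p z) \<le> M2"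
    using compact_imp_bounded bounded_pos by (metis imageI)
  define \<rho> where "\<rho> = min \<rho>1 (min \<rho>2 \<rho>3)"
  define K' where "K' = M1 * K + M2 * (norm (L x) + 1)"
  have "\<forall>z\<in>(ball ?z \<rho> - {?z}) \<inter> snd c ` fst c. norm (local_rep c (dbar ?\<omega> c) z) \<le> K' / dist z ?z"
  proof
    fix z assume z: "z \<in> (ball ?z \<rho> - {?z}) \<inter> snd c ` fst c"
    have z1: "z \<in> cball ?z \<rho>1" "z \<in> ball ?z \<rho>2 - {?z}" "z \<noteq> ?z" "dist z ?z < \<rho>3" and z2: "z \<in> snd c ` fst c"
      using z by (auto simp: \<rho>_def dist_commute)
    have zD: "z \<in> snd c ` (fst c \<inter> - D)" using \<rho>1(2) z1 by blast
    have d: "dist z ?z > 0" using z1 by simp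
    have "local_rep c (dbar ?\<omega> c) z = wirtinger_dbar (\<lambda>z. ?p z * ?f z) z"
      unfolding local_rep_dbar[OF cc z2] by (simp add: local_rep_def o_def)
    also have "\<dots> = ?p z * wirtinger_dbar ?f z + wirtinger_dbar ?p z * ?f z"
      using Cp Cf z2 zD unfolding C1_on_def by (intro wirtinger_dbar_mult) auto
    also have "norm \<dots> \<le> M1 * (K / dist z ?z) + M2 * ((norm (L x) + 1) / dist z ?z)"
    proof (rule order_trans[OF norm_triangle_ineq add_mono])
      have "norm (wirtinger_dbar ?f z) \<le> K / dist z ?z"
        using \<rho>2(2) z1(2) z2 unfolding local_rep_dbar[OF cc z2, symmetric] by blast
      thus "norm (?p z * wirtinger_dbar ?f z) \<le> M1 * (K / dist z ?z)"
        unfolding norm_mult using M1 z1 by (intro mult_mono) auto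
      have "norm ((z - ?z) * ?f z) \<le> norm (L x) + 1"
        using \<rho>3(2)[OF z1(3,4)] norm_triangle_sub[of "(z - ?z) * ?f z" "L x"] unfolding dist_norm by linarith
      hence "norm (?f z) \<le> (norm (L x) + 1) / dist z ?z"
        unfolding pos_le_divide_eq[OF d] by (simp add: norm_mult dist_norm mult.commute)
      thus "norm (wirtinger_dbar ?p z * ?f z) \<le> M2 * ((norm (L x) + 1) / dist z ?z)"
        unfolding norm_mult using M2 z1 by (intro mult_mono) auto
    qed
    also have "\<dots> = K' / dist z ?z" by (simp add: K'_def add_divide_distrib ring_distribs)
    finally show "norm (local_rep c (dbar ?\<omega> c) z) \<le> K' / dist z ?z" .
  qed
  moreover have "\<rho> > 0" using \<rho>1 \<rho>2 \<rho>3 by (simp add: \<rho>_def)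
  ultimately show "\<exists>\<rho>>0. \<exists>K. \<forall>z\<in>(ball ?z \<rho> - {?z}) \<inter> snd c ` fst c.
      norm (local_rep c (dbar ?\<omega> c) z) \<le> K / dist z ?z" by blast
qed

text \<open>The Stokes formula for a form cut off by a function \<open>\<phi>\<close> supported in one coordinate disc. The
  centre of the disc need not belong to \<open>D\<close>; then the right-hand side is 0.\<close>

lemma stokes_coordinate_disc:
  assumes D: "finite D" and \<phi>: "C1_scalar A \<phi>"
    and \<omega>: "tensor_field A 1 0 (- D) \<omega>" "C1_field A (- D) \<omega>" "mild_singularities A D (dbar \<omega>)"
    and lim: "\<And>c x. c \<in> coords A \<Longrightarrow> x \<in> D \<Longrightarrow> x \<in> fst c \<Longrightarrow>
        ((\<lambda>z. (z - snd c x) * local_rep c (\<omega> c) z) \<longlongrightarrow> L x) (at (snd c x))"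
    and cd: "coordinate_disc A D x c r" and supp: "\<And>y. y \<notin> closed_disc c x (2 * r) \<Longrightarrow> \<phi> y = 0"
    and t: "tiling A (- D) m e F"
  shows "form_integral A (- D) (dbar (\<lambda>c x. \<phi> x * \<omega> c x)) =
    2 * of_real pi * \<i> * (\<phi> x * (if x \<in> D then L x else 0))"
proof -
  note c = coordinate_discD[OF atlas cd]
  let ?\<omega> = "\<lambda>c x. \<phi> x * \<omega> c x" and ?z = "snd c x" and ?K = "closed_disc c x (3 * r)"
  let ?f = "local_rep c (?\<omega> c)" and ?L = "\<phi> x * (if x \<in> D then L x else 0)"
  have opD: "open (- D)" using D by (intro open_Compl finite_imp_closed)
  have C1: "C1_field A (- D) ?\<omega>" by (rule C1_field_scalar_mult[OF \<phi> \<omega>(2)])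
  have mild: "mild_singularities A D (dbar ?\<omega>)"
    by (rule mild_singularities_dbar_scalar_mult[OF D \<phi> \<omega>(2,3) lim])
  have tens: "tensor_field A 1 1 (- D) (dbar ?\<omega>)"
    by (rule tensor_field_dbar[OF atlas tensor_field_scalar_mult[OF \<omega>(1)] C1 opD])
  have K3: "cball ?z (3 * r) \<subseteq> snd c ` fst c" using c(4) by (intro c(6)) simp
  have K2: "cball ?z (2 * r) \<subseteq> snd c ` fst c" using c(4) by (intro c(6)) simp
  note K = closed_disc_eq[OF c(2) K3] and K' = closed_disc_eq[OF c(2) K2]
  have Kf: "?K \<subseteq> fst c" using K(1) by auto
  have int: "set_integrable lborel (cball ?z (3 * r) - {?z}) (local_rep c (dbar ?\<omega> c))"
    by (rule mild_singularities_integrable(1)[OF atlas mild cd])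
  have KD: "snd c ` (?K \<inter> - D) = (if x \<in> D then cball ?z (3 * r) - {?z} else cball ?z (3 * r))"
  proof -
    have Dx: "?K \<inter> D = (if x \<in> D then {x} else {})"
    proof -
      have "y = x" if "y \<in> D" "y \<in> fst c" "dist (snd c y) (snd c x) \<le> 3 * r" for y
        by (rule c(7)[OF that(1,2)]) (use that(3) c(4) in linarith)
      thus ?thesis using c(3,4) unfolding K(1) by (auto split: if_splits)
    qed
    have "snd c ` (?K \<inter> - D) = snd c ` ?K - snd c ` (?K \<inter> D)"
    proof -
      have "?K \<inter> - D = ?K - (?K \<inter> D)" by blast
      thus ?thesis using inj_on_image_set_diff[OF inj_on_subset[OF chart_inj_on[OF c(2)] Kf], of ?K "?K \<inter> D"] by auto
    qed
    thus ?thesis unfolding K(2) Dx by (simp split: if_splits)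
  qed
  have int': "piece_integrable c (?K \<inter> - D) (dbar ?\<omega>)"
    unfolding piece_integrable_def KD
    using int mild_singularities_integrable(2)[OF atlas mild cd] by simp
  have val: "piece_integral c (?K \<inter> - D) (dbar ?\<omega>) =
      (LINT z:cball ?z (3 * r) - {?z}|lborel. local_rep c (dbar ?\<omega> c) z)"
    unfolding piece_integral_def KD
    using set_integrable_insert(2)[OF int] c(4) by simp
  have "(LINT z:cball ?z (3 * r) - {?z}|lborel. local_rep c (dbar ?\<omega> c) z) =
      (LINT z:cball ?z (3 * r) - {?z}|lborel. wirtinger_dbar ?f z)"
    using K3 by (intro set_lebesgue_integral_cong) (auto simp: local_rep_dbar[OF c(2)] subset_iff)
  also have "\<dots> = - (of_real pi * ?L)"
  proof (rule integral_wirtinger_dbar_punctured_disc)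
    show "C1_on (ball ?z (4 * r) - {?z}) ?f"
      using C1 c(1,8) C1_on_subset unfolding C1_field_def by blast
    show "0 < 3 * r" "3 * r < 4 * r" using c(4) by auto
    show "?f z = 0" if z: "dist z ?z = 3 * r" for z
    proof -
      have "z \<in> cball ?z (3 * r)" using z by (simp add: dist_commute)
      then obtain y where y: "y \<in> fst c" "z = snd c y" using K3 by blast
      hence "y \<notin> closed_disc c x (2 * r)" using z c(4) unfolding K'(1) by simp
      thus ?thesis using y c(2) supp by simp
    qed
    show "set_integrable lborel (cball ?z (3 * r) - {?z}) (wirtinger_dbar ?f)"
    proof -
      have "(\<lambda>z. indicator (cball ?z (3 * r) - {?z}) z *\<^sub>R local_rep c (dbar ?\<omega> c) z) =
          (\<lambda>z. indicator (cball ?z (3 * r) - {?z}) z *\<^sub>R wirtinger_dbar ?f z)"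
        using K3 by (auto simp: fun_eq_iff indicator_def local_rep_dbar[OF c(2)] subset_iff)
      thus ?thesis using int unfolding set_integrable_def by simp
    qed
    have "C1_on (snd c ` fst c) (local_rep c \<phi>)" using \<phi> c(1) unfolding C1_scalar_def by blast
    hence "isCont (local_rep c \<phi>) ?z"
      using c(3) by (auto simp: C1_on_def intro!: differentiable_imp_continuous_within)
    hence p: "(local_rep c \<phi> \<longlongrightarrow> \<phi> x) (at ?z)"
      using c(2,3) by (simp add: isCont_def)
    have q: "((\<lambda>z. (z - ?z) * local_rep c (\<omega> c) z) \<longlongrightarrow> (if x \<in> D then L x else 0)) (at ?z)"
    proof (cases "x \<in> D")
      case True
      thus ?thesis using lim[OF c(1) _ c(3)] by simp
    next
      case False
      have "C1_on (snd c ` (fst c \<inter> - D)) (local_rep c (\<omega> c))"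
        using \<omega>(2) c(1) unfolding C1_field_def by blast
      hence "isCont (local_rep c (\<omega> c)) ?z"
        using c(3) False by (auto simp: C1_on_def intro!: differentiable_imp_continuous_within)
      hence "((\<lambda>z. (z - ?z) * local_rep c (\<omega> c) z) \<longlongrightarrow> (?z - ?z) * local_rep c (\<omega> c) ?z) (at ?z)"
        by (intro tendsto_intros) (simp add: isCont_def)
      thus ?thesis using False by simp
    qed
    have "((\<lambda>z. local_rep c \<phi> z * ((z - ?z) * local_rep c (\<omega> c) z)) \<longlongrightarrow> ?L) (at ?z)"
      by (rule tendsto_mult[OF p q])
    thus "((\<lambda>z. (z - ?z) * ?f z) \<longlongrightarrow> ?L) (at ?z)"
      by (simp add: local_rep_def o_def mult_ac)
  qed
  finally have I: "piece_integral c (?K \<inter> - D) (dbar ?\<omega>) = - (of_real pi * ?L)" unfolding val .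
  have "form_integral A (- D) (dbar ?\<omega>) = - 2 * \<i> * piece_integral c (?K \<inter> - D) (dbar ?\<omega>)"
  proof (rule form_integral_supported[OF t tens _ c(1) K(3) Kf _ int'])
    show "- D \<in> sets borel" using opD by (rule borel_open)
    fix e y assume e: "e \<in> coords A" "y \<in> fst e" "y \<notin> ?K"
    have ee: "complex_chart e" using e coords_complex_chart by blast
    let ?W = "snd e ` (fst e \<inter> - closed_disc c x (2 * r))"
    have W: "open ?W" using ee K'(3) by (intro open_chart_image open_Compl)
    have y: "snd e y \<in> ?W" using e c(4) unfolding K(1) K'(1) by auto
    have "dbar ?\<omega> e y = wirtinger_dbar (\<lambda>_. 0) (snd e y)"
      unfolding dbar_def by (rule wirtinger_dbar_cong[OF W y]) (use ee supp in auto)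
    thus "dbar ?\<omega> e y = 0" by simp
  qed
  thus ?thesis unfolding I by simp
qed

text \<open>For a (1,0)-form \<open>\<omega>\<close> on the complement of \<open>D\<close> with at most simple poles, of residue \<open>L x\<close>, the residue
  being given as the limit of $(z - z(x))\,\omega$ in every coordinate \<open>z\<close>.\<close>

theorem stokes_residues:
  assumes comp: "compact (UNIV :: 'c set)" and D: "finite D"
    and \<omega>: "tensor_field A 1 0 (- D) \<omega>" "C1_field A (- D) \<omega>" "mild_singularities A D (dbar \<omega>)"
    and lim: "\<And>c x. c \<in> coords A \<Longrightarrow> x \<in> D \<Longrightarrow> x \<in> fst c \<Longrightarrow>
        ((\<lambda>z. (z - snd c x) * local_rep c (\<omega> c) z) \<longlongrightarrow> L x) (at (snd c x))"
  shows "form_integral A (- D) (dbar \<omega>) = 2 * of_real pi * \<i> * (\<Sum>x\<in>D. L x)"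
proof -
  obtain m :: nat and x c r where cd: "\<And>j. j < m \<Longrightarrow> coordinate_disc A D (x j) (c j) (r j)"
    and cover: "\<And>y. \<exists>j<m. y \<in> fst (c j) \<and> dist (snd (c j) y) (snd (c j) (x j)) < r j"
    using finite_coordinate_disc_cover[OF atlas D comp] by metis
  obtain F where t: "tiling A (- D) m c F"
    and int: "\<And>w l. mild_singularities A D w \<Longrightarrow> l < m \<Longrightarrow> piece_integrable (c l) (F l) w"
    using disc_tiling[OF D cd cover] by blast
  define \<beta> where "\<beta> = (\<lambda>j. surface_bump (c j) (x j) (r j))"
  \<comment> \<open>The partition of unity obtained from the bump functions by telescoping.\<close>
  define \<phi> where "\<phi> = (\<lambda>j y. \<beta> j y * (\<Prod>i<j. 1 - \<beta> i y))"
  have opD: "open (- D)" using D by (intro open_Compl finite_imp_closed)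
  have \<beta>: "C1_scalar A (\<beta> j)" if "j < m" for j
    unfolding \<beta>_def by (rule C1_scalar_surface_bump[OF atlas cd[OF that]])
  have \<phi>: "C1_scalar A (\<phi> j)" if "j < m" for j
    unfolding \<phi>_def using \<beta> that
    by (intro C1_scalar_mult C1_scalar_prod C1_scalar_one_minus) auto
  have supp: "\<phi> j y = 0" if "j < m" "y \<notin> closed_disc (c j) (x j) (2 * r j)" for j y
    using surface_bump_eq_0[OF atlas cd[OF that(1)] that(2)] by (simp add: \<phi>_def \<beta>_def)
  have one: "(\<Sum>j<m. \<phi> j y) = 1" for y
  proof -
    obtain j where j: "j < m" "y \<in> fst (c j)" "dist (snd (c j) y) (snd (c j) (x j)) < r j"
      using cover by blast
    hence "\<beta> j y = 1" unfolding \<beta>_def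
      using coordinate_discD(4)[OF atlas cd[OF j(1)]] by (intro surface_bump_eq_1) auto
    hence "(\<Prod>i<m. 1 - \<beta> i y) = 0" using j by (intro prod_zero) auto
    thus ?thesis unfolding \<phi>_def telescoping_partition[of "\<lambda>j. \<beta> j y"] by simp
  qed
  let ?w = "\<lambda>j. dbar (\<lambda>c x. \<phi> j x * \<omega> c x)"
  have "form_integral A (- D) (dbar \<omega>) = (\<Sum>j<m. form_integral A (- D) (?w j))"
  proof (rule form_integral_sum[OF t])
    fix j assume "j \<in> {..<m}"
    hence j: "j < m" by simp
    show "tensor_field A 1 1 (- D) (?w j)"
      by (rule tensor_field_dbar[OF atlas tensor_field_scalar_mult[OF \<omega>(1)] C1_field_scalar_mult[OF \<phi>[OF j] \<omega>(2)] opD])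
    fix l assume "l < m"
    thus "piece_integrable (c l) (F l) (?w j)"
      by (intro int mild_singularities_dbar_scalar_mult[OF D \<phi>[OF j] \<omega>(2,3) lim])
  next
    show "tensor_field A 1 1 (- D) (dbar \<omega>)" by (rule tensor_field_dbar[OF atlas \<omega>(1,2) opD])
    fix d y assume d: "d \<in> coords A" "y \<in> fst d" "y \<in> - D"
    have eq: "local_rep d (\<omega> d) = (\<lambda>z. \<Sum>j<m. local_rep d (\<lambda>x. \<phi> j x * \<omega> d x) z)"
      by (simp add: fun_eq_iff local_rep_def one flip: sum_distrib_right)
    show "dbar \<omega> d y = (\<Sum>j<m. ?w j d y)"
      unfolding dbar_def
    proof (subst eq, rule wirtinger_dbar_sum)
      fix j assume "j \<in> {..<m}"
      hence "C1_field A (- D) (\<lambda>c x. \<phi> j x * \<omega> c x)" using \<phi> \<omega>(2) by (intro C1_field_scalar_mult) auto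
      thus "local_rep d (\<lambda>x. \<phi> j x * \<omega> d x) differentiable at (snd d y)"
        using d unfolding C1_field_def C1_on_def by blast
    qed simp
  qed simp
  also have "\<dots> = (\<Sum>j<m. 2 * of_real pi * \<i> * (\<phi> j (x j) * (if x j \<in> D then L (x j) else 0)))"
  proof (rule sum.cong[OF refl])
    fix j assume "j \<in> {..<m}"
    hence j: "j < m" by simp
    show "form_integral A (- D) (?w j) = 2 * of_real pi * \<i> * (\<phi> j (x j) * (if x j \<in> D then L (x j) else 0))"
      by (rule stokes_coordinate_disc[OF D \<phi>[OF j] \<omega> lim cd[OF j] supp[OF j] t])
  qed
  also have "\<dots> = 2 * of_real pi * \<i> * (\<Sum>j<m. \<phi> j (x j) * (if x j \<in> D then L (x j) else 0))"
    by (simp only: sum_distrib_left)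
  also have "(\<Sum>j<m. \<phi> j (x j) * (if x j \<in> D then L (x j) else 0)) = (\<Sum>j<m. \<Sum>y\<in>D. \<phi> j y * L y)"
  proof (rule sum.cong[OF refl])
    fix j assume "j \<in> {..<m}"
    hence j: "j < m" by simp
    note c = coordinate_discD[OF atlas cd[OF j]]
    have K2: "cball (snd (c j) (x j)) (2 * r j) \<subseteq> snd (c j) ` fst (c j)" using c(4) by (intro c(6)) simp
    have "\<phi> j y * L y = (if y = x j then \<phi> j (x j) * L (x j) else 0)" if y: "y \<in> D" for y
    proof (cases "y = x j")
      case False
      hence "y \<notin> closed_disc (c j) (x j) (2 * r j)"
        using c(4) c(7)[OF y] unfolding closed_disc_eq(1)[OF c(2) K2] by auto
      thus ?thesis using supp[OF j] False by simp
    qed simp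
    hence "(\<Sum>y\<in>D. \<phi> j y * L y) = (\<Sum>y\<in>D. if y = x j then \<phi> j (x j) * L (x j) else 0)" by simp
    thus "\<phi> j (x j) * (if x j \<in> D then L (x j) else 0) = (\<Sum>y\<in>D. \<phi> j y * L y)"
      using D by (simp add: sum.delta)
  qed
  also have "\<dots> = (\<Sum>y\<in>D. \<Sum>j<m. \<phi> j y * L y)" by (rule sum.swap)
  also have "\<dots> = (\<Sum>y\<in>D. L y)" by (simp add: one flip: sum_distrib_right)
  finally show ?thesis .
qed

lemma form_integral_mild_add:
  assumes comp: "compact (UNIV :: 'c set)" and D: "finite D"
    and u: "tensor_field A 1 1 (- D) u" "mild_singularities A D u"
    and v: "tensor_field A 1 1 (- D) v" "mild_singularities A D v"
    and w: "tensor_field A 1 1 (- D) w"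
    and eq: "\<And>c x. c \<in> coords A \<Longrightarrow> x \<in> fst c \<Longrightarrow> x \<notin> D \<Longrightarrow> w c x = u c x + v c x"
  shows "form_integral A (- D) w = form_integral A (- D) u + form_integral A (- D) v"
proof -
  obtain m :: nat and x c r where cd: "\<And>j. j < m \<Longrightarrow> coordinate_disc A D (x j) (c j) (r j)"
    and cover: "\<And>y. \<exists>j<m. y \<in> fst (c j) \<and> dist (snd (c j) y) (snd (c j) (x j)) < r j"
    using finite_coordinate_disc_cover[OF atlas D comp] by metis
  obtain F where t: "tiling A (- D) m c F"
    and int: "\<And>w l. mild_singularities A D w \<Longrightarrow> l < m \<Longrightarrow> piece_integrable (c l) (F l) w"
    using disc_tiling[OF D cd cover] by blast
  \<comment> \<open>The sum over two terms, indexed by the booleans.\<close>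
  have "form_integral A (- D) w = (\<Sum>b\<in>UNIV. form_integral A (- D) (if b then u else v))"
    by (rule form_integral_sum[OF t]) (use u v w int eq in \<open>auto simp: UNIV_bool\<close>)
  thus ?thesis by (simp add: UNIV_bool add.commute)
qed

end

section \<open>Traces and semidefinite forms\<close>

text \<open>The basis is finite, and the subspace is its real span. The trace of an operator \<open>T\<close> on \<open>V\<close> is
  the sum of \<open>b \<bullet> T b\<close> over such a basis \<open>C\<close>.\<close>

definition orthonormal_basis_of :: "'a::euclidean_space set \<Rightarrow> 'a set \<Rightarrow> bool" where
  "orthonormal_basis_of V C \<longleftrightarrow>
     finite C \<and> pairwise orthogonal C \<and> (\<forall>b\<in>C. norm b = 1) \<and> span C = V"

lemma orthonormal_basis_of_exists:
  fixes V :: "'a::euclidean_space set"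
  assumes "subspace V"
  obtains C where "orthonormal_basis_of V C"
  using orthonormal_basis_subspace[OF assms] independent_imp_finite
  unfolding orthonormal_basis_of_def by metis

lemma orthonormal_basis_of_subset: "orthonormal_basis_of V C \<Longrightarrow> b \<in> C \<Longrightarrow> b \<in> V"
  unfolding orthonormal_basis_of_def using span_superset by blast

lemma orthonormal_basis_of_expand:
  assumes "orthonormal_basis_of V C" "x \<in> V"
  shows "x = (\<Sum>b\<in>C. (x \<bullet> b) *\<^sub>R b)"
  using assms orthonormal_basis_expand[of C x] unfolding orthonormal_basis_of_def by simp

text \<open>$\mathrm{tr}_V(ST) = \mathrm{tr}_U(TS)$ for $T : V \to U$ and $S : U \to V$. With \<open>S\<close> an
  inclusion, the trace of \<open>T\<close> may be computed on any subspace containing its range.\<close>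

lemma trace_cyclic:
  fixes S T :: "'a::euclidean_space \<Rightarrow> 'a"
  assumes B: "orthonormal_basis_of V B" and C: "orthonormal_basis_of U C"
    and S: "linear S" "S ` U \<subseteq> V" and T: "linear T" "T ` V \<subseteq> U"
  shows "(\<Sum>b\<in>B. b \<bullet> S (T b)) = (\<Sum>c\<in>C. c \<bullet> T (S c))"
proof -
  have "b \<bullet> S (T b) = (\<Sum>c\<in>C. (T b \<bullet> c) * (b \<bullet> S c))" if b: "b \<in> B" for b
  proof -
    have "T b \<in> U" using T(2) orthonormal_basis_of_subset[OF B b] by blast
    from orthonormal_basis_of_expand[OF C this]
    have "S (T b) = S (\<Sum>c\<in>C. (T b \<bullet> c) *\<^sub>R c)" by simp
    also have "\<dots> = (\<Sum>c\<in>C. (T b \<bullet> c) *\<^sub>R S c)" by (simp add: S(1) linear_sum linear_scale)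
    finally show ?thesis by (simp add: inner_sum_right)
  qed
  moreover have "c \<bullet> T (S c) = (\<Sum>b\<in>B. (T b \<bullet> c) * (b \<bullet> S c))" if c: "c \<in> C" for c
  proof -
    have "S c \<in> V" using S(2) orthonormal_basis_of_subset[OF C c] by blast
    from orthonormal_basis_of_expand[OF B this]
    have "T (S c) = T (\<Sum>b\<in>B. (S c \<bullet> b) *\<^sub>R b)" by simp
    also have "\<dots> = (\<Sum>b\<in>B. (S c \<bullet> b) *\<^sub>R T b)" by (simp add: T(1) linear_sum linear_scale)
    finally show ?thesis by (simp add: inner_sum_right inner_commute mult.commute)
  qed
  ultimately show ?thesis by (simp add: sum.swap[of _ C B])
qed

text \<open>Replacing \<open>V\<close> by \<open>T ` V\<close> does not change the trace, and \<open>k\<close> such steps lead to the zero space.\<close>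

lemma trace_nilpotent:
  fixes T :: "'a::euclidean_space \<Rightarrow> 'a"
  assumes T: "linear T"
  shows "subspace V \<Longrightarrow> T ` V \<subseteq> V \<Longrightarrow> (\<And>v. v \<in> V \<Longrightarrow> (T ^^ k) v = 0) \<Longrightarrow>
    orthonormal_basis_of V B \<Longrightarrow> (\<Sum>b\<in>B. b \<bullet> T b) = 0"
proof (induction k arbitrary: V B)
  case 0
  have "b = 0" if "b \<in> B" for b using "0.prems"(3)[OF orthonormal_basis_of_subset[OF "0.prems"(4) that]] by simp
  thus ?case by (intro sum.neutral ballI) (metis inner_zero_left)
next
  case (Suc k)
  let ?U = "T ` V"
  have U: "subspace ?U" using T Suc.prems(1) linear_subspace_image by blast
  obtain C where C: "orthonormal_basis_of ?U C" using orthonormal_basis_of_exists[OF U] .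
  have "(\<Sum>b\<in>B. b \<bullet> T b) = (\<Sum>c\<in>C. c \<bullet> T c)"
    using trace_cyclic[OF Suc.prems(4) C, of "\<lambda>x. x" T] T Suc.prems(2) by (simp add: linear_id[unfolded id_def] linear_ident)
  also have "\<dots> = 0"
  proof (rule Suc.IH[OF U _ _ C])
    show "T ` ?U \<subseteq> ?U" using Suc.prems(2) by blast
    fix v assume "v \<in> ?U"
    then obtain u where "u \<in> V" "v = T u" by blast
    thus "(T ^^ k) v = 0" using Suc.prems(3)[of u] by (simp add: funpow_swap1)
  qed
  finally show ?case .
qed

text \<open>Orthogonal projection to a finite-dimensional subspace with respect to a positive semidefinite
  form, by the Gram--Schmidt process.\<close>

lemma semidefinite_projection:
  fixes K :: "'a::real_vector \<Rightarrow> 'a \<Rightarrow> real"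
  assumes lin: "\<And>y. linear (\<lambda>x. K x y)" and sym: "\<And>x y. K x y = K y x" and psd: "\<And>x. 0 \<le> K x x"
    and S: "finite S"
  shows "\<exists>m\<in>span S. \<forall>y\<in>span S. K (v - m) y = 0"
proof -
  have addl: "K (x + y) z = K x z + K y z" and scl: "K (a *\<^sub>R x) z = a * K x z"
    and subl: "K (x - y) z = K x z - K y z" for x y z a
    using linear_add[OF lin[of z]] linear_scale[OF lin[of z]] linear_diff[OF lin[of z]] by auto
  have addr: "K z (x + y) = K z x + K z y" and scr: "K z (a *\<^sub>R x) = a * K z x" for x y z a
    using addl scl sym by metis+
  have degenerate: "K a x = 0" if "K a a = 0" for a x
  proof (rule ccontr)
    assume nz: "K a x \<noteq> 0"
    define t where "t = - (K x x + 1) / (2 * K a x)"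
    have "K (x + t *\<^sub>R a) (x + t *\<^sub>R a) = K x x + 2 * t * K a x"
      using that sym[of x a] by (simp add: addl addr scl scr algebra_simps)
    also have "\<dots> = - 1" using nz by (simp add: t_def field_simps)
    finally show False using psd[of "x + t *\<^sub>R a"] by simp
  qed
  show ?thesis using S
  proof (induction S arbitrary: v rule: finite_induct)
    case empty
    have "K v 0 = 0" using scr[of v 0 0] by simp
    thus ?case by simp
  next
    case (insert a S)
    obtain m where m: "m \<in> span S" "\<forall>y\<in>span S. K (v - m) y = 0" using insert.IH by blast
    obtain n where n: "n \<in> span S" "\<forall>y\<in>span S. K (a - n) y = 0" using insert.IH by blast
    define a' where "a' = a - n"
    \<comment> \<open>If \<open>K a' a' = 0\<close> then \<open>t = 0\<close>, and \<open>a'\<close> is orthogonal to everything anyway.\<close>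
    define t where "t = K (v - m) a' / K a' a'"
    have sub: "span S \<subseteq> span (insert a S)" by (intro span_mono) auto
    have a': "a' \<in> span (insert a S)"
      using span_diff[OF span_base[of a "insert a S"] subsetD[OF sub n(1)]] unfolding a'_def by simp
    have t: "K (v - m) a' - t * K a' a' = 0"
      using degenerate[of a' "v - m"] sym[of a' "v - m"] by (cases "K a' a' = 0") (auto simp: t_def)
    show ?case
    proof (intro bexI ballI)
      show "m + t *\<^sub>R a' \<in> span (insert a S)" using span_add[OF subsetD[OF sub m(1)] span_scale[OF a']] .
      fix y assume "y \<in> span (insert a S)"
      then obtain k where k: "y - k *\<^sub>R a \<in> span S" unfolding span_insert by blast
      define s where "s = y - k *\<^sub>R a + k *\<^sub>R n"
      have s: "s \<in> span S" unfolding s_def using k n by (intro span_add span_scale) auto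
      have y: "y = s + k *\<^sub>R a'" by (simp add: s_def a'_def algebra_simps)
      have "K (v - (m + t *\<^sub>R a')) y = K ((v - m) - t *\<^sub>R a') (s + k *\<^sub>R a')"
        unfolding y by (simp add: algebra_simps)
      also have "\<dots> = K (v - m) s - t * K a' s + k * (K (v - m) a' - t * K a' a')"
        unfolding subl[of "v - m" "t *\<^sub>R a'"] by (simp add: addr scl scr algebra_simps)
      also have "\<dots> = 0" using m(2) n(2) s t by (simp add: a'_def)
      finally show "K (v - (m + t *\<^sub>R a')) y = 0" .
    qed
  qed
qed

section \<open>Matrix Lie algebras\<close>

lemma bilinear_matrix_mult: "bilinear ((**) :: complex^'n^'n \<Rightarrow> complex^'n^'n \<Rightarrow> complex^'n^'n)"
  unfolding bilinear_def
proof (intro conjI allI linearI)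
  fix X Y Z :: "complex^'n^'n" and r :: real
  show "X ** (Y + Z) = X ** Y + X ** Z" by (simp add: matrix_add_ldistrib)
  show "(X + Y) ** Z = X ** Z + Y ** Z" 
    by (simp add: matrix_matrix_mult_def vec_eq_iff distrib_right sum.distrib)
  show "X ** (r *\<^sub>R Y) = r *\<^sub>R (X ** Y)" "(r *\<^sub>R X) ** Y = r *\<^sub>R (X ** Y)"
    by (simp_all add: matrix_matrix_mult_def vec_eq_iff scaleR_sum_right)
qed

lemma bounded_bilinear_matrix_mult:
  "bounded_bilinear ((**) :: complex^'n^'n \<Rightarrow> complex^'n^'n \<Rightarrow> complex^'n^'n)"
  using bilinear_matrix_mult bilinear_conv_bounded_bilinear by blast

lemmas matrix_mult_simps = bounded_bilinear.diff_left[OF bounded_bilinear_matrix_mult]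
  bounded_bilinear.diff_right[OF bounded_bilinear_matrix_mult]
  bounded_bilinear.add_left[OF bounded_bilinear_matrix_mult]
  bounded_bilinear.add_right[OF bounded_bilinear_matrix_mult]
  bounded_bilinear.scaleR_left[OF bounded_bilinear_matrix_mult]
  bounded_bilinear.scaleR_right[OF bounded_bilinear_matrix_mult]
  bounded_bilinear.minus_left[OF bounded_bilinear_matrix_mult]
  bounded_bilinear.minus_right[OF bounded_bilinear_matrix_mult]
  bounded_bilinear.zero_left[OF bounded_bilinear_matrix_mult]
  bounded_bilinear.zero_right[OF bounded_bilinear_matrix_mult]

lemma linear_bracket: "linear (bracket X)"
  by (rule linearI) (simp_all add: bracket_def matrix_mult_simps algebra_simps)

lemma linear_bracket_left: "linear (\<lambda>X. bracket X Y)"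
  by (rule linearI) (simp_all add: bracket_def matrix_mult_simps algebra_simps)

lemma bracket_swap: "bracket X Y = - bracket Y X"
  by (simp add: bracket_def)

lemma jacobi: "bracket (bracket X Y) Z = bracket X (bracket Y Z) - bracket Y (bracket X Z)"
  by (simp add: bracket_def matrix_mult_simps matrix_mul_assoc algebra_simps)

lemma conj_transpose_nth [simp]: "conj_transpose M $ i $ j = cnj (M $ j $ i)"
  by (simp add: conj_transpose_def)

lemma conj_transpose_conj_transpose [simp]: "conj_transpose (conj_transpose M) = M"
  by (simp add: vec_eq_iff)

lemma linear_conj_transpose: "linear (conj_transpose :: complex^'n^'n \<Rightarrow> complex^'n^'n)"
  by (rule linearI) (simp_all add: vec_eq_iff)

lemma conj_transpose_mult: "conj_transpose (X ** Y) = conj_transpose Y ** conj_transpose X"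
  by (simp add: vec_eq_iff matrix_matrix_mult_def mult.commute)

lemma conj_transpose_bracket:
  "conj_transpose (bracket X Y) = bracket (conj_transpose Y) (conj_transpose X)"
  by (simp add: bracket_def conj_transpose_mult linear_diff[OF linear_conj_transpose])

lemma inner_matrix: "X \<bullet> Y = Re (\<Sum>i\<in>UNIV. \<Sum>j\<in>UNIV. X $ i $ j * cnj (Y $ i $ j))"
  for X Y :: "complex^'n^'m"
  by (simp add: inner_vec_def inner_complex_def)

lemma inner_matrix_mult_left: "(X ** Y) \<bullet> Z = Y \<bullet> (conj_transpose X ** Z)"
  for X Y Z :: "complex^'n^'n"
proof -
  have "(\<Sum>i\<in>UNIV. \<Sum>j\<in>UNIV. (X ** Y) $ i $ j * cnj (Z $ i $ j)) =
      (\<Sum>i\<in>UNIV. \<Sum>j\<in>UNIV. \<Sum>k\<in>UNIV. X $ i $ k * Y $ k $ j * cnj (Z $ i $ j))"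
    by (simp add: matrix_matrix_mult_def sum_distrib_right)
  also have "\<dots> = (\<Sum>i\<in>UNIV. \<Sum>k\<in>UNIV. \<Sum>j\<in>UNIV. X $ i $ k * Y $ k $ j * cnj (Z $ i $ j))"
    by (intro sum.cong refl sum.swap)
  also have "\<dots> = (\<Sum>k\<in>UNIV. \<Sum>i\<in>UNIV. \<Sum>j\<in>UNIV. X $ i $ k * Y $ k $ j * cnj (Z $ i $ j))"
    by (rule sum.swap)
  also have "\<dots> = (\<Sum>k\<in>UNIV. \<Sum>j\<in>UNIV. \<Sum>i\<in>UNIV. X $ i $ k * Y $ k $ j * cnj (Z $ i $ j))"
    by (intro sum.cong refl sum.swap)
  also have "\<dots> = (\<Sum>k\<in>UNIV. \<Sum>j\<in>UNIV. Y $ k $ j * cnj ((conj_transpose X ** Z) $ k $ j))"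
    by (simp add: matrix_matrix_mult_def sum_distrib_left mult_ac)
  finally show ?thesis by (simp only: inner_matrix)
qed

lemma inner_conj_transpose: "conj_transpose X \<bullet> conj_transpose Y = X \<bullet> Y" for X Y :: "complex^'n^'n"
proof -
  have "conj_transpose X \<bullet> conj_transpose Y = Re (\<Sum>i\<in>UNIV. \<Sum>j\<in>UNIV. cnj (X $ j $ i) * Y $ j $ i)"
    by (simp add: inner_matrix)
  also have "\<dots> = Re (cnj (\<Sum>i\<in>UNIV. \<Sum>j\<in>UNIV. X $ j $ i * cnj (Y $ j $ i)))"
    by simp
  also have "\<dots> = X \<bullet> Y" unfolding inner_matrix by (subst sum.swap) simp
  finally show ?thesis .
qed

lemma inner_matrix_mult_right: "(X ** Y) \<bullet> Z = X \<bullet> (Z ** conj_transpose Y)" for X Y Z :: "complex^'n^'n"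
proof -
  have "(X ** Y) \<bullet> Z = conj_transpose (X ** Y) \<bullet> conj_transpose Z"
    by (simp only: inner_conj_transpose)
  also have "\<dots> = conj_transpose X \<bullet> (Y ** conj_transpose Z)"
    by (simp only: conj_transpose_mult inner_matrix_mult_left conj_transpose_conj_transpose)
  also have "\<dots> = conj_transpose X \<bullet> conj_transpose (Z ** conj_transpose Y)"
    by (simp only: conj_transpose_mult conj_transpose_conj_transpose)
  also have "\<dots> = X \<bullet> (Z ** conj_transpose Y)" by (simp only: inner_conj_transpose)
  finally show ?thesis .
qed

text \<open>The adjoint of $\mathrm{ad}\,X$ with respect to the real inner product
  $\mathrm{Re}\,\mathrm{tr}(XY^*)$ is $\mathrm{ad}\,X^*$.\<close>

lemma inner_bracket: "bracket X Y \<bullet> Z = Y \<bullet> bracket (conj_transpose X) Z"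
  by (simp add: bracket_def inner_diff_left inner_diff_right inner_matrix_mult_left[of X Y]
      inner_matrix_mult_right[of Y X])

lemma has_vector_derivative_iff_limit:
  "(f has_vector_derivative D) (at x) \<longleftrightarrow> ((\<lambda>t. (f t - f x) /\<^sub>R (t - x)) \<longlongrightarrow> D) (at x)"
proof -
  have "((\<lambda>t. norm (f t - f x - (t - x) *\<^sub>R D) / norm (t - x)) \<longlongrightarrow> 0) (at x) \<longleftrightarrow>
      ((\<lambda>t. norm ((f t - f x) /\<^sub>R (t - x) - D)) \<longlongrightarrow> 0) (at x)"
  proof (rule filterlim_cong[OF refl refl])
    show "\<forall>\<^sub>F t in at x. norm (f t - f x - (t - x) *\<^sub>R D) / norm (t - x) =
        norm ((f t - f x) /\<^sub>R (t - x) - D)"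
      unfolding eventually_at_filter
    proof (intro always_eventually allI impI)
      fix t assume t: "t \<noteq> x"
      have "(f t - f x) /\<^sub>R (t - x) - D = (f t - f x - (t - x) *\<^sub>R D) /\<^sub>R (t - x)"
        using t by (simp add: scaleR_diff_right)
      thus "norm (f t - f x - (t - x) *\<^sub>R D) / norm (t - x) = norm ((f t - f x) /\<^sub>R (t - x) - D)"
        by (simp add: divide_inverse mult.commute)
    qed
  qed
  thus ?thesis
    unfolding has_vector_derivative_def has_derivative_iff_norm
    by (simp add: tendsto_norm_zero_iff LIM_zero_iff bounded_linear_scaleR_left)
qed

lemma has_vector_derivative_in_subspace:
  fixes f :: "real \<Rightarrow> 'a::euclidean_space"
  assumes f: "(f has_vector_derivative D) (at x)" and V: "subspace V" "\<And>t. f t \<in> V"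
  shows "D \<in> V"
proof (rule Lim_in_closed_set[OF closed_subspace[OF V(1)]])
  show "((\<lambda>t. (f t - f x) /\<^sub>R (t - x)) \<longlongrightarrow> D) (at x)"
    using f unfolding has_vector_derivative_iff_limit .
  show "\<forall>\<^sub>F t in at x. (f t - f x) /\<^sub>R (t - x) \<in> V"
    using V by (intro always_eventually allI subspace_scale subspace_diff)
qed simp

lemma matrix_inv_inverse:
  "invertible A \<Longrightarrow> matrix_inv A ** A = mat 1" "invertible A \<Longrightarrow> A ** matrix_inv A = mat 1"
  for A :: "complex^'n^'n"
  using someI_ex[of "\<lambda>A'. A ** A' = mat 1 \<and> A' ** A = mat 1"]
  unfolding matrix_inv_def invertible_def by blast+

lemma matrix_inv_has_vector_derivative:
  fixes \<gamma> :: "real \<Rightarrow> complex^'n^'n"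
  assumes \<gamma>: "(\<gamma> has_vector_derivative X) (at 0)" "\<gamma> 0 = mat 1" "\<And>t. invertible (\<gamma> t)"
  shows "((\<lambda>t. matrix_inv (\<gamma> t)) has_vector_derivative - X) (at 0)"
proof -
  define \<delta> where "\<delta> = (\<lambda>t. matrix_inv (\<gamma> t))"
  have inv: "\<delta> t ** \<gamma> t = mat 1" for t unfolding \<delta>_def using \<gamma>(3) matrix_inv_inverse by blast
  have \<delta>0: "\<delta> 0 = mat 1" using inv[of 0] \<gamma>(2) by simp
  have diff: "\<delta> t - mat 1 = - (\<delta> t ** (\<gamma> t - mat 1))" for t
    using inv[of t] by (simp add: matrix_mult_simps)
  obtain K where K': "0 < K \<and> (\<forall>(Y :: complex^'n^'n) (Z :: complex^'n^'n). norm (Y ** Z) \<le> norm Y * norm Z * K)"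
    using bounded_bilinear.pos_bounded[OF bounded_bilinear_matrix_mult] by (rule exE)
  have K: "K > 0" using K' by (rule conjunct1)
  have Kb: "norm (Y ** Z) \<le> norm Y * norm Z * K" for Y Z :: "complex^'n^'n"
    using conjunct2[OF K'] by (elim allE)
  have \<gamma>lim: "(\<gamma> \<longlongrightarrow> mat 1) (at 0)"
    using has_vector_derivative_continuous[OF \<gamma>(1)] \<gamma>(2) by (simp add: isCont_def)
  hence e: "\<forall>\<^sub>F t in at 0. dist (\<gamma> t) (mat 1) < 1 / (2 * K)"
    using K by (intro tendstoD) auto
  \<comment> \<open>From $\delta - 1 = -\delta(\gamma - 1)$ the norm of \<open>\<delta>\<close> is at most $2\|1\|$ once \<open>\<gamma>\<close> is
    close to 1, so that \<open>\<delta>\<close> is continuous; the same identity then gives the derivative.\<close>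
  have "\<forall>\<^sub>F t in at 0. norm (\<delta> t - mat 1) \<le> 2 * norm (mat 1 :: complex^'n^'n) * K * norm (\<gamma> t - mat 1)"
    using e
  proof eventually_elim
    case (elim t)
    have "norm (\<gamma> t - mat 1) * K \<le> 1 / 2" using elim K by (simp add: dist_norm field_simps)
    hence 1: "norm (\<delta> t) * (norm (\<gamma> t - mat 1) * K) \<le> norm (\<delta> t) * (1 / 2)"
      by (intro mult_left_mono) auto
    have 2: "norm (\<delta> t - mat 1) \<le> norm (\<delta> t) * norm (\<gamma> t - mat 1) * K"
      unfolding diff using Kb[of "\<delta> t" "\<gamma> t - mat 1"] by simp
    have "norm (\<delta> t) \<le> norm (mat 1 :: complex^'n^'n) + norm (\<delta> t - mat 1)"
      by (metis add.commute diff_add_cancel norm_triangle_ineq)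
    hence "norm (\<delta> t) \<le> 2 * norm (mat 1 :: complex^'n^'n)" using 1 2 by (simp add: mult.assoc)
    hence "norm (\<delta> t) * (norm (\<gamma> t - mat 1) * K) \<le>
        2 * norm (mat 1 :: complex^'n^'n) * (norm (\<gamma> t - mat 1) * K)"
      using K by (intro mult_right_mono) auto
    thus ?case using 2 by (simp add: mult_ac)
  qed
  moreover have "((\<lambda>t. 2 * norm (mat 1 :: complex^'n^'n) * K * norm (\<gamma> t - mat 1)) \<longlongrightarrow> 0) (at 0)"
    using \<gamma>lim by (auto intro!: tendsto_eq_intros)
  ultimately have "((\<lambda>t. \<delta> t - mat 1) \<longlongrightarrow> 0) (at 0)" by (rule Lim_null_comparison)
  hence \<delta>lim: "(\<delta> \<longlongrightarrow> mat 1) (at 0)" by (simp add: LIM_zero_iff)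
  have "((\<lambda>t. (\<gamma> t - mat 1) /\<^sub>R t) \<longlongrightarrow> X) (at 0)"
    using \<gamma>(1,2) unfolding has_vector_derivative_iff_limit by simp
  hence "((\<lambda>t. - (\<delta> t ** ((\<gamma> t - mat 1) /\<^sub>R t))) \<longlongrightarrow> - (mat 1 ** X)) (at 0)"
    by (intro tendsto_minus bounded_bilinear.tendsto[OF bounded_bilinear_matrix_mult] \<delta>lim)
  moreover have "- (\<delta> t ** ((\<gamma> t - mat 1) /\<^sub>R t)) = (\<delta> t - mat 1) /\<^sub>R t" for t
    by (simp only: diff bounded_bilinear.scaleR_right[OF bounded_bilinear_matrix_mult] scaleR_minus_right)
  ultimately have "((\<lambda>t. (\<delta> t - mat 1) /\<^sub>R t) \<longlongrightarrow> - X) (at 0)"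
    by simp
  thus ?thesis unfolding has_vector_derivative_iff_limit \<delta>_def[symmetric] by (simp add: \<delta>0)
qed

lemma scaleR_eq_cscale: "r *\<^sub>R X = cscale (of_real r) X"
  by (simp add: cscale_def vec_eq_iff complex_eq_iff)

lemma cscale_nth [simp]: "cscale a X $ i $ j = a * X $ i $ j"
  by (simp add: cscale_def)

lemma cscale_expand: "cscale a X = Re a *\<^sub>R X + Im a *\<^sub>R cscale \<i> X"
  by (simp add: vec_eq_iff complex_eq_iff)

text \<open>The Hermitian product $\mathrm{tr}(XY^*)$, complex-linear in the first argument.\<close>

definition hermitian_inner :: "complex^'n^'n \<Rightarrow> complex^'n^'n \<Rightarrow> complex" where
  "hermitian_inner X Y = (\<Sum>i\<in>UNIV. \<Sum>j\<in>UNIV. X $ i $ j * cnj (Y $ i $ j))"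

lemma hermitian_inner_add: "hermitian_inner (X + Y) Z = hermitian_inner X Z + hermitian_inner Y Z"
  by (simp add: hermitian_inner_def distrib_right sum.distrib)

lemma hermitian_inner_cscale: "hermitian_inner (cscale a X) Y = a * hermitian_inner X Y"
  by (simp add: hermitian_inner_def sum_distrib_left mult.assoc)

lemma hermitian_inner_scaleR: "hermitian_inner (r *\<^sub>R X) Y = of_real r * hermitian_inner X Y"
  by (simp only: scaleR_eq_cscale hermitian_inner_cscale)

lemma hermitian_inner_eq:
  "hermitian_inner X Y = of_real (X \<bullet> Y) - \<i> * of_real (cscale \<i> X \<bullet> Y)"
proof -
  have 1: "X \<bullet> Y = Re (hermitian_inner X Y)" by (simp only: inner_matrix hermitian_inner_def)
  have "cscale \<i> X \<bullet> Y = Re (hermitian_inner (cscale \<i> X) Y)" by (simp only: inner_matrix hermitian_inner_def)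
  hence 2: "cscale \<i> X \<bullet> Y = - Im (hermitian_inner X Y)" by (simp add: hermitian_inner_cscale)
  show ?thesis unfolding 1 2 by (simp add: complex_eq_iff)
qed

text \<open>A complex-linear functional on a complex subspace is a combination of Hermitian products
  with the members of a real orthonormal basis.\<close>

lemma complex_linear_functional_expand:
  fixes V :: "(complex^'n^'n) set"
  assumes C: "orthonormal_basis_of V C" and V: "subspace V" "\<And>X. X \<in> V \<Longrightarrow> cscale \<i> X \<in> V"
    and f: "\<And>s X Y. X \<in> V \<Longrightarrow> Y \<in> V \<Longrightarrow> f (cscale s X + Y) = s * f X + f Y"
    and X: "X \<in> V"
  shows "f X = (\<Sum>b\<in>C. f b * hermitian_inner X b) / 2"
proof -
  have V0: "0 \<in> V" using V(1) by (rule subspace_0)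
  have cs0: "cscale s 0 = (0::complex^'n^'n)" for s by (simp add: vec_eq_iff)
  have cs1: "cscale 1 Y = Y" for Y :: "complex^'n^'n" by (simp add: vec_eq_iff)
  have f0: "f 0 = 0"
    using f[OF V0 V0, of 1] unfolding cs1 by simp
  have fs: "f (cscale s Y) = s * f Y" if "Y \<in> V" for s Y
    using f[OF that V0, of s] f0 by simp
  have fsum: "f (\<Sum>b\<in>C'. r b *\<^sub>R b) = (\<Sum>b\<in>C'. of_real (r b) * f b)"
    if "finite C'" "C' \<subseteq> V" for r C'
    using that
  proof (induction C' rule: finite_induct)
    case (insert b C')
    have s: "(\<Sum>b\<in>C'. r b *\<^sub>R b) \<in> V"
      using insert.prems V(1) by (intro subspace_sum subspace_scale) auto
    have "f (\<Sum>b\<in>insert b C'. r b *\<^sub>R b) = f (cscale (of_real (r b)) b + (\<Sum>b\<in>C'. r b *\<^sub>R b))"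
      using insert.hyps by (simp add: scaleR_eq_cscale[of "r b" b])
    also have "\<dots> = of_real (r b) * f b + f (\<Sum>b\<in>C'. r b *\<^sub>R b)"
      using insert.prems s by (intro f) auto
    finally show ?case using insert by simp
  qed (simp add: f0)
  have fin: "finite C" using C by (simp add: orthonormal_basis_of_def)
  have sub: "C \<subseteq> V" using orthonormal_basis_of_subset[OF C] by blast
  have fY: "f Y = (\<Sum>b\<in>C. of_real (Y \<bullet> b) * f b)" if "Y \<in> V" for Y
  proof -
    have "f Y = f (\<Sum>b\<in>C. (Y \<bullet> b) *\<^sub>R b)" using orthonormal_basis_of_expand[OF C that] by simp
    thus ?thesis using fsum[OF fin sub] by simp
  qed
  \<comment> \<open>The real expansions of $f(X)$ and of $f(iX) = i f(X)$ are combined into a complex-linear one,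
    which explains the factor 1/2.\<close>
  have "\<i> * f X = (\<Sum>b\<in>C. of_real (cscale \<i> X \<bullet> b) * f b)"
    using fY[OF V(2)[OF X]] fs[OF X] by simp
  hence "2 * f X = f X - \<i> * (\<Sum>b\<in>C. of_real (cscale \<i> X \<bullet> b) * f b)"
    by (metis (no_types, lifting) add.commute complex_i_mult_minus diff_minus_eq_add mult_2)
  also have "\<dots> = (\<Sum>b\<in>C. f b * hermitian_inner X b)"
    unfolding fY[OF X] hermitian_inner_eq
    by (simp add: sum_distrib_left algebra_simps flip: sum_subtractf)
  finally have double: "2 * f X = (\<Sum>b\<in>C. f b * hermitian_inner X b)" .
  show ?thesis unfolding double[symmetric] by simp
qed

lemma velocity_in_lie_algebra:
  assumes "\<And>t::real. \<gamma> t \<in> G" "\<gamma> 0 = mat 1" "(\<gamma> has_vector_derivative X) (at 0)"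
  shows "X \<in> lie_algebra G"
  using assms unfolding lie_algebra_def by blast

context
  fixes G :: "(complex^'n^'n) set"
  assumes red: "connected_complex_reductive G"
begin

lemma
  shows one_in_group: "mat 1 \<in> G"
    and mult_in_group: "a \<in> G \<Longrightarrow> b \<in> G \<Longrightarrow> a ** b \<in> G"
    and inv_in_group: "a \<in> G \<Longrightarrow> matrix_inv a \<in> G"
    and group_invertible: "a \<in> G \<Longrightarrow> invertible a"
    and group_conj_transpose: "a \<in> G \<Longrightarrow> conj_transpose a \<in> G"
  using red unfolding connected_complex_reductive_def closed_subgroup_def matrix_subgroup_def by blast+

lemma subspace_lie_algebra: "subspace (lie_algebra G)"
  unfolding subspace_def
proof (intro conjI ballI allI)
  show "0 \<in> lie_algebra G"
    by (rule velocity_in_lie_algebra[of "\<lambda>_. mat 1"]) (use one_in_group in auto)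
next
  fix X Y assume X: "X \<in> lie_algebra G" and Y: "Y \<in> lie_algebra G"
  obtain \<gamma> where \<gamma>: "\<And>t::real. \<gamma> t \<in> G" "\<gamma> 0 = mat 1" "(\<gamma> has_vector_derivative X) (at 0)"
    using X unfolding lie_algebra_def by blast
  obtain \<delta> where \<delta>: "\<And>t::real. \<delta> t \<in> G" "\<delta> 0 = mat 1" "(\<delta> has_vector_derivative Y) (at 0)"
    using Y unfolding lie_algebra_def by blast
  have "((\<lambda>t. \<gamma> t ** \<delta> t) has_vector_derivative \<gamma> 0 ** Y + X ** \<delta> 0) (at 0)"
    by (rule bounded_bilinear.has_vector_derivative[OF bounded_bilinear_matrix_mult \<gamma>(3) \<delta>(3)])
  hence "((\<lambda>t. \<gamma> t ** \<delta> t) has_vector_derivative X + Y) (at 0)"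
    using \<gamma>(2) \<delta>(2) by (simp add: add.commute)
  thus "X + Y \<in> lie_algebra G"
    by (rule velocity_in_lie_algebra[rotated 2]) (use \<gamma> \<delta> mult_in_group in auto)
next
  fix r X assume X: "X \<in> lie_algebra G"
  obtain \<gamma> where \<gamma>: "\<And>t::real. \<gamma> t \<in> G" "\<gamma> 0 = mat 1" "(\<gamma> has_vector_derivative X) (at 0)"
    using X unfolding lie_algebra_def by blast
  have "((\<lambda>t. r * t) has_vector_derivative r) (at 0)"
    using has_vector_derivative_mult_right[of "\<lambda>t. t" 1 "at 0" r] by simp
  moreover have "(\<gamma> has_vector_derivative X) (at (r * 0))" using \<gamma>(3) by simp
  ultimately have "((\<gamma> \<circ> (\<lambda>t. r * t)) has_vector_derivative r *\<^sub>R X) (at 0)"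
    by (rule vector_diff_chain_at)
  thus "r *\<^sub>R X \<in> lie_algebra G"
    by (rule velocity_in_lie_algebra[rotated 2]) (use \<gamma> in auto)
qed

lemma lie_algebra_cscale:
  assumes "X \<in> lie_algebra G"
  shows "cscale a X \<in> lie_algebra G"
proof -
  have "cscale \<i> X \<in> lie_algebra G"
    using red assms unfolding connected_complex_reductive_def by blast
  thus ?thesis unfolding cscale_expand[of a]
    using assms subspace_lie_algebra by (intro subspace_add subspace_scale)
qed

lemma lie_algebra_conj_transpose:
  assumes X: "X \<in> lie_algebra G"
  shows "conj_transpose X \<in> lie_algebra G"
proof -
  obtain \<gamma> where \<gamma>: "\<And>t::real. \<gamma> t \<in> G" "\<gamma> 0 = mat 1" "(\<gamma> has_vector_derivative X) (at 0)"
    using X unfolding lie_algebra_def by blast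
  have "bounded_linear (conj_transpose :: complex^'n^'n \<Rightarrow> _)"
    using linear_conj_transpose linear_conv_bounded_linear by blast
  from bounded_linear.has_vector_derivative[OF this \<gamma>(3)]
  have 1: "((\<lambda>t. conj_transpose (\<gamma> t)) has_vector_derivative conj_transpose X) (at 0)" .
  have 2: "conj_transpose (mat 1) = (mat 1 :: complex^'n^'n)" by (simp add: vec_eq_iff mat_def)
  show ?thesis
    by (rule velocity_in_lie_algebra[OF _ _ 1]) (use \<gamma> group_conj_transpose 2 in auto)
qed

lemma lie_algebra_Ad:
  assumes a: "a \<in> G" and X: "X \<in> lie_algebra G"
  shows "Ad a X \<in> lie_algebra G"
proof -
  obtain \<gamma> where \<gamma>: "\<And>t::real. \<gamma> t \<in> G" "\<gamma> 0 = mat 1" "(\<gamma> has_vector_derivative X) (at 0)"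
    using X unfolding lie_algebra_def by blast
  have bl: "bounded_linear (Ad a)"
    unfolding linear_conv_bounded_linear[symmetric]
    by (rule linearI) (simp_all add: Ad_def matrix_mult_simps)
  from bounded_linear.has_vector_derivative[OF bl \<gamma>(3)]
  have 1: "((\<lambda>t. Ad a (\<gamma> t)) has_vector_derivative Ad a X) (at 0)" .
  have 2: "Ad a (mat 1) = mat 1"
    using matrix_inv_inverse(2)[OF group_invertible[OF a]] by (simp add: Ad_def)
  have 3: "Ad a b \<in> G" if "b \<in> G" for b
    unfolding Ad_def using a that by (intro mult_in_group inv_in_group)
  show ?thesis
    by (rule velocity_in_lie_algebra[OF _ _ 1]) (use \<gamma> 2 3 in auto)
qed

lemma Ad_curve_has_vector_derivative:
  assumes \<gamma>: "\<And>t::real. \<gamma> t \<in> G" "\<gamma> 0 = mat 1" "(\<gamma> has_vector_derivative X) (at 0)"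
  shows "((\<lambda>t. Ad (\<gamma> t) Y) has_vector_derivative bracket X Y) (at 0)"
proof -
  have 0: "Ad (mat 1) Y = Y"
  proof -
    have "matrix_inv (mat 1) = (mat 1 :: complex^'n^'n)"
      using matrix_inv_inverse(1)[OF group_invertible[OF one_in_group]] by simp
    thus ?thesis by (simp add: Ad_def)
  qed
  have inv: "((\<lambda>t. matrix_inv (\<gamma> t)) has_vector_derivative - X) (at 0)"
    using matrix_inv_has_vector_derivative[OF \<gamma>(3,2)] \<gamma>(1) group_invertible by blast
  have Y: "((\<lambda>t. \<gamma> t ** Y) has_vector_derivative X ** Y) (at 0)"
    using bounded_bilinear.has_vector_derivative[OF bounded_bilinear_matrix_mult \<gamma>(3) has_vector_derivative_const, of Y]
    by (simp add: matrix_mult_simps)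
  have i0: "matrix_inv (\<gamma> 0) = mat 1"
    using matrix_inv_inverse(1)[OF group_invertible[OF \<gamma>(1)], of 0] \<gamma>(2) by simp
  from bounded_bilinear.has_vector_derivative[OF bounded_bilinear_matrix_mult Y inv]
  have "((\<lambda>t. (\<gamma> t ** Y) ** matrix_inv (\<gamma> t)) has_vector_derivative
      (\<gamma> 0 ** Y) ** (- X) + (X ** Y) ** matrix_inv (\<gamma> 0)) (at 0)" .
  thus ?thesis unfolding Ad_def bracket_def i0 using \<gamma>(2) by (simp add: matrix_mult_simps)
qed

lemma lie_algebra_bracket:
  assumes X: "X \<in> lie_algebra G" and Y: "Y \<in> lie_algebra G"
  shows "bracket X Y \<in> lie_algebra G"
proof -
  obtain \<gamma> where \<gamma>: "\<And>t::real. \<gamma> t \<in> G" "\<gamma> 0 = mat 1" "(\<gamma> has_vector_derivative X) (at 0)"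
    using X unfolding lie_algebra_def by blast
  show ?thesis
    by (rule has_vector_derivative_in_subspace[OF Ad_curve_has_vector_derivative[OF \<gamma>] subspace_lie_algebra])
      (use lie_algebra_Ad[OF \<gamma>(1) Y] in auto)
qed

lemma lie_derived_subset: "lie_derived (lie_algebra G) \<subseteq> lie_algebra G"
  unfolding lie_derived_def
  by (rule span_minimal[OF _ subspace_lie_algebra]) (use lie_algebra_bracket in auto)

lemma subspace_lie_derived: "subspace (lie_derived L)"
  unfolding lie_derived_def by (rule subspace_span)

lemma bracket_in_lie_derived: "X \<in> L \<Longrightarrow> Y \<in> L \<Longrightarrow> bracket X Y \<in> lie_derived L"
  unfolding lie_derived_def by (intro span_base) blast

text \<open>The centre is orthogonal to the derived algebra, because the Lie algebra is stable under
  conjugate transposition.\<close>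

lemma central_in_derived_eq_0:
  assumes X: "X \<in> lie_derived (lie_algebra G)" and central: "\<And>Y. Y \<in> lie_algebra G \<Longrightarrow> bracket X Y = 0"
  shows "X = 0"
proof -
  have "X \<bullet> W = 0" if "W \<in> lie_derived (lie_algebra G)" for W
    using that unfolding lie_derived_def
  proof (induction rule: span_induct_alt)
    case (step c W Z)
    then obtain Y1 Y2 where Y: "Y1 \<in> lie_algebra G" "Y2 \<in> lie_algebra G" "W = bracket Y1 Y2" by blast
    have "X \<bullet> W = Y2 \<bullet> bracket (conj_transpose Y1) X"
      unfolding Y(3) by (subst inner_commute) (rule inner_bracket)
    also have "bracket (conj_transpose Y1) X = 0"
      using central[OF lie_algebra_conj_transpose[OF Y(1)]] bracket_swap[of "conj_transpose Y1" X] by simp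
    finally show ?case using step by (simp add: inner_add_right)
  qed simp
  hence "X \<bullet> X = 0" using X by blast
  thus ?thesis by simp
qed

text \<open>Let \<open>L\<close> be the Lie algebra. The form $K(X,Y) = \mathrm{tr}_L((\mathrm{ad}\,Y)^*\,\mathrm{ad}\,X)$ is
  positive definite on the derived algebra. Let \<open>W\<close> be the component of \<open>N\<close> orthogonal to
  $[N,L]$ for \<open>K\<close>. By invariance of \<open>K\<close>, $[N^*,W]$ is orthogonal to \<open>L\<close>, hence zero, so $W^*$
  commutes with \<open>N\<close> and $K(N,W)$ is the trace of the nilpotent operator
  $\mathrm{ad}\,W^*\,\mathrm{ad}\,N$. Thus $K(W,W) = K(N,W) = 0$ and $N \in [N,L]$.\<close>

lemma nilpotent_in_range_bracket:
  assumes N: "N \<in> lie_derived (lie_algebra G)"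
    and nil: "\<And>Y. Y \<in> lie_derived (lie_algebra G) \<Longrightarrow> (bracket N ^^ k) Y = 0"
  shows "\<exists>X\<in>lie_algebra G. N = bracket N X"
proof -
  let ?L = "lie_algebra G" and ?D = "lie_derived (lie_algebra G)"
  have subL: "subspace ?L" by (rule subspace_lie_algebra)
  have NL: "N \<in> ?L" using N lie_derived_subset by blast
  obtain C where C: "orthonormal_basis_of ?L C" using orthonormal_basis_of_exists[OF subL] .
  define K where "K = (\<lambda>X Y. \<Sum>b\<in>C. bracket X b \<bullet> bracket Y b)"
  have Kadd: "K (X + X') Y = K X Y + K X' Y" and Kscale: "K (r *\<^sub>R X) Y = r * K X Y" for X X' Y r
    by (simp_all add: K_def linear_add[OF linear_bracket_left] linear_scale[OF linear_bracket_left]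
        inner_add_left sum.distrib sum_distrib_left)
  have Klin: "linear (\<lambda>X. K X Y)" for Y by (rule linearI) (simp_all add: Kadd Kscale)
  have Ksym: "K X Y = K Y X" for X Y by (simp add: K_def inner_commute)
  have Kpsd: "0 \<le> K X X" for X unfolding K_def by (intro sum_nonneg) simp
  have Ktr: "K X Y = (\<Sum>b\<in>C. b \<bullet> bracket (conj_transpose Y) (bracket X b))" for X Y
    unfolding K_def
  proof (intro sum.cong refl)
    fix b
    have "bracket X b \<bullet> bracket Y b = bracket Y b \<bullet> bracket X b" by (rule inner_commute)
    also have "\<dots> = b \<bullet> bracket (conj_transpose Y) (bracket X b)" by (rule inner_bracket)
    finally show "bracket X b \<bullet> bracket Y b = b \<bullet> bracket (conj_transpose Y) (bracket X b)" .
  qed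
  have Kdef: "X = 0" if X: "X \<in> ?D" and z: "K X X = 0" for X
  proof (rule central_in_derived_eq_0[OF X])
    fix Y assume Y: "Y \<in> ?L"
    have fin: "finite C" using C by (simp add: orthonormal_basis_of_def)
    have "bracket X b = 0" if "b \<in> C" for b
      using z that unfolding K_def by (subst (asm) sum_nonneg_eq_0_iff[OF fin]) auto
    moreover have "Y \<in> span C" using Y C by (simp add: orthonormal_basis_of_def)
    ultimately show "bracket X Y = 0" using linear_eq_0_on_span[OF linear_bracket] by blast
  qed
  have adL: "bracket X ` ?L \<subseteq> ?L" if "X \<in> ?L" for X using lie_algebra_bracket[OF that] by blast
  have Kinv: "K (bracket N X) Y = K X (bracket (conj_transpose N) Y)" if X: "X \<in> ?L" and Y: "Y \<in> ?L" for X Y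
  proof -
    let ?Y = "conj_transpose Y"
    have YL: "?Y \<in> ?L" by (rule lie_algebra_conj_transpose[OF Y])
    have cyc: "(\<Sum>b\<in>C. b \<bullet> bracket ?Y (bracket X (bracket N b))) = (\<Sum>b\<in>C. b \<bullet> bracket N (bracket ?Y (bracket X b)))"
    proof (rule trace_cyclic[OF C C, of "\<lambda>v. bracket ?Y (bracket X v)" "bracket N"])
      show "linear (\<lambda>v. bracket ?Y (bracket X v))"
        using linear_compose[OF linear_bracket linear_bracket] by (simp add: o_def)
      show "(\<lambda>v. bracket ?Y (bracket X v)) ` ?L \<subseteq> ?L" using adL[OF YL] adL[OF X] by blast
    qed (use linear_bracket adL[OF NL] in auto)
    have "K (bracket N X) Y = (\<Sum>b\<in>C. b \<bullet> bracket ?Y (bracket N (bracket X b))) -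
        (\<Sum>b\<in>C. b \<bullet> bracket ?Y (bracket X (bracket N b)))"
      unfolding Ktr jacobi[of N X] by (simp add: linear_diff[OF linear_bracket] inner_diff_right sum_subtractf)
    also have "\<dots> = (\<Sum>b\<in>C. b \<bullet> bracket (bracket ?Y N) (bracket X b))"
      unfolding cyc jacobi[of ?Y N] by (simp add: inner_diff_right sum_subtractf)
    also have "\<dots> = K X (bracket (conj_transpose N) Y)"
      unfolding Ktr by (simp add: conj_transpose_bracket)
    finally show ?thesis .
  qed
  let ?M = "bracket N ` ?L"
  have subM: "subspace ?M" using linear_subspace_image[OF linear_bracket subL] .
  obtain S where S: "orthonormal_basis_of ?M S" using orthonormal_basis_of_exists[OF subM] .
  hence S': "finite S" "span S = ?M" by (auto simp: orthonormal_basis_of_def)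
  obtain m where m: "m \<in> ?M" "\<And>y. y \<in> ?M \<Longrightarrow> K (N - m) y = 0"
    using semidefinite_projection[where K = K, OF Klin Ksym Kpsd S'(1), of N] unfolding S'(2) by blast
  define W where "W = N - m"
  have MD: "?M \<subseteq> ?D" using bracket_in_lie_derived[OF NL] by blast
  have WD: "W \<in> ?D" unfolding W_def using N m(1) MD subspace_lie_derived by (intro subspace_diff) auto
  have WL: "W \<in> ?L" using WD lie_derived_subset by blast
  have N'L: "conj_transpose N \<in> ?L" by (rule lie_algebra_conj_transpose[OF NL])
  have NW: "bracket (conj_transpose N) W = 0"
  proof (rule Kdef)
    show "bracket (conj_transpose N) W \<in> ?D" by (rule bracket_in_lie_derived[OF N'L WL])
    let ?X = "bracket (conj_transpose N) W"
    have XL: "?X \<in> ?L" by (rule lie_algebra_bracket[OF N'L WL])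
    have "K ?X ?X = K (bracket N ?X) W" using Kinv[OF XL WL] by simp
    also have "\<dots> = K W (bracket N ?X)" by (rule Ksym)
    also have "\<dots> = 0"
    proof -
      have "bracket N ?X \<in> ?M" using XL by blast
      from m(2)[OF this] show ?thesis by (simp only: W_def[symmetric])
    qed
    finally show "K ?X ?X = 0" .
  qed
  let ?Z = "conj_transpose W"
  have ZL: "?Z \<in> ?L" by (rule lie_algebra_conj_transpose[OF WL])
  have ZN: "bracket ?Z N = 0"
    using arg_cong[OF NW, of conj_transpose] linear_0[OF linear_conj_transpose]
    by (simp add: conj_transpose_bracket)
  have comm: "bracket ?Z (bracket N v) = bracket N (bracket ?Z v)" for v
    using jacobi[of ?Z N v] ZN linear_0[OF linear_bracket_left, of v] by simp
  have comm_pow: "(bracket ?Z ^^ j) (bracket N v) = bracket N ((bracket ?Z ^^ j) v)" for j v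
    by (induction j) (simp_all add: comm)
  have pow: "((\<lambda>v. bracket ?Z (bracket N v)) ^^ j) v = (bracket ?Z ^^ j) ((bracket N ^^ j) v)" for j v
    by (induction j) (simp_all add: comm comm_pow)
  have lin_pow: "(bracket ?Z ^^ j) 0 = 0" for j
    by (induction j) (simp_all add: linear_0[OF linear_bracket])
  have "K N W = (\<Sum>b\<in>C. b \<bullet> bracket ?Z (bracket N b))" by (rule Ktr)
  also have "\<dots> = 0"
  proof (rule trace_nilpotent[OF _ subL _ _ C, where k = "Suc k"])
    show "linear (\<lambda>v. bracket ?Z (bracket N v))"
      using linear_compose[OF linear_bracket linear_bracket] by (simp add: o_def)
    show "(\<lambda>v. bracket ?Z (bracket N v)) ` ?L \<subseteq> ?L" using adL[OF ZL] adL[OF NL] by blast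
    fix v assume "v \<in> ?L"
    hence "(bracket N ^^ k) (bracket N v) = 0" by (intro nil bracket_in_lie_derived[OF NL])
    hence "(bracket N ^^ Suc k) v = 0" unfolding funpow_Suc_right by simp
    thus "((\<lambda>v. bracket ?Z (bracket N v)) ^^ Suc k) v = 0" unfolding pow by (simp only: lin_pow)
  qed
  finally have "K N W = 0" .
  moreover have "K W m = 0" unfolding W_def by (rule m(2)[OF m(1)])
  moreover have "N = W + m" by (simp add: W_def)
  ultimately have "K W W = 0" using Kadd[of W m W] Ksym[of m W] by simp
  hence "W = 0" using Kdef[OF WD] by blast
  hence "N \<in> ?M" using m(1) by (simp add: W_def)
  thus ?thesis by blast
qed

section \<open>Invariant bilinear forms\<close>

context
  fixes B :: "complex^'n^'n \<Rightarrow> complex^'n^'n \<Rightarrow> complex"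
  assumes B: "invariant_form G B"
begin

text \<open>On the Lie algebra, the form is a complex-bilinear polynomial in the matrix entries. Nothing is
  known about its values elsewhere.\<close>

lemma invariant_form_expand:
  "\<exists>C \<beta>. finite C \<and> (\<forall>X\<in>lie_algebra G. \<forall>Y\<in>lie_algebra G.
     B X Y = (\<Sum>b\<in>C. \<Sum>b'\<in>C. \<beta> b b' * (hermitian_inner X b * hermitian_inner Y b')))"
proof -
  let ?L = "lie_algebra G"
  obtain C where C: "orthonormal_basis_of ?L C" using orthonormal_basis_of_exists[OF subspace_lie_algebra] .
  have lin: "B (cscale s X + Y) Z = s * B X Z + B Y Z" if "X \<in> ?L" "Y \<in> ?L" "Z \<in> ?L" for s X Y Z
    using B that unfolding invariant_form_def by blast
  have sym: "B X Y = B Y X" if "X \<in> ?L" "Y \<in> ?L" for X Y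
    using B that unfolding invariant_form_def by blast
  have ex: "B X Y = (\<Sum>b\<in>C. B b Y * hermitian_inner X b) / 2" if "X \<in> ?L" "Y \<in> ?L" for X Y
    using that lin lie_algebra_cscale
    by (intro complex_linear_functional_expand[OF C subspace_lie_algebra, of "\<lambda>X. B X Y"]) auto
  have CL: "b \<in> ?L" if "b \<in> C" for b using orthonormal_basis_of_subset[OF C that] .
  show ?thesis
  proof (rule exI[of _ C], rule exI[of _ "\<lambda>b b'. B b b' / 4"], intro conjI ballI)
    show "finite C" using C by (simp add: orthonormal_basis_of_def)
    fix X Y assume X: "X \<in> ?L" and Y: "Y \<in> ?L"
    have bY: "B b Y = (\<Sum>b'\<in>C. B b b' * hermitian_inner Y b') / 2" if b: "b \<in> C" for b
    proof -
      have "B b Y = (\<Sum>b'\<in>C. B b' b * hermitian_inner Y b') / 2"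
        using ex[OF Y CL[OF b]] sym[OF CL[OF b] Y] by simp
      also have "(\<Sum>b'\<in>C. B b' b * hermitian_inner Y b') = (\<Sum>b'\<in>C. B b b' * hermitian_inner Y b')"
        using sym CL b by (intro sum.cong refl) metis
      finally show ?thesis .
    qed
    have "(\<Sum>b\<in>C. B b Y * hermitian_inner X b) =
        (\<Sum>b\<in>C. (\<Sum>b'\<in>C. B b b' * hermitian_inner Y b') / 2 * hermitian_inner X b)"
      by (intro sum.cong refl) (simp only: bY)
    hence "B X Y = (\<Sum>b\<in>C. (\<Sum>b'\<in>C. B b b' * hermitian_inner Y b') / 2 * hermitian_inner X b) / 2"
      using ex[OF X Y] by (simp only:)
    also have "\<dots> = (\<Sum>b\<in>C. \<Sum>b'\<in>C. B b b' / 4 * (hermitian_inner X b * hermitian_inner Y b'))"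
      unfolding sum_divide_distrib sum_distrib_right by (intro sum.cong refl) simp
    finally show "B X Y = (\<Sum>b\<in>C. \<Sum>b'\<in>C. B b b' / 4 * (hermitian_inner X b * hermitian_inner Y b'))" .
  qed
qed

lemma invariant_form_nilpotent:
  assumes N: "nilpotent_element (lie_algebra G) N"
  shows "B N N = 0"
proof -
  let ?L = "lie_algebra G"
  obtain k where ND: "N \<in> lie_derived ?L" and nil': "\<forall>Y\<in>lie_derived ?L. (bracket N ^^ k) Y = 0"
    using N unfolding nilpotent_element_def by auto
  have nil: "(bracket N ^^ k) Y = 0" if "Y \<in> lie_derived ?L" for Y
    using nil' that by (rule bspec)
  have NL: "N \<in> ?L" using ND lie_derived_subset by blast
  obtain X where X: "X \<in> ?L" "N = bracket N X" using nilpotent_in_range_bracket[OF ND nil] by blast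
  obtain C \<beta> where C: "finite C" "\<forall>X\<in>?L. \<forall>Y\<in>?L.
       B X Y = (\<Sum>b\<in>C. \<Sum>b'\<in>C. \<beta> b b' * (hermitian_inner X b * hermitian_inner Y b'))"
    using invariant_form_expand by blast
  define F where "F = (\<lambda>X Y. \<Sum>b\<in>C. \<Sum>b'\<in>C. \<beta> b b' * (hermitian_inner X b * hermitian_inner Y b'))"
  have "F (X + X') Y = F X Y + F X' Y" "F Y (X + X') = F Y X + F Y X'" for X X' Y
    unfolding F_def by (simp_all only: hermitian_inner_add distrib_left distrib_right sum.distrib)
  moreover have "F (r *\<^sub>R X) Y = r *\<^sub>R F X Y" "F Y (r *\<^sub>R X) = r *\<^sub>R F Y X" for r X Y
    unfolding F_def scaleR_sum_right hermitian_inner_scaleR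
    by (intro sum.cong refl; simp add: scaleR_conv_of_real)+
  ultimately have "bilinear F"
    unfolding bilinear_def by (intro conjI allI linearI)
  hence F: "bounded_bilinear F" using bilinear_conv_bounded_bilinear by blast
  obtain \<gamma> where \<gamma>: "\<And>t::real. \<gamma> t \<in> G" "\<gamma> 0 = mat 1" "(\<gamma> has_vector_derivative X) (at 0)"
    using X(1) unfolding lie_algebra_def by blast
  \<comment> \<open>The value of \<open>B\<close> at the curve is constant, and its derivative at 0 is
    $B(N,[X,N]) + B([X,N],N) = -2B(N,N)$. The bilinear extension \<open>F\<close> of \<open>B\<close> is what is
    differentiated.\<close>
  note d = Ad_curve_has_vector_derivative[OF \<gamma>, of N]
  have Ad0: "Ad (\<gamma> 0) N = N"
    using matrix_inv_inverse(1)[OF group_invertible[OF one_in_group]] \<gamma>(2) by (simp add: Ad_def)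
  have XN: "bracket X N = - N" using X(2) bracket_swap[of X N] by simp
  have "F (Ad (\<gamma> t) N) (Ad (\<gamma> t) N) = B N N" for t
  proof -
    have "F (Ad (\<gamma> t) N) (Ad (\<gamma> t) N) = B (Ad (\<gamma> t) N) (Ad (\<gamma> t) N)"
      unfolding F_def by (rule C(2)[rule_format, OF lie_algebra_Ad[OF \<gamma>(1) NL] lie_algebra_Ad[OF \<gamma>(1) NL], symmetric])
    also have "\<dots> = B N N" using B \<gamma>(1) NL unfolding invariant_form_def by blast
    finally show ?thesis .
  qed
  hence "((\<lambda>t. F (Ad (\<gamma> t) N) (Ad (\<gamma> t) N)) has_vector_derivative 0) (at 0)"
    by simp
  moreover have "((\<lambda>t. F (Ad (\<gamma> t) N) (Ad (\<gamma> t) N)) has_vector_derivative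
      F (Ad (\<gamma> 0) N) (bracket X N) + F (bracket X N) (Ad (\<gamma> 0) N)) (at 0)"
    by (rule bounded_bilinear.has_vector_derivative[OF F d d])
  ultimately have "0 = F (Ad (\<gamma> 0) N) (bracket X N) + F (bracket X N) (Ad (\<gamma> 0) N)"
    by (rule vector_derivative_unique_at)
  hence "- 2 * F N N = 0"
    unfolding Ad0 XN by (simp add: bounded_bilinear.minus_left[OF F] bounded_bilinear.minus_right[OF F])
  moreover have "B N N = F N N" unfolding F_def by (rule C(2)[rule_format, OF NL NL])
  ultimately show ?thesis by simp
qed

end

end

section \<open>The Serre pairing in Cech-Dolbeault form\<close>

text \<open>In every coordinate the field has at most a simple pole at each point of \<open>D\<close>; the value of \<open>g\<close>
  at the point is the coefficient of the pole.\<close>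

definition simple_pole_field :: "'c::topological_space chart set \<Rightarrow> 'c set \<Rightarrow> 'c field \<Rightarrow> bool" where
  "simple_pole_field A D q \<longleftrightarrow> (\<forall>c\<in>coords A. \<forall>x\<in>D \<inter> fst c. \<exists>\<rho>>0. \<exists>g.
     g holomorphic_on ball (snd c x) \<rho> \<and>
     (\<forall>z\<in>ball (snd c x) \<rho> - {snd c x}. local_rep c (q c) z = g z / (z - snd c x)))"

text \<open>Continuous off \<open>D\<close> and bounded near the points of \<open>D\<close>.\<close>

definition bounded_near :: "'c::topological_space chart set \<Rightarrow> 'c set \<Rightarrow> 'c field \<Rightarrow> bool" where
  "bounded_near A D w \<longleftrightarrow> (\<forall>c\<in>coords A. continuous_on (fst c \<inter> - D) (w c) \<and>
     (\<forall>x\<in>D \<inter> fst c. \<exists>\<rho>>0. \<exists>K. \<forall>z\<in>(ball (snd c x) \<rho> - {snd c x}) \<inter> snd c ` fst c.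
        norm (local_rep c (w c) z) \<le> K))"

lemma tensor_field_add:
  assumes f: "tensor_field A a b S f" and h: "tensor_field A a b S h"
  shows "tensor_field A a b S (\<lambda>c x. f c x + h c x)"
  unfolding tensor_field_def
proof (intro ballI)
  fix c d x assume *: "c \<in> coords A" "d \<in> coords A" "x \<in> fst c \<inter> fst d \<inter> S"
  let ?t = "deriv (transition c d) (snd c x)"
  have 1: "f c x = f d x * ?t powi a * cnj ?t powi b" using f * unfolding tensor_field_def by blast
  have 2: "h c x = h d x * ?t powi a * cnj ?t powi b" using h * unfolding tensor_field_def by blast
  show "f c x + h c x = (f d x + h d x) * ?t powi a * cnj ?t powi b"
    unfolding 1 2 by (simp only: distrib_right)
qed

lemma tensor_field_diff:
  assumes f: "tensor_field A a b S f" and h: "tensor_field A a b S h"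
  shows "tensor_field A a b S (\<lambda>c x. f c x - h c x)"
  using tensor_field_add[OF f tensor_field_scalar_mult[OF h, of "\<lambda>_. - 1"]] by simp

lemma tensor_field_subset: "tensor_field A a b S f \<Longrightarrow> S' \<subseteq> S \<Longrightarrow> tensor_field A a b S' f"
  unfolding tensor_field_def by blast

lemma C1_field_subset: "C1_field A S f \<Longrightarrow> S' \<subseteq> S \<Longrightarrow> C1_field A S' f"
  unfolding C1_field_def by (meson C1_on_subset Int_mono image_mono order_refl)

lemma C1_field_add: "C1_field A S f \<Longrightarrow> C1_field A S h \<Longrightarrow> C1_field A S (\<lambda>c x. f c x + h c x)"
  unfolding C1_field_def using C1_on_add by (fastforce simp: local_rep_def o_def)

lemma C1_field_diff: "C1_field A S f \<Longrightarrow> C1_field A S h \<Longrightarrow> C1_field A S (\<lambda>c x. f c x - h c x)"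
  unfolding C1_field_def using C1_on_diff by (fastforce simp: local_rep_def o_def)

lemma C1_field_differentiable:
  assumes "C1_field A S f" "c \<in> coords A" "x \<in> fst c" "x \<in> S"
  shows "local_rep c (f c) differentiable (at (snd c x))"
  using assms unfolding C1_field_def C1_on_def by blast

lemma dbar_add:
  assumes "C1_field A S f" "C1_field A S h" "c \<in> coords A" "x \<in> fst c" "x \<in> S"
  shows "dbar (\<lambda>c x. f c x + h c x) c x = dbar f c x + dbar h c x"
  using wirtinger_dbar_add[OF C1_field_differentiable[OF assms(1,3-5)] C1_field_differentiable[OF assms(2-5)]]
  by (simp add: dbar_def local_rep_def o_def)

lemma dbar_diff:
  assumes "C1_field A S f" "C1_field A S h" "c \<in> coords A" "x \<in> fst c" "x \<in> S"
  shows "dbar (\<lambda>c x. f c x - h c x) c x = dbar f c x - dbar h c x"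
  using wirtinger_dbar_diff[OF C1_field_differentiable[OF assms(1,3-5)] C1_field_differentiable[OF assms(2-5)]]
  by (simp add: dbar_def local_rep_def o_def)

context
  fixes A :: "'c::t2_space chart set"
  assumes atlas: "holomorphic_atlas A"
begin

lemma tensor_field_fmult:
  assumes f: "tensor_field A a b S f" and h: "tensor_field A a' b' S h"
  shows "tensor_field A (a + a') (b + b') S (fmult f h)"
  unfolding tensor_field_def
proof (intro ballI)
  fix c d x assume c: "c \<in> coords A" and d: "d \<in> coords A" and x: "x \<in> fst c \<inter> fst d \<inter> S"
  let ?t = "deriv (transition c d) (snd c x)"
  have nz: "?t \<noteq> 0" "cnj ?t \<noteq> 0" using deriv_transition_nonzero[OF atlas c d] x by auto
  have 1: "f c x = f d x * ?t powi a * cnj ?t powi b" using f c d x unfolding tensor_field_def by blast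
  have 2: "h c x = h d x * ?t powi a' * cnj ?t powi b'" using h c d x unfolding tensor_field_def by blast
  show "fmult f h c x = fmult f h d x * ?t powi (a + a') * cnj ?t powi (b + b')"
    unfolding fmult_def 1 2 power_int_add[OF disjI1[OF nz(1)]] power_int_add[OF disjI1[OF nz(2)]]
    by (simp only: mult_ac)
qed

lemma smooth_field_imp_C1_field:
  assumes "smooth_field A S f" "open S"
  shows "C1_field A S f"
  unfolding C1_field_def
proof
  fix c assume c: "c \<in> coords A"
  have "complex_chart c" using c coords_complex_chart by blast
  hence "open (snd c ` (fst c \<inter> S))" using assms(2) by (rule open_chart_image)
  moreover have "smooth_fun_on (snd c ` (fst c \<inter> S)) (local_rep c (f c))"
    using assms(1) c unfolding smooth_field_def by blast
  ultimately show "C1_on (snd c ` (fst c \<inter> S)) (local_rep c (f c))"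
    by (rule smooth_fun_on_imp_C1_on[rotated])
qed

lemma C1_field_continuous_on:
  assumes "C1_field A S f" "c \<in> coords A"
  shows "continuous_on (fst c \<inter> S) (f c)"
proof -
  have "complex_chart c" using assms(2) coords_complex_chart by blast
  thus ?thesis
    using assms C1_on_imp_continuous_on unfolding C1_field_def
    by (intro continuous_on_of_local_rep) auto
qed

text \<open>A coordinate disc inside a given neighbourhood of \<open>x\<close>, with no point of \<open>D\<close> except possibly its
  centre.\<close>

lemma open_punctured_chart_image:
  assumes c: "c \<in> coords A" and D: "finite D" and x: "x \<in> fst c" and V: "open V" "x \<in> V"
  obtains \<rho> where "\<rho> > 0" "ball (snd c x) \<rho> - {snd c x} \<subseteq> snd c ` (fst c \<inter> (V \<inter> - D))"
    "ball (snd c x) \<rho> \<subseteq> snd c ` (fst c \<inter> V)"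
proof -
  have cc: "complex_chart c" using c coords_complex_chart by blast
  have "closed (D - {x})" using D by (intro finite_imp_closed) auto
  hence "open (snd c ` (fst c \<inter> (V \<inter> - (D - {x}))))" using cc V
    by (intro open_chart_image open_Int open_Compl)
  moreover have "snd c x \<in> snd c ` (fst c \<inter> (V \<inter> - (D - {x})))" using x V by blast
  ultimately obtain \<rho> where \<rho>: "\<rho> > 0" "ball (snd c x) \<rho> \<subseteq> snd c ` (fst c \<inter> (V \<inter> - (D - {x})))"
    using openE by blast
  thus thesis by (intro that[of \<rho>]) blast+
qed

lemma mild_singularities_fmult:
  assumes D: "finite D" and q: "holomorphic_field A (- D) q" "simple_pole_field A D q"
    and w: "bounded_near A D w"
  shows "mild_singularities A D (fmult q w)"
  unfolding mild_singularities_def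
proof (intro ballI conjI)
  fix c assume c: "c \<in> coords A"
  have cc: "complex_chart c" using c coords_complex_chart by blast
  have "continuous_on (fst c \<inter> - D) (q c)"
    using q(1) c cc holomorphic_on_imp_continuous_on unfolding holomorphic_field_def
    by (intro continuous_on_of_local_rep) auto
  moreover have "continuous_on (fst c \<inter> - D) (w c)" using w c unfolding bounded_near_def by blast
  ultimately show "continuous_on (fst c \<inter> - D) (fmult q w c)"
    unfolding fmult_def by (intro continuous_intros)
  fix x assume x: "x \<in> D \<inter> fst c"
  let ?z = "snd c x"
  obtain \<rho>1 g where \<rho>1: "\<rho>1 > 0" "g holomorphic_on ball ?z \<rho>1"
    "\<forall>z\<in>ball ?z \<rho>1 - {?z}. local_rep c (q c) z = g z / (z - ?z)"
    using q(2) c x unfolding simple_pole_field_def by blast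
  obtain \<rho>2 K where \<rho>2: "\<rho>2 > 0"
    "\<forall>z\<in>(ball ?z \<rho>2 - {?z}) \<inter> snd c ` fst c. norm (local_rep c (w c) z) \<le> K"
    using w c x unfolding bounded_near_def by blast
  define \<rho> where "\<rho> = min (\<rho>1 / 2) \<rho>2"
  have "compact (g ` cball ?z (\<rho>1 / 2))"
    using \<rho>1 by (intro compact_continuous_image continuous_on_subset[OF holomorphic_on_imp_continuous_on[OF \<rho>1(2)]]) auto
  then obtain M where M: "M > 0" "\<And>z. z \<in> cball ?z (\<rho>1 / 2) \<Longrightarrow> norm (g z) \<le> M"
    using compact_imp_bounded bounded_pos by (metis imageI)
  have "\<forall>z\<in>(ball ?z \<rho> - {?z}) \<inter> snd c ` fst c. norm (local_rep c (fmult q w c) z) \<le> M * K / dist z ?z"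
  proof
    fix z assume z: "z \<in> (ball ?z \<rho> - {?z}) \<inter> snd c ` fst c"
    have z1: "z \<in> ball ?z \<rho>1 - {?z}" "z \<in> cball ?z (\<rho>1 / 2)" "z \<in> (ball ?z \<rho>2 - {?z}) \<inter> snd c ` fst c"
      using z \<rho>1(1) by (auto simp: \<rho>_def)
    have "local_rep c (fmult q w c) z = local_rep c (q c) z * local_rep c (w c) z"
      by (simp add: local_rep_def fmult_def)
    also have "\<dots> = g z / (z - ?z) * local_rep c (w c) z" using \<rho>1(3) z1(1) by simp
    also have "norm \<dots> = norm (g z) * norm (local_rep c (w c) z) / dist z ?z"
      by (simp add: norm_mult norm_divide dist_norm)
    also have "\<dots> \<le> M * K / dist z ?z"
    proof -
      have "norm (local_rep c (w c) z) \<le> K" using \<rho>2(2) z1(3) by blast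
      thus ?thesis using M(1) M(2)[OF z1(2)] by (intro divide_right_mono mult_mono) auto
    qed
    finally show "norm (local_rep c (fmult q w c) z) \<le> M * K / dist z ?z" .
  qed
  moreover have "\<rho> > 0" using \<rho>1 \<rho>2 by (simp add: \<rho>_def)
  ultimately show "\<exists>\<rho>>0. \<exists>K. \<forall>z\<in>(ball ?z \<rho> - {?z}) \<inter> snd c ` fst c.
      norm (local_rep c (fmult q w c) z) \<le> K / dist z ?z" by blast
qed

lemma mild_singularities_cong:
  assumes D: "finite D" and w: "mild_singularities A D w"
    and eq: "\<And>c x. c \<in> coords A \<Longrightarrow> x \<in> fst c \<Longrightarrow> x \<notin> D \<Longrightarrow> w' c x = w c x"
  shows "mild_singularities A D w'"
  unfolding mild_singularities_def
proof (intro ballI conjI)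
  fix c assume c: "c \<in> coords A"
  have cc: "complex_chart c" using c coords_complex_chart by blast
  have "continuous_on (fst c \<inter> - D) (w c)" using w c unfolding mild_singularities_def by blast
  thus "continuous_on (fst c \<inter> - D) (w' c)"
    by (subst continuous_on_cong[OF refl, of _ _ "w c"]) (use eq[OF c] in auto)
  fix x assume x: "x \<in> D \<inter> fst c"
  let ?z = "snd c x"
  obtain \<rho>1 K where \<rho>1: "\<rho>1 > 0"
    "\<forall>z\<in>(ball ?z \<rho>1 - {?z}) \<inter> snd c ` fst c. norm (local_rep c (w c) z) \<le> K / dist z ?z"
    using w c x unfolding mild_singularities_def by blast
  obtain \<rho>2 where \<rho>2: "\<rho>2 > 0" "ball ?z \<rho>2 - {?z} \<subseteq> snd c ` (fst c \<inter> (UNIV \<inter> - D))"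
    using open_punctured_chart_image[OF c D _ open_UNIV, of x] x by blast
  have "\<forall>z\<in>(ball ?z (min \<rho>1 \<rho>2) - {?z}) \<inter> snd c ` fst c. norm (local_rep c (w' c) z) \<le> K / dist z ?z"
  proof
    fix z assume z: "z \<in> (ball ?z (min \<rho>1 \<rho>2) - {?z}) \<inter> snd c ` fst c"
    hence "z \<in> snd c ` (fst c \<inter> (UNIV \<inter> - D))" using \<rho>2(2) by auto
    then obtain y where y: "y \<in> fst c" "y \<notin> D" "z = snd c y" by blast
    have "local_rep c (w' c) z = local_rep c (w c) z" using eq[OF c y(1,2)] y cc by simp
    thus "norm (local_rep c (w' c) z) \<le> K / dist z ?z" using \<rho>1(2) z by auto
  qed
  moreover have "min \<rho>1 \<rho>2 > 0" using \<rho>1 \<rho>2 by simp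
  ultimately show "\<exists>\<rho>>0. \<exists>K. \<forall>z\<in>(ball ?z \<rho> - {?z}) \<inter> snd c ` fst c.
      norm (local_rep c (w' c) z) \<le> K / dist z ?z" by blast
qed

text \<open>The residue of a (1,0)-form with a simple pole, in the form of a limit, does not depend
  on the coordinate.\<close>

lemma residue_limit_invariant:
  assumes D: "finite D" and \<omega>: "tensor_field A 1 0 (- D) \<omega>"
    and c: "c \<in> coords A" "x \<in> fst c" and d: "d \<in> coords A" "x \<in> fst d"
    and lim: "((\<lambda>z. (z - snd d x) * local_rep d (\<omega> d) z) \<longlongrightarrow> L) (at (snd d x))"
  shows "((\<lambda>z. (z - snd c x) * local_rep c (\<omega> c) z) \<longlongrightarrow> L) (at (snd c x))"
proof -
  let ?T = "transition c d" and ?z = "snd c x" and ?w = "snd d x"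
  have cc: "complex_chart c" "complex_chart d" using c d coords_complex_chart by blast+
  have opd: "open (fst d)" using cc by (intro open_chart_domain)
  obtain \<rho> where \<rho>: "\<rho> > 0" "ball ?z \<rho> - {?z} \<subseteq> snd c ` (fst c \<inter> (fst d \<inter> - D))"
    "ball ?z \<rho> \<subseteq> snd c ` (fst c \<inter> fst d)"
    using open_punctured_chart_image[OF c(1) D c(2) opd d(2)] .
  have holo: "?T holomorphic_on ball ?z \<rho>"
    using transition_holomorphic[OF atlas c(1) d(1)] \<rho>(3) by (rule holomorphic_on_subset)
  have inj: "inj_on ?T (ball ?z \<rho>)"
    by (rule inj_on_subset[OF transition_inj_on[OF cc] \<rho>(3)]) auto
  have Tz: "?T ?z = ?w" using cc c by simp
  have z: "?z \<in> ball ?z \<rho>" using \<rho>(1) by simp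
  have nz: "deriv ?T ?z \<noteq> 0" by (rule deriv_transition_nonzero[OF atlas c(1) d(1) c(2) d(2)])
  have ev: "\<forall>\<^sub>F z in at ?z. z \<in> ball ?z \<rho> - {?z}"
    unfolding eventually_at_filter using \<rho>(1) by (intro eventually_mono[OF eventually_nhds_ball]) auto
  have ne: "?T z \<noteq> ?w" if "z \<in> ball ?z \<rho> - {?z}" for z
    using inj_onD[OF inj _ _ z, of z] that Tz by auto
  have "(?T \<longlongrightarrow> ?w) (at ?z)"
    using holomorphic_on_imp_continuous_on[OF holo] z Tz
    by (metis centre_in_ball continuous_on_def open_ball at_within_open)
  hence fl: "filterlim ?T (at ?w) (at ?z)"
    unfolding filterlim_at using ev ne by (auto elim: eventually_mono)
  have 1: "((\<lambda>z. (?T z - ?w) * local_rep d (\<omega> d) (?T z)) \<longlongrightarrow> L) (at ?z)"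
    by (rule filterlim_compose[OF lim fl])
  have "(?T has_field_derivative deriv ?T ?z) (at ?z)"
    using holo z by (intro holomorphic_derivI) auto
  hence 2: "((\<lambda>z. (?T z - ?w) / (z - ?z)) \<longlongrightarrow> deriv ?T ?z) (at ?z)"
    unfolding has_field_derivative_iff Tz .
  have "continuous_on (ball ?z \<rho>) (deriv ?T)"
    using holo by (intro holomorphic_on_imp_continuous_on holomorphic_deriv) auto
  hence 3: "(deriv ?T \<longlongrightarrow> deriv ?T ?z) (at ?z)"
    using z by (metis continuous_on_def open_ball at_within_open)
  \<comment> \<open>The first factor tends to the residue in the chart \<open>d\<close>, the second to 1.\<close>
  have "((\<lambda>z. (?T z - ?w) * local_rep d (\<omega> d) (?T z) * (deriv ?T z / ((?T z - ?w) / (z - ?z)))) \<longlongrightarrow>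
      L * (deriv ?T ?z / deriv ?T ?z)) (at ?z)"
    by (intro tendsto_mult tendsto_divide 1 2 3 nz)
  hence "((\<lambda>z. (?T z - ?w) * local_rep d (\<omega> d) (?T z) * (deriv ?T z / ((?T z - ?w) / (z - ?z)))) \<longlongrightarrow> L) (at ?z)"
    using nz by simp
  moreover have "\<forall>\<^sub>F z in at ?z. (?T z - ?w) * local_rep d (\<omega> d) (?T z) * (deriv ?T z / ((?T z - ?w) / (z - ?z)))
      = (z - ?z) * local_rep c (\<omega> c) z"
    using ev
  proof eventually_elim
    case (elim z)
    then obtain y where y: "y \<in> fst c" "y \<in> fst d" "y \<notin> D" "z = snd c y" using \<rho>(2) by blast
    have "\<omega> c y = \<omega> d y * deriv ?T (snd c y) powi 1 * cnj (deriv ?T (snd c y)) powi 0"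
      using \<omega> c d y unfolding tensor_field_def by blast
    hence "local_rep c (\<omega> c) z = local_rep d (\<omega> d) (?T z) * deriv ?T z" using y cc by simp
    thus ?case using ne[OF elim] elim by simp
  qed
  ultimately show ?thesis by (simp only: tendsto_cong)
qed

text \<open>At a simple pole of \<open>q\<close> the residue of $q\,\xi$ depends only on the value of \<open>\<xi>\<close> at the point.
  For the holomorphic \<open>\<xi>\<close> it is the residue of a meromorphic form, for the merely continuous \<open>\<eta>\<close>
  it is a limit.\<close>

lemma simple_pole_residue:
  assumes q: "simple_pole_field A D q" and x: "x \<in> D" and \<xi>: "local_holomorphic_vector_field A x \<xi>"
    and \<eta>: "continuous_field A UNIV \<eta>" "\<And>c. c \<in> coords A \<Longrightarrow> x \<in> fst c \<Longrightarrow> \<eta> c x = \<xi> c x"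
  obtains d where "d \<in> coords A" "x \<in> fst d"
    "((\<lambda>z. (z - snd d x) * local_rep d (fmult q \<eta> d) z) \<longlongrightarrow> form_residue A x (fmult q \<xi>)) (at (snd d x))"
proof -
  define d where "d = (SOME c. c \<in> coords A \<and> x \<in> fst c \<and> snd c x = 0)"
  have "d \<in> coords A \<and> x \<in> fst d \<and> snd d x = 0"
    unfolding d_def by (rule someI_ex) (use coords_centred[OF atlas, of x] in blast)
  hence d: "d \<in> coords A" "x \<in> fst d" "snd d x = 0" by blast+
  have dd: "complex_chart d" using d coords_complex_chart by blast
  have "x \<in> D \<inter> fst d" using x d by blast
  from q[unfolded simple_pole_field_def, THEN bspec, OF d(1), THEN bspec, OF this, unfolded d(3) diff_zero]
  obtain \<rho> g where \<rho>: "\<rho> > 0" "g holomorphic_on ball 0 \<rho>"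
    "\<forall>z\<in>ball 0 \<rho> - {0}. local_rep d (q d) z = g z / z"
    by blast
  obtain V where V: "open V" "x \<in> V" "holomorphic_field A V \<xi>"
    using \<xi> unfolding local_holomorphic_vector_field_def by blast
  have opV: "open (snd d ` (fst d \<inter> V))" using dd V by (intro open_chart_image)
  have "0 \<in> snd d ` (fst d \<inter> V)" using d V by (intro image_eqI[of _ _ x]) auto
  then obtain \<rho>' where \<rho>': "\<rho>' > 0" "ball 0 \<rho>' \<subseteq> snd d ` (fst d \<inter> V)" using opV openE by blast
  define s where "s = min \<rho> \<rho>'"
  have s: "s > 0" using \<rho> \<rho>' by (simp add: s_def)
  let ?x = "local_rep d (\<xi> d)"
  have "?x holomorphic_on snd d ` (fst d \<inter> V)" using V d unfolding holomorphic_field_def by blast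
  hence "?x holomorphic_on ball 0 s" by (rule holomorphic_on_subset) (use \<rho>' in \<open>auto simp: s_def\<close>)
  moreover have "g holomorphic_on ball 0 s"
    by (rule holomorphic_on_subset[OF \<rho>(2)]) (auto simp: s_def)
  ultimately have holo: "(\<lambda>z. g z * ?x z) holomorphic_on ball 0 s" by (intro holomorphic_intros)
  have ev: "\<forall>\<^sub>F z in at 0. z \<in> ball 0 s - {0::complex}"
    unfolding eventually_at_filter using s by (intro eventually_mono[OF eventually_nhds_ball]) auto
  have x0: "?x 0 = \<xi> d x" using local_rep_chart[OF dd d(2), of "\<xi> d"] d(3) by simp
  have "form_residue A x (fmult q \<xi>) = residue (local_rep d (fmult q \<xi> d)) 0"
    unfolding form_residue_def d_def Let_def ..
  also have "\<dots> = residue (\<lambda>z. g z * ?x z / (z - 0)) 0"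
  proof (rule residue_cong)
    show "\<forall>\<^sub>F z in at 0. local_rep d (fmult q \<xi> d) z = g z * ?x z / (z - 0)"
      using ev by eventually_elim (use \<rho>(3) in \<open>simp add: local_rep_def fmult_def s_def\<close>)
  qed simp
  also have "\<dots> = g 0 * ?x 0"
    by (rule residue_simple[OF open_ball _ holo]) (use s in auto)
  finally have res: "form_residue A x (fmult q \<xi>) = g 0 * \<xi> d x" using x0 by simp
  have "continuous_on (fst d \<inter> UNIV) (\<eta> d)" using \<eta>(1) d unfolding continuous_field_def by blast
  hence "continuous_on (snd d ` (fst d \<inter> UNIV)) (local_rep d (\<eta> d))" by (rule continuous_on_local_rep[OF dd])
  moreover have "open (snd d ` (fst d \<inter> UNIV))" using dd by (intro open_chart_image) auto
  moreover have "0 \<in> snd d ` (fst d \<inter> UNIV)" using d by (intro image_eqI[of _ _ x]) auto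
  ultimately have "(local_rep d (\<eta> d) \<longlongrightarrow> local_rep d (\<eta> d) 0) (at 0)"
    by (metis continuous_on_def at_within_open)
  also have "local_rep d (\<eta> d) 0 = \<xi> d x"
    using local_rep_chart[OF dd d(2), of "\<eta> d"] d \<eta>(2) by simp
  finally have e: "(local_rep d (\<eta> d) \<longlongrightarrow> \<xi> d x) (at 0)" .
  have "(g \<longlongrightarrow> g 0) (at 0)"
    using holomorphic_on_imp_continuous_on[OF \<rho>(2)] \<rho>(1) by (metis centre_in_ball continuous_on_def open_ball at_within_open)
  hence "((\<lambda>z. g z * local_rep d (\<eta> d) z) \<longlongrightarrow> g 0 * \<xi> d x) (at 0)"
    by (intro tendsto_mult e)
  moreover have "\<forall>\<^sub>F z in at 0. g z * local_rep d (\<eta> d) z = (z - 0) * local_rep d (fmult q \<eta> d) z"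
    using ev by eventually_elim (use \<rho>(3) in \<open>simp add: local_rep_def fmult_def s_def\<close>)
  ultimately have "((\<lambda>z. (z - 0) * local_rep d (fmult q \<eta> d) z) \<longlongrightarrow> g 0 * \<xi> d x) (at 0)"
    by (simp only: tendsto_cong)
  thus thesis using that[OF d(1,2)] unfolding res d(3) by blast
qed

lemma smooth_sections_vanishing_bounded_near:
  assumes "\<nu> \<in> smooth_sections_vanishing A D a b"
  shows "bounded_near A D \<nu>"
  unfolding bounded_near_def
proof (intro ballI conjI)
  fix c assume c: "c \<in> coords A"
  have cc: "complex_chart c" using c coords_complex_chart by blast
  have C1: "C1_field A UNIV \<nu>"
    using assms by (intro smooth_field_imp_C1_field) (auto simp: smooth_sections_vanishing_def)
  show "continuous_on (fst c \<inter> - D) (\<nu> c)"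
    by (rule continuous_on_subset[OF C1_field_continuous_on[OF C1 c]]) auto
  fix x assume x: "x \<in> D \<inter> fst c"
  let ?U = "snd c ` (fst c \<inter> UNIV)"
  have cont: "continuous_on ?U (local_rep c (\<nu> c))"
    using C1 c C1_on_imp_continuous_on unfolding C1_field_def by blast
  have "open ?U" using cc by (intro open_chart_image) auto
  moreover have "snd c x \<in> ?U" using x by blast
  ultimately obtain \<rho> where \<rho>: "\<rho> > 0" "cball (snd c x) \<rho> \<subseteq> ?U"
    using open_contains_cball by blast
  have "compact (local_rep c (\<nu> c) ` cball (snd c x) \<rho>)"
    by (intro compact_continuous_image continuous_on_subset[OF cont \<rho>(2)]) auto
  then obtain M where "\<And>z. z \<in> cball (snd c x) \<rho> \<Longrightarrow> norm (local_rep c (\<nu> c) z) \<le> M"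
    using compact_imp_bounded bounded_iff by (metis imageI)
  hence "\<forall>z\<in>(ball (snd c x) \<rho> - {snd c x}) \<inter> snd c ` fst c. norm (local_rep c (\<nu> c) z) \<le> M" by auto
  thus "\<exists>\<rho>>0. \<exists>K. \<forall>z\<in>(ball (snd c x) \<rho> - {snd c x}) \<inter> snd c ` fst c. norm (local_rep c (\<nu> c) z) \<le> K"
    using \<rho>(1) by blast
qed

lemma beltrami_differential_bounded_near:
  assumes D: "finite D" and \<mu>: "beltrami_differential A D \<mu>"
  shows "bounded_near A D \<mu>"
  unfolding bounded_near_def
proof (intro ballI conjI)
  fix c assume c: "c \<in> coords A"
  have "C1_field A (- D) \<mu>"
    using \<mu> D unfolding beltrami_differential_def
    by (intro smooth_field_imp_C1_field open_Compl finite_imp_closed) auto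
  thus "continuous_on (fst c \<inter> - D) (\<mu> c)" by (rule C1_field_continuous_on[OF _ c])
  fix x assume "x \<in> D \<inter> fst c"
  thus "\<exists>\<rho>>0. \<exists>K. \<forall>z\<in>(ball (snd c x) \<rho> - {snd c x}) \<inter> snd c ` fst c. norm (local_rep c (\<mu> c) z) \<le> K"
    using \<mu> c unfolding beltrami_differential_def by blast
qed

lemma smooth_sections_vanishing_at:
  assumes "\<eta> \<in> smooth_sections_vanishing A D a b" "c \<in> coords A" "x \<in> D" "x \<in> fst c"
  shows "\<eta> c x = 0"
proof -
  have cc: "complex_chart c" using assms(2) coords_complex_chart by blast
  obtain \<rho> h where "\<rho> > 0" "\<forall>z \<in> ball (snd c x) \<rho> \<inter> snd c ` fst c. local_rep c (\<eta> c) z = (z - snd c x) * h z"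
    using assms unfolding smooth_sections_vanishing_def by blast
  hence "local_rep c (\<eta> c) (snd c x) = 0" using assms(4) by auto
  thus ?thesis using cc assms(4) by simp
qed

text \<open>The Serre pairing of a quadratic differential with at most simple poles on \<open>D\<close>, computed from any
  Cech--Dolbeault representative.\<close>

theorem serre_pairing_cech_dolbeault:
  assumes comp: "compact (UNIV :: 'c set)" and inj: "inj_on p {1..r}"
    and q: "tensor_field A 2 0 (- (p ` {1..r})) q" "holomorphic_field A (- (p ` {1..r})) q"
      "simple_pole_field A (p ` {1..r}) q"
    and Y: "Y \<in> H1_tangent_log A (p ` {1..r})"
    and \<mu>: "beltrami_differential A (p ` {1..r}) \<mu>"
    and \<xi>: "\<And>i. i \<in> {1..r} \<Longrightarrow> local_holomorphic_vector_field A (p i) (\<xi> i)"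
    and rep: "represents_class A r p Y \<mu> \<xi>"
  shows "serre_pairing A (p ` {1..r}) q Y = trace_integral A (- (p ` {1..r})) (fmult q \<mu>) +
     (\<Sum>i=1..r. form_residue A (p i) (fmult q (\<xi> i)))"
proof -
  define D where "D = p ` {1..r}"
  have D: "finite D" by (simp add: D_def)
  have opD: "open (- D)" using D by (intro open_Compl finite_imp_closed)
  note q' = q[folded D_def]
  obtain \<nu> \<eta> where \<nu>: "\<nu> \<in> Y" and \<eta>: "tensor_field A (-1) 0 UNIV \<eta>" "continuous_field A UNIV \<eta>"
      "smooth_field A (- D) \<eta>"
    and \<nu>\<mu>: "\<forall>c\<in>coords A. \<forall>x\<in>fst c - D. \<nu> c x = \<mu> c x + dbar \<eta> c x"
    and \<eta>\<xi>: "\<forall>i\<in>{1..r}. \<forall>c\<in>coords A. p i \<in> fst c \<longrightarrow> \<eta> c (p i) = \<xi> i c (p i)"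
    using rep unfolding represents_class_def D_def[symmetric] by blast
  define \<nu>\<^sub>0 where "\<nu>\<^sub>0 = (SOME \<nu>. \<nu> \<in> Y)"
  have \<nu>0Y: "\<nu>\<^sub>0 \<in> Y" unfolding \<nu>\<^sub>0_def using someI_ex[of "\<lambda>\<nu>. \<nu> \<in> Y"] \<nu> by blast
  obtain \<nu>\<^sub>1 where "Y = dolbeault_rel A D `` {\<nu>\<^sub>1}"
    using Y unfolding H1_tangent_log_def D_def[symmetric] by (rule quotientE)
  hence r1: "(\<nu>\<^sub>1, \<nu>) \<in> dolbeault_rel A D" and r0: "(\<nu>\<^sub>1, \<nu>\<^sub>0) \<in> dolbeault_rel A D" using \<nu> \<nu>0Y by auto
  obtain \<eta>\<^sub>1 where \<eta>1: "\<eta>\<^sub>1 \<in> smooth_sections_vanishing A D (-1) 0"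
      "\<forall>c\<in>coords A. \<forall>x\<in>fst c. \<nu>\<^sub>1 c x = \<nu> c x + dbar \<eta>\<^sub>1 c x"
    using r1 unfolding dolbeault_rel_def by blast
  obtain \<eta>\<^sub>2 where \<eta>2: "\<eta>\<^sub>2 \<in> smooth_sections_vanishing A D (-1) 0"
      "\<forall>c\<in>coords A. \<forall>x\<in>fst c. \<nu>\<^sub>1 c x = \<nu>\<^sub>0 c x + dbar \<eta>\<^sub>2 c x"
    using r0 unfolding dolbeault_rel_def by blast
  have \<nu>0: "\<nu>\<^sub>0 \<in> smooth_sections_vanishing A D (-1) 1" using r0 unfolding dolbeault_rel_def by blast
  \<comment> \<open>The representative that enters the pairing is related to the one that witnesses \<open>rep\<close> by
    fields vanishing on \<open>D\<close>. Absorbing these into \<open>\<eta>\<close> does not change its values on \<open>D\<close>.\<close>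
  define \<eta>' where "\<eta>' = (\<lambda>c x. (\<eta> c x + \<eta>\<^sub>1 c x) - \<eta>\<^sub>2 c x)"
  have t1: "tensor_field A (-1) 0 UNIV \<eta>\<^sub>1" "tensor_field A (-1) 0 UNIV \<eta>\<^sub>2"
    and s1: "smooth_field A UNIV \<eta>\<^sub>1" "smooth_field A UNIV \<eta>\<^sub>2"
    using \<eta>1(1) \<eta>2(1) unfolding smooth_sections_vanishing_def by auto
  have C1u: "C1_field A UNIV \<eta>\<^sub>1" "C1_field A UNIV \<eta>\<^sub>2"
    by (intro smooth_field_imp_C1_field s1 open_UNIV)+
  have C1: "C1_field A (- D) \<eta>" "C1_field A (- D) \<eta>\<^sub>1" "C1_field A (- D) \<eta>\<^sub>2"
    by (rule smooth_field_imp_C1_field[OF \<eta>(3) opD], rule C1_field_subset[OF C1u(1)], simp,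
        rule C1_field_subset[OF C1u(2)], simp)
  have t': "tensor_field A (-1) 0 UNIV \<eta>'"
    unfolding \<eta>'_def by (intro tensor_field_diff tensor_field_add \<eta>(1) t1)
  have C1': "C1_field A (- D) \<eta>'"
    unfolding \<eta>'_def by (intro C1_field_diff C1_field_add C1)
  have cont': "continuous_field A UNIV \<eta>'"
    unfolding continuous_field_def \<eta>'_def
  proof (intro ballI continuous_on_diff continuous_on_add)
    fix c assume c: "c \<in> coords A"
    show "continuous_on (fst c \<inter> UNIV) (\<eta> c)" using \<eta>(2) c unfolding continuous_field_def by blast
    show "continuous_on (fst c \<inter> UNIV) (\<eta>\<^sub>1 c)" "continuous_on (fst c \<inter> UNIV) (\<eta>\<^sub>2 c)"
      by (rule C1_field_continuous_on[OF _ c], rule C1u)+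
  qed
  have val': "\<eta>' c (p i) = \<xi> i c (p i)" if "i \<in> {1..r}" "c \<in> coords A" "p i \<in> fst c" for i c
  proof -
    have "p i \<in> D" using that by (auto simp: D_def)
    thus ?thesis unfolding \<eta>'_def
      using smooth_sections_vanishing_at[OF \<eta>1(1) that(2) _ that(3)]
        smooth_sections_vanishing_at[OF \<eta>2(1) that(2) _ that(3)] \<eta>\<xi> that by simp
  qed
  have dbar': "dbar \<eta>' c x = \<nu>\<^sub>0 c x - \<mu> c x" if c: "c \<in> coords A" "x \<in> fst c" "x \<notin> D" for c x
  proof -
    have x: "x \<in> - D" using c by simp
    have e1: "dbar \<eta>' c x = dbar \<eta> c x + dbar \<eta>\<^sub>1 c x - dbar \<eta>\<^sub>2 c x"
      unfolding \<eta>'_def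
      by (simp only: dbar_diff[OF C1_field_add[OF C1(1,2)] C1(3) c(1,2) x] dbar_add[OF C1(1,2) c(1,2) x])
    have e2: "\<nu> c x = \<mu> c x + dbar \<eta> c x" using \<nu>\<mu> c by blast
    have e3: "\<nu>\<^sub>1 c x = \<nu> c x + dbar \<eta>\<^sub>1 c x" using \<eta>1(2) c by blast
    have e4: "\<nu>\<^sub>1 c x = \<nu>\<^sub>0 c x + dbar \<eta>\<^sub>2 c x" using \<eta>2(2) c by blast
    hence "\<nu>\<^sub>0 c x = \<nu>\<^sub>1 c x - dbar \<eta>\<^sub>2 c x" by simp
    thus ?thesis unfolding e3 e2 e1 by simp
  qed
  define \<omega> where "\<omega> = fmult q \<eta>'"
  have t\<omega>: "tensor_field A 1 0 (- D) \<omega>"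
    using tensor_field_fmult[OF q'(1) tensor_field_subset[OF t', of "- D"]] by (simp add: \<omega>_def)
  have holo: "local_rep c (q c) holomorphic_on snd c ` (fst c \<inter> - D)"
    and opc: "open (snd c ` (fst c \<inter> - D))" if "c \<in> coords A" for c
    using q'(2) that opD open_chart_image[OF coords_complex_chart[OF that]]
    unfolding holomorphic_field_def by blast+
  have C1q: "C1_field A (- D) q"
    unfolding C1_field_def using C1_on_holomorphic holo opc by blast
  have C1\<omega>: "C1_field A (- D) \<omega>"
    unfolding C1_field_def
  proof
    fix c assume c: "c \<in> coords A"
    have "C1_on (snd c ` (fst c \<inter> - D)) (\<lambda>z. local_rep c (q c) z * local_rep c (\<eta>' c) z)"
      using C1q C1' c unfolding C1_field_def by (intro C1_on_mult) auto
    thus "C1_on (snd c ` (fst c \<inter> - D)) (local_rep c (\<omega> c))"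
      by (simp add: \<omega>_def fmult_def local_rep_def o_def)
  qed
  have dbar\<omega>: "dbar \<omega> c x = q c x * (\<nu>\<^sub>0 c x - \<mu> c x)" if c: "c \<in> coords A" "x \<in> fst c" "x \<notin> D" for c x
  proof -
    have cc: "complex_chart c" using c coords_complex_chart by blast
    have x: "x \<in> - D" using c by simp
    have "dbar \<omega> c x = wirtinger_dbar (\<lambda>z. local_rep c (q c) z * local_rep c (\<eta>' c) z) (snd c x)"
      by (simp add: dbar_def \<omega>_def fmult_def local_rep_def o_def)
    also have "\<dots> = local_rep c (q c) (snd c x) * wirtinger_dbar (local_rep c (\<eta>' c)) (snd c x) +
        wirtinger_dbar (local_rep c (q c)) (snd c x) * local_rep c (\<eta>' c) (snd c x)"
      by (rule wirtinger_dbar_mult[OF C1_field_differentiable[OF C1q c(1,2) x] C1_field_differentiable[OF C1' c(1,2) x]])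
    also have "wirtinger_dbar (local_rep c (q c)) (snd c x) = 0"
    proof (rule wirtinger_dbar_holomorphic)
      have "snd c x \<in> snd c ` (fst c \<inter> - D)" using c by blast
      thus "local_rep c (q c) field_differentiable at (snd c x)"
        using holo[OF c(1)] opc[OF c(1)] holomorphic_on_imp_differentiable_at by blast
    qed
    also have "wirtinger_dbar (local_rep c (\<eta>' c)) (snd c x) = \<nu>\<^sub>0 c x - \<mu> c x"
      using dbar'[OF c] by (simp add: dbar_def)
    finally show ?thesis using cc c(2) by simp
  qed
  have bn: "bounded_near A D \<nu>\<^sub>0" "bounded_near A D \<mu>"
    using smooth_sections_vanishing_bounded_near[OF \<nu>0]
      beltrami_differential_bounded_near[OF D \<mu>[folded D_def]] by auto
  have mild: "mild_singularities A D (fmult q \<nu>\<^sub>0)" "mild_singularities A D (fmult q \<mu>)"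
    by (intro mild_singularities_fmult D q' bn)+
  have mild\<omega>: "mild_singularities A D (dbar \<omega>)"
  proof (rule mild_singularities_cong[OF D])
    have "bounded_near A D (\<lambda>c x. \<nu>\<^sub>0 c x - \<mu> c x)"
      unfolding bounded_near_def
    proof (intro ballI conjI continuous_on_diff)
      fix c assume c: "c \<in> coords A"
      show "continuous_on (fst c \<inter> - D) (\<nu>\<^sub>0 c)" "continuous_on (fst c \<inter> - D) (\<mu> c)"
        using bn c unfolding bounded_near_def by blast+
      fix x assume x: "x \<in> D \<inter> fst c"
      obtain \<rho>1 K1 where 1: "\<rho>1 > 0" "\<forall>z\<in>(ball (snd c x) \<rho>1 - {snd c x}) \<inter> snd c ` fst c. norm (local_rep c (\<nu>\<^sub>0 c) z) \<le> K1"
        using bn(1) c x unfolding bounded_near_def by blast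
      obtain \<rho>2 K2 where 2: "\<rho>2 > 0" "\<forall>z\<in>(ball (snd c x) \<rho>2 - {snd c x}) \<inter> snd c ` fst c. norm (local_rep c (\<mu> c) z) \<le> K2"
        using bn(2) c x unfolding bounded_near_def by blast
      have "\<forall>z\<in>(ball (snd c x) (min \<rho>1 \<rho>2) - {snd c x}) \<inter> snd c ` fst c.
          norm (local_rep c (\<lambda>x. \<nu>\<^sub>0 c x - \<mu> c x) z) \<le> K1 + K2"
      proof
        fix z assume z: "z \<in> (ball (snd c x) (min \<rho>1 \<rho>2) - {snd c x}) \<inter> snd c ` fst c"
        have "norm (local_rep c (\<nu>\<^sub>0 c) z - local_rep c (\<mu> c) z) \<le> norm (local_rep c (\<nu>\<^sub>0 c) z) + norm (local_rep c (\<mu> c) z)"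
          by (rule norm_triangle_ineq4)
        also have "\<dots> \<le> K1 + K2" using 1(2) 2(2) z by (intro add_mono) auto
        finally show "norm (local_rep c (\<lambda>x. \<nu>\<^sub>0 c x - \<mu> c x) z) \<le> K1 + K2" by (simp add: local_rep_def)
      qed
      moreover have "min \<rho>1 \<rho>2 > 0" using 1 2 by simp
      ultimately show "\<exists>\<rho>>0. \<exists>K. \<forall>z\<in>(ball (snd c x) \<rho> - {snd c x}) \<inter> snd c ` fst c.
          norm (local_rep c (\<lambda>x. \<nu>\<^sub>0 c x - \<mu> c x) z) \<le> K" by blast
    qed
    thus "mild_singularities A D (fmult q (\<lambda>c x. \<nu>\<^sub>0 c x - \<mu> c x))"
      by (intro mild_singularities_fmult D q')
  qed (use dbar\<omega> in \<open>simp add: fmult_def\<close>)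
  have tq: "tensor_field A 1 1 (- D) (fmult q \<nu>\<^sub>0)" "tensor_field A 1 1 (- D) (fmult q \<mu>)"
  proof -
    have "tensor_field A (-1) 1 (- D) \<nu>\<^sub>0"
      by (rule tensor_field_subset[of _ _ _ UNIV]) (use \<nu>0 in \<open>auto simp: smooth_sections_vanishing_def\<close>)
    from tensor_field_fmult[OF q'(1) this] show "tensor_field A 1 1 (- D) (fmult q \<nu>\<^sub>0)" by simp
    have "tensor_field A (-1) 1 (- D) \<mu>" using \<mu> unfolding beltrami_differential_def D_def by blast
    from tensor_field_fmult[OF q'(1) this] show "tensor_field A 1 1 (- D) (fmult q \<mu>)" by simp
  qed
  define L where "L = (\<lambda>x. form_residue A x (fmult q (\<xi> (the_inv_into {1..r} p x))))"
  have lim: "((\<lambda>z. (z - snd c x) * local_rep c (\<omega> c) z) \<longlongrightarrow> L x) (at (snd c x))"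
    if c: "c \<in> coords A" and x: "x \<in> D" "x \<in> fst c" for c x
  proof -
    obtain i where i: "i \<in> {1..r}" "x = p i" using x by (auto simp: D_def)
    have Lx: "L x = form_residue A x (fmult q (\<xi> i))"
      unfolding L_def i(2) using the_inv_into_f_f[OF inj i(1)] by simp
    obtain d where d: "d \<in> coords A" "x \<in> fst d"
      "((\<lambda>z. (z - snd d x) * local_rep d (fmult q \<eta>' d) z) \<longlongrightarrow> form_residue A x (fmult q (\<xi> i))) (at (snd d x))"
      using simple_pole_residue[OF q'(3) x(1) \<xi>[OF i(1), folded i(2)] cont' val'[OF i(1), folded i(2)]] .
    show ?thesis
      by (rule residue_limit_invariant[OF D t\<omega> c x(2) d(1,2)]) (use d(3) in \<open>simp add: Lx \<omega>_def\<close>)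
  qed
  have "form_integral A (- D) (fmult q \<nu>\<^sub>0) = form_integral A (- D) (fmult q \<mu>) + form_integral A (- D) (dbar \<omega>)"
  proof (rule form_integral_mild_add[OF atlas comp D tq(2) mild(2) _ mild\<omega> tq(1)])
    show "tensor_field A 1 1 (- D) (dbar \<omega>)" by (rule tensor_field_dbar[OF atlas t\<omega> C1\<omega> opD])
    fix c x assume "c \<in> coords A" "x \<in> fst c" "x \<notin> D"
    thus "fmult q \<nu>\<^sub>0 c x = fmult q \<mu> c x + dbar \<omega> c x"
      using dbar\<omega> by (simp add: fmult_def algebra_simps)
  qed
  also have "form_integral A (- D) (dbar \<omega>) = 2 * of_real pi * \<i> * (\<Sum>x\<in>D. L x)"
    by (rule stokes_residues[OF atlas comp D t\<omega> C1\<omega> mild\<omega> lim])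
  also have "(\<Sum>x\<in>D. L x) = (\<Sum>i\<in>{1..r}. L (p i))"
    unfolding D_def by (rule sum.reindex[OF inj, unfolded o_def])
  also have "\<dots> = (\<Sum>i=1..r. form_residue A (p i) (fmult q (\<xi> i)))"
    unfolding L_def using the_inv_into_f_f[OF inj] by (intro sum.cong refl) simp
  finally show ?thesis
    unfolding serre_pairing_def trace_integral_def D_def[symmetric] \<nu>\<^sub>0_def[symmetric]
    by (simp add: add_divide_distrib)
qed

end

section \<open>The quadratic differential of a Higgs bundle\<close>

lemma holomorphic_on_hermitian_inner:
  assumes "\<And>i j. (\<lambda>z. F z $ i $ j) holomorphic_on S"
  shows "(\<lambda>z. hermitian_inner (F z) b) holomorphic_on S"
  unfolding hermitian_inner_def by (intro holomorphic_intros assms)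

context
  fixes A :: "'c::t2_space chart set" and D :: "'c set"
    and G :: "(complex^'n^'n) set" and B :: "complex^'n^'n \<Rightarrow> complex^'n^'n \<Rightarrow> complex"
    and P :: "('c, 'p, 'n) gbundle" and \<Phi> :: "('c, 'p, 'n) adfield"
  assumes atlas: "holomorphic_atlas A" and D: "finite D"
    and red: "connected_complex_reductive G" and B: "invariant_form G B"
    and higgs: "log_higgs_bundle A D G P \<Phi>" and nil: "nilpotent_residues A D G P \<Phi>"
begin

lemma principal_bundle: "holomorphic_principal_bundle A G P"
  using higgs unfolding log_higgs_bundle_def by blast

lemma section_cover: "\<exists>\<sigma>\<in>sects P. x \<in> fst \<sigma>"
  using principal_bundle unfolding holomorphic_principal_bundle_def by blast

lemma section_point:
  assumes "\<sigma> \<in> sects P" "x \<in> fst \<sigma>"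
  shows "snd \<sigma> x \<in> total P" "proj P (snd \<sigma> x) = x"
  using assms principal_bundle unfolding holomorphic_principal_bundle_def holomorphic_section_def by blast+

lemma higgs_in_lie_algebra:
  "c \<in> coords A \<Longrightarrow> u \<in> total P \<Longrightarrow> proj P u \<in> fst c - D \<Longrightarrow> \<Phi> c u \<in> lie_algebra G"
  using higgs unfolding log_higgs_bundle_def by blast

text \<open>By invariance of \<open>B\<close>, every point of the fibre gives the same value.\<close>

lemma higgs_square_eq:
  assumes c: "c \<in> coords A" and u: "u \<in> total P" "proj P u = x" and x: "x \<in> fst c" "x \<notin> D"
  shows "higgs_square B P \<Phi> c x = B (\<Phi> c u) (\<Phi> c u)"
proof -
  define u0 where "u0 = (SOME u. u \<in> total P \<and> proj P u = x)"
  have "u0 \<in> total P \<and> proj P u0 = x"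
    unfolding u0_def using someI_ex[of "\<lambda>u. u \<in> total P \<and> proj P u = x"] u by blast
  then obtain a where a: "a \<in> G" "u0 = act P u a"
    using principal_bundle u unfolding holomorphic_principal_bundle_def by metis
  have ux: "proj P u \<in> fst c - D" using u x by blast
  have "\<Phi> c u0 = Ad (matrix_inv a) (\<Phi> c u)"
    using higgs c u(1) ux a unfolding log_higgs_bundle_def by blast
  moreover have "matrix_inv a \<in> G" by (rule inv_in_group[OF red a(1)])
  moreover have "\<Phi> c u \<in> lie_algebra G" by (rule higgs_in_lie_algebra[OF c u(1) ux])
  ultimately have "B (\<Phi> c u0) (\<Phi> c u0) = B (\<Phi> c u) (\<Phi> c u)"
    using B unfolding invariant_form_def by simp
  thus ?thesis unfolding higgs_square_def u0_def Let_def .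
qed

lemma tensor_field_higgs_square: "tensor_field A 2 0 (- D) (higgs_square B P \<Phi>)"
  unfolding tensor_field_def
proof (intro ballI)
  fix c d x assume c: "c \<in> coords A" and d: "d \<in> coords A" and x: "x \<in> fst c \<inter> fst d \<inter> - D"
  obtain \<sigma> where \<sigma>: "\<sigma> \<in> sects P" "x \<in> fst \<sigma>" using section_cover by blast
  define u where "u = snd \<sigma> x"
  have u: "u \<in> total P" "proj P u = x" using section_point[OF \<sigma>] by (simp_all add: u_def)
  let ?t = "deriv (transition c d) (snd c x)"
  have xc: "x \<in> fst c" "x \<in> fst d" "x \<notin> D" using x by auto
  have "proj P u \<in> fst c \<inter> fst d - D" using u xc by blast
  hence eq: "\<Phi> c u = cscale ?t (\<Phi> d u)"
    using higgs c d u unfolding log_higgs_bundle_def by metis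
  have L: "\<Phi> c u \<in> lie_algebra G" "\<Phi> d u \<in> lie_algebra G"
    using u xc by (intro higgs_in_lie_algebra c d; blast)+
  obtain C \<beta> where C: "finite C" "\<forall>X\<in>lie_algebra G. \<forall>Y\<in>lie_algebra G.
     B X Y = (\<Sum>b\<in>C. \<Sum>b'\<in>C. \<beta> b b' * (hermitian_inner X b * hermitian_inner Y b'))"
    using invariant_form_expand[OF red B] by blast
  note expand = C(2)[rule_format, OF L(1) L(1), unfolded eq hermitian_inner_cscale]
  have "B (\<Phi> c u) (\<Phi> c u) = ?t ^ 2 * B (\<Phi> d u) (\<Phi> d u)"
    unfolding eq expand C(2)[rule_format, OF L(2) L(2)] sum_distrib_left
    by (intro sum.cong refl) (simp add: power2_eq_square)
  thus "higgs_square B P \<Phi> c x = higgs_square B P \<Phi> d x * ?t powi 2 * cnj ?t powi 0"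
    unfolding higgs_square_eq[OF c u xc(1,3)] higgs_square_eq[OF d u xc(2,3)]
    by (simp add: power_int_def)
qed

lemma higgs_square_local:
  assumes c: "c \<in> coords A" and \<sigma>: "\<sigma> \<in> sects P"
    and C: "\<forall>X\<in>lie_algebra G. \<forall>Y\<in>lie_algebra G.
     B X Y = (\<Sum>b\<in>C. \<Sum>b'\<in>C. \<beta> b b' * (hermitian_inner X b * hermitian_inner Y b'))"
    and z: "z \<in> snd c ` (fst c \<inter> (fst \<sigma> \<inter> - D))"
  defines "F \<equiv> local_rep c (\<Phi> c \<circ> snd \<sigma>)"
  shows "local_rep c (higgs_square B P \<Phi> c) z =
    (\<Sum>b\<in>C. \<Sum>b'\<in>C. \<beta> b b' * (hermitian_inner (F z) b * hermitian_inner (F z) b'))"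
proof -
  have cc: "complex_chart c" using c coords_complex_chart by blast
  obtain x where x: "x \<in> fst c" "x \<in> fst \<sigma>" "x \<notin> D" "z = snd c x" using z by blast
  have u: "snd \<sigma> x \<in> total P" "proj P (snd \<sigma> x) = x" using section_point[OF \<sigma> x(2)] .
  have Fz: "F z = \<Phi> c (snd \<sigma> x)" unfolding F_def x(4) local_rep_chart[OF cc x(1)] by simp
  have L: "\<Phi> c (snd \<sigma> x) \<in> lie_algebra G" using u x by (intro higgs_in_lie_algebra c) auto
  have "local_rep c (higgs_square B P \<Phi> c) z = B (\<Phi> c (snd \<sigma> x)) (\<Phi> c (snd \<sigma> x))"
    unfolding x(4) local_rep_chart[OF cc x(1)] by (rule higgs_square_eq[OF c u x(1,3)])
  thus ?thesis unfolding Fz using C[rule_format, OF L L] by simp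
qed

lemma open_section_image:
  assumes c: "c \<in> coords A" and \<sigma>: "\<sigma> \<in> sects P"
  shows "open (snd c ` (fst c \<inter> (fst \<sigma> \<inter> - D)))"
proof -
  have "open (fst \<sigma>)"
    using principal_bundle \<sigma> unfolding holomorphic_principal_bundle_def holomorphic_section_def by blast
  thus ?thesis using coords_complex_chart[OF c] D
    by (intro open_chart_image open_Int open_Compl finite_imp_closed)
qed

lemma holomorphic_field_higgs_square: "holomorphic_field A (- D) (higgs_square B P \<Phi>)"
  unfolding holomorphic_field_def
proof
  fix c assume c: "c \<in> coords A"
  obtain C \<beta> where C: "finite C" "\<forall>X\<in>lie_algebra G. \<forall>Y\<in>lie_algebra G.
     B X Y = (\<Sum>b\<in>C. \<Sum>b'\<in>C. \<beta> b b' * (hermitian_inner X b * hermitian_inner Y b'))"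
    using invariant_form_expand[OF red B] by blast
  have "local_rep c (higgs_square B P \<Phi> c) holomorphic_on
      (\<Union>\<sigma>\<in>sects P. snd c ` (fst c \<inter> (fst \<sigma> \<inter> - D)))"
  proof (rule holomorphic_on_UN_open)
    fix \<sigma> assume \<sigma>: "\<sigma> \<in> sects P"
    let ?S = "snd c ` (fst c \<inter> (fst \<sigma> \<inter> - D))" and ?F = "local_rep c (\<Phi> c \<circ> snd \<sigma>)"
    show "open ?S" by (rule open_section_image[OF c \<sigma>])
    have "(\<lambda>z. ?F z $ i $ j) holomorphic_on ?S" for i j
    proof -
      have "(\<lambda>z. ?F z $ i $ j) holomorphic_on snd c ` (fst c \<inter> fst \<sigma> - D)"
        using higgs c \<sigma> unfolding log_higgs_bundle_def by blast
      moreover have "fst c \<inter> fst \<sigma> - D = fst c \<inter> (fst \<sigma> \<inter> - D)" by blast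
      ultimately show ?thesis by (simp only:)
    qed
    hence "(\<lambda>z. \<Sum>b\<in>C. \<Sum>b'\<in>C. \<beta> b b' * (hermitian_inner (?F z) b * hermitian_inner (?F z) b')) holomorphic_on ?S"
      by (intro holomorphic_on_sum holomorphic_on_mult holomorphic_on_const holomorphic_on_hermitian_inner)
    thus "local_rep c (higgs_square B P \<Phi> c) holomorphic_on ?S"
      by (rule holomorphic_transform) (rule higgs_square_local[OF c \<sigma> C(2), symmetric])
  qed
  also have "(\<Union>\<sigma>\<in>sects P. snd c ` (fst c \<inter> (fst \<sigma> \<inter> - D))) = snd c ` (fst c \<inter> - D)"
    using section_cover by blast
  finally show "local_rep c (higgs_square B P \<Phi> c) holomorphic_on snd c ` (fst c \<inter> - D)" .
qed

text \<open>The coefficient of $1/(z-z_0)^2$ is $B(N,N)$ for the nilpotent residue \<open>N\<close>.\<close>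

lemma simple_pole_field_higgs_square: "simple_pole_field A D (higgs_square B P \<Phi>)"
  unfolding simple_pole_field_def
proof (intro ballI)
  fix c x assume c: "c \<in> coords A" and x: "x \<in> D \<inter> fst c"
  obtain C \<beta> where C: "finite C" "\<forall>X\<in>lie_algebra G. \<forall>Y\<in>lie_algebra G.
     B X Y = (\<Sum>b\<in>C. \<Sum>b'\<in>C. \<beta> b b' * (hermitian_inner X b * hermitian_inner Y b'))"
    using invariant_form_expand[OF red B] by blast
  obtain \<sigma> where \<sigma>: "\<sigma> \<in> sects P" "x \<in> fst \<sigma>" using section_cover by blast
  let ?z = "snd c x" and ?F = "local_rep c (\<Phi> c \<circ> snd \<sigma>)"
  have x\<sigma>: "x \<in> D \<inter> fst c \<inter> fst \<sigma>" using x \<sigma> by blast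
  obtain N where log: "log_expansion ?F ?z N"
    using higgs \<sigma>(1) c x\<sigma> unfolding log_higgs_bundle_def by blast
  hence nilN: "nilpotent_element (lie_algebra G) N"
    using nil \<sigma>(1) c x\<sigma> unfolding nilpotent_residues_def by blast
  have NL: "N \<in> lie_algebra G"
    using nilN lie_derived_subset[OF red] unfolding nilpotent_element_def by auto
  have BN: "(\<Sum>b\<in>C. \<Sum>b'\<in>C. \<beta> b b' * (hermitian_inner N b * hermitian_inner N b')) = 0"
    using invariant_form_nilpotent[OF red B nilN] C(2)[rule_format, OF NL NL] by simp
  obtain \<rho>1 R where \<rho>1: "\<rho>1 > 0" "\<forall>i j. (\<lambda>z. R z $ i $ j) holomorphic_on ball ?z \<rho>1"
    "\<forall>z \<in> ball ?z \<rho>1 - {?z}. ?F z = cscale (1 / (z - ?z)) N + R z"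
    using log unfolding log_expansion_def by blast
  have op: "open (fst \<sigma>)"
    using principal_bundle \<sigma> unfolding holomorphic_principal_bundle_def holomorphic_section_def by blast
  have xc: "x \<in> fst c" using x by blast
  obtain \<rho>2 where \<rho>2: "\<rho>2 > 0" "ball ?z \<rho>2 - {?z} \<subseteq> snd c ` (fst c \<inter> (fst \<sigma> \<inter> - D))"
    "ball ?z \<rho>2 \<subseteq> snd c ` (fst c \<inter> fst \<sigma>)"
    using open_punctured_chart_image[OF atlas c D xc op \<sigma>(2)] .
  define \<rho> where "\<rho> = min \<rho>1 \<rho>2"
  define g where "g = (\<lambda>z. (\<Sum>b\<in>C. \<Sum>b'\<in>C. \<beta> b b' *
      (hermitian_inner N b * hermitian_inner (R z) b' + hermitian_inner (R z) b * hermitian_inner N b')) +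
      (z - ?z) * (\<Sum>b\<in>C. \<Sum>b'\<in>C. \<beta> b b' * (hermitian_inner (R z) b * hermitian_inner (R z) b')))"
  have hR: "(\<lambda>z. hermitian_inner (R z) b) holomorphic_on ball ?z \<rho>" for b
    by (rule holomorphic_on_subset[OF holomorphic_on_hermitian_inner[of R "ball ?z \<rho>1"]])
      (use \<rho>1(2) in \<open>auto simp: \<rho>_def\<close>)
  have "g holomorphic_on ball ?z \<rho>"
    unfolding g_def by (intro holomorphic_intros hR)
  moreover have "\<forall>z\<in>ball ?z \<rho> - {?z}. local_rep c (higgs_square B P \<Phi> c) z = g z / (z - ?z)"
  proof
    fix z assume z: "z \<in> ball ?z \<rho> - {?z}"
    have z1: "z \<in> ball ?z \<rho>1 - {?z}" "z \<in> ball ?z \<rho>2 - {?z}" using z by (auto simp: \<rho>_def)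
    let ?s = "1 / (z - ?z)"
    have s: "?s * (z - ?z) = 1" using z by simp
    have h: "hermitian_inner (?F z) b = ?s * hermitian_inner N b + hermitian_inner (R z) b" for b
      using \<rho>1(3) z1(1) by (simp only: hermitian_inner_add hermitian_inner_cscale)
    have "z \<in> snd c ` (fst c \<inter> (fst \<sigma> \<inter> - D))" using \<rho>2(2) z1(2) by blast
    from higgs_square_local[OF c \<sigma>(1) C(2) this]
    have "local_rep c (higgs_square B P \<Phi> c) z =
        (\<Sum>b\<in>C. \<Sum>b'\<in>C. \<beta> b b' * (hermitian_inner (?F z) b * hermitian_inner (?F z) b'))" .
    also have "\<dots> = (\<Sum>b\<in>C. \<Sum>b'\<in>C. ?s ^ 2 * (\<beta> b b' * (hermitian_inner N b * hermitian_inner N b')) +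
        ?s * (\<beta> b b' * (hermitian_inner N b * hermitian_inner (R z) b' + hermitian_inner (R z) b * hermitian_inner N b')) +
        \<beta> b b' * (hermitian_inner (R z) b * hermitian_inner (R z) b'))"
      unfolding h by (intro sum.cong refl) (simp only: power2_eq_square ring_distribs mult_ac add_ac)
    also have "\<dots> = ?s ^ 2 * (\<Sum>b\<in>C. \<Sum>b'\<in>C. \<beta> b b' * (hermitian_inner N b * hermitian_inner N b')) +
        ?s * (\<Sum>b\<in>C. \<Sum>b'\<in>C. \<beta> b b' *
          (hermitian_inner N b * hermitian_inner (R z) b' + hermitian_inner (R z) b * hermitian_inner N b')) +
        (\<Sum>b\<in>C. \<Sum>b'\<in>C. \<beta> b b' * (hermitian_inner (R z) b * hermitian_inner (R z) b'))"
      by (simp only: sum.distrib sum_distrib_left)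
    also have "\<dots> = g z / (z - ?z)"
      unfolding BN g_def using z by (simp add: add_divide_distrib)
    finally show "local_rep c (higgs_square B P \<Phi> c) z = g z / (z - ?z)" .
  qed
  moreover have "\<rho> > 0" using \<rho>1 \<rho>2 by (simp add: \<rho>_def)
  ultimately show "\<exists>\<rho>>0. \<exists>g. g holomorphic_on ball ?z \<rho> \<and>
      (\<forall>z\<in>ball ?z \<rho> - {?z}. local_rep c (higgs_square B P \<Phi> c) z = g z / (z - ?z))" by blast
qed

end

theorem proposition6p2:
  fixes A :: "'c::t2_space chart set"
    and g r :: nat
    and p :: "nat \<Rightarrow> 'c"
    and G :: "(complex^'n^'n) set"
    and B :: "complex^'n^'n \<Rightarrow> complex^'n^'n \<Rightarrow> complex"
    and \<F> :: "(('c, 'p, 'n) gbundle \<times> ('c, 'p, 'n) adfield) set"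
    and P :: "('c, 'p, 'n) gbundle"
    and \<Phi> :: "('c, 'p, 'n) adfield"
    and Y :: "'c field set"
    and \<mu> :: "'c field"
    and \<xi> :: "nat \<Rightarrow> 'c field"
  assumes "compact_riemann_surface A"
    and "has_genus TYPE('c) g" and "g \<ge> 2"
    and "inj_on p {1..r}"
    and "connected_complex_reductive G"
    and "invariant_form G B"
    and "nilpotent_stable_locus A (p ` {1..r}) G \<F>"
    and "(P, \<Phi>) \<in> \<F>"
    and "Y \<in> H1_tangent_log A (p ` {1..r})"
    and "beltrami_differential A (p ` {1..r}) \<mu>"
    and "\<forall>i\<in>{1..r}. local_holomorphic_vector_field A (p i) (\<xi> i)"
    and "represents_class A r p Y \<mu> \<xi>"
  shows "phi_G_log A (p ` {1..r}) B P \<Phi> Y =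
    - (1/2) * (trace_integral A (- (p ` {1..r})) (fmult (higgs_square B P \<Phi>) \<mu>) +
               (\<Sum>i=1..r. form_residue A (p i) (fmult (higgs_square B P \<Phi>) (\<xi> i))))"
proof -
  let ?D = "p ` {1..r}" and ?q = "higgs_square B P \<Phi>"
  have atlas: "holomorphic_atlas A" and comp: "compact (UNIV :: 'c set)"
    using assms(1) unfolding compact_riemann_surface_def by blast+
  have D: "finite ?D" by simp
  have higgs: "log_higgs_bundle A ?D G P \<Phi>" and nil: "nilpotent_residues A ?D G P \<Phi>"
    using assms(7,8) unfolding nilpotent_stable_locus_def by blast+
  have "serre_pairing A ?D ?q Y = trace_integral A (- ?D) (fmult ?q \<mu>) +
      (\<Sum>i=1..r. form_residue A (p i) (fmult ?q (\<xi> i)))"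
  proof (rule serre_pairing_cech_dolbeault[OF atlas comp assms(4) _ _ _ assms(9,10) _ assms(12)])
    show "tensor_field A 2 0 (- ?D) ?q"
      by (rule tensor_field_higgs_square[OF atlas D assms(5,6) higgs nil])
    show "holomorphic_field A (- ?D) ?q"
      by (rule holomorphic_field_higgs_square[OF atlas D assms(5,6) higgs nil])
    show "simple_pole_field A ?D ?q"
      by (rule simple_pole_field_higgs_square[OF atlas D assms(5,6) higgs nil])
    show "local_holomorphic_vector_field A (p i) (\<xi> i)" if "i \<in> {1..r}" for i
      using assms(11) that by blast
  qed
  thus ?thesis unfolding phi_G_log_def by simp
qed

end
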